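(* Let $0<\beta_0<\frac12$ be any fixed number and let $1<q<\infty$. There exists a constant $C$ depending only on $n, q, B_1, B_2$ and $\beta_0$ such that for every $f\in L^1(\mathbb{R}^n)\cap L^q(\mathbb{R}^n)$ the estimate $$\|T_\varepsilon f\|_q\le C\left(\|f\|_q+\frac{\beta^{\frac{(q-1)n}{q}}}{\sqrt[q]{n(q-1)-\beta q}}\,\|f\|_1\right)$$ holds uniformly for all $\varepsilon>0$ and all $0<\beta<\min\{1-\beta_0,\frac{(q-1)n}{q}\}$.
   Context: Let $\mathbb{S}=\{x\in\mathbb{R}^n:|x|=1\}$ be the unit sphere with surface measure $d\sigma$. The function $\Omega:\mathbb{R}^n\to\mathbb{R}$ satisfies, with positive constants $B_1,B_2$, for all $r>0$ and $x\in\mathbb{R}^n\setminus\{0\}$: (boundedness) $|\Omega(x)|\le B_1$; (homogeneity of degree $0$) $\Omega(rx)=\Omega(x)$; (cancellation) $\int_{\mathbb{S}}\Omega\,d\sigma=0$; (Dini-type continuity) $\int_0^1\frac{\omega(\delta)}{\delta}\,d\delta=B_2$, where $\omega(\delta)=\sup\{|\Omega(x)-\Omega(x')|:|x-x'|\le\delta,\ |x|=|x'|=1\}$. For $0<\beta<n$ and $\varepsilon>0$, $T_\varepsilon$ is the operator (depending also on $\beta$) $$T_\varepsilon f(x)=\int_{|y|\ge\varepsilon}\frac{\Omega(y)}{|y|^{n-\beta}}f(x-y)\,dy .$$ $\|\cdot\|_q$ is the norm of $L^q(\mathbb{R}^n)$. *)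

theory Defs
  imports "HOL-Analysis.Analysis"
begin

text \<open>
  The usual polar-coordinate definition of the surface measure on the unit sphere:
  the measure of a Borel set \<open>E\<close> is \<open>n\<close> times the Lebesgue measure of the cone
  \<open>{r x | 0 < r \<le> 1, x \<in> E}\<close>; see \<open>emeasure_surface_measure\<close>.
\<close>

definition surface_measure :: "(real^'n) measure" where
  "surface_measure =
     scale_measure (of_nat CARD('n))
       (distr (restrict_space lborel (cball 0 1 - {0}))
              (restrict_space borel (sphere 0 1))
              (\<lambda>x. x /\<^sub>R norm x))"

lemma space_surface_measure: "space (surface_measure :: (real^'n) measure) = sphere 0 1"
  by (simp add: surface_measure_def space_scale_measure space_restrict_space)

lemma sets_surface_measure:
  "sets (surface_measure :: (real^'n) measure) = sets (restrict_space borel (sphere 0 1))"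
  by (simp add: surface_measure_def)

lemma emeasure_surface_measure:
  fixes E :: "(real^'n) set"
  assumes "E \<in> sets borel" "E \<subseteq> sphere 0 1"
  shows "emeasure surface_measure E =
           of_nat CARD('n) * emeasure lborel {r *\<^sub>R x | r x. 0 < r \<and> r \<le> 1 \<and> x \<in> E}"
proof -
  let ?M = "restrict_space lborel (cball 0 1 - {0}) :: (real^'n) measure"
  let ?N = "restrict_space borel (sphere 0 1) :: (real^'n) measure"
  have meas: "(\<lambda>x::real^'n. x /\<^sub>R norm x) \<in> measurable ?M ?N"
    by (intro measurable_restrict_space3) (auto simp: measurable_lborel1)
  have E: "E \<in> sets ?N"
    using assms by (subst sets_restrict_space_iff) auto
  have eq: "(\<lambda>x. x /\<^sub>R norm x) -` E \<inter> space ?M = {r *\<^sub>R x | r x. 0 < r \<and> r \<le> 1 \<and> x \<in> E}"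
    (is "?L = ?R")
  proof (intro equalityI subsetI)
    fix x assume x: "x \<in> ?L"
    then have "x = norm x *\<^sub>R (x /\<^sub>R norm x)" "0 < norm x" "norm x \<le> 1" "x /\<^sub>R norm x \<in> E"
      by (auto simp: space_restrict_space)
    then show "x \<in> ?R" by blast
  next
    fix x assume "x \<in> ?R"
    then obtain r y where "x = r *\<^sub>R y" "0 < r" "r \<le> 1" "y \<in> E" by blast
    moreover from this have "norm y = 1" using assms(2) by auto
    ultimately show "x \<in> ?L" by (auto simp: space_restrict_space)
  qed
  have "?L \<subseteq> cball 0 1 - {0}" by (auto simp: space_restrict_space)
  then show ?thesis
    unfolding surface_measure_def eq[symmetric]
    using meas E by (simp add: emeasure_scale_measure emeasure_distr emeasure_restrict_space)
qed

text \<open>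
  The least upper bound is taken in the reals: the set is nonempty for \<open>\<delta> \<ge> 0\<close>, and bounded
  as soon as \<open>\<Omega>\<close> is bounded on the unit sphere.
\<close>

definition sphere_modulus :: "(real^'n \<Rightarrow> real) \<Rightarrow> real \<Rightarrow> real" where
  "sphere_modulus \<Omega> \<delta> =
     Sup {\<bar>\<Omega> x - \<Omega> x'\<bar> | x x'. norm (x - x') \<le> \<delta> \<and> norm x = 1 \<and> norm x' = 1}"

text \<open>
  The Dini integral is an extended nonnegative one, so equality with \<open>ennreal B2\<close> includes
  its finiteness. In particular \<open>\<Omega>\<close> is continuous on the unit sphere, which makes the
  cancellation condition a statement about a convergent integral.
\<close>

definition dini_kernel :: "real \<Rightarrow> real \<Rightarrow> (real^'n \<Rightarrow> real) \<Rightarrow> bool" where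
  "dini_kernel B1 B2 \<Omega> \<longleftrightarrow>
     (\<forall>x. x \<noteq> 0 \<longrightarrow> \<bar>\<Omega> x\<bar> \<le> B1) \<and>
     (\<forall>r x. r > 0 \<longrightarrow> x \<noteq> 0 \<longrightarrow> \<Omega> (r *\<^sub>R x) = \<Omega> x) \<and>
     (\<integral>x. \<Omega> x \<partial>surface_measure) = 0 \<and>
     (\<integral>\<^sup>+\<delta>\<in>{0<..1}. ennreal (sphere_modulus \<Omega> \<delta> / \<delta>) \<partial>lborel) = ennreal B2"

definition T_op :: "(real^'n \<Rightarrow> real) \<Rightarrow> real \<Rightarrow> real \<Rightarrow> (real^'n \<Rightarrow> real) \<Rightarrow> real^'n \<Rightarrow> real" where
  "T_op \<Omega> \<beta> \<epsilon> f x =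
     (LINT y:{y. norm y \<ge> \<epsilon>}|lebesgue. \<Omega> y / norm y powr (real CARD('n) - \<beta>) * f (x - y))"

text \<open>\<open>Lp_norm p f\<close> is meaningful only for \<open>f \<in> Lp_space p\<close>.\<close>

definition Lp_space :: "real \<Rightarrow> (real^'n \<Rightarrow> real) set" where
  "Lp_space p = {f \<in> borel_measurable lebesgue. integrable lebesgue (\<lambda>x. \<bar>f x\<bar> powr p)}"

definition Lp_norm :: "real \<Rightarrow> (real^'n \<Rightarrow> real) \<Rightarrow> real" where
  "Lp_norm p f = (\<integral>x. \<bar>f x\<bar> powr p \<partial>lebesgue) powr (1 / p)"

end

theory Submission
  imports Defs "HOL-Probability.Characteristic_Functions"
begin

text \<open>
  The kernel \<open>\<Omega> y / norm y powr (n - \<beta>)\<close> on \<open>norm y \<ge> \<epsilon>\<close> is split at the radius \<open>R = 1 / \<beta>\<close>.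

  The far part lies in \<open>L\<^sup>q\<close>, because \<open>(n - \<beta>) * q > n\<close>. Young's inequality (\<open>conv_young\<close>) bounds its convolution
  with \<open>f\<close> by the product of the norm of the kernel in \<open>L\<^sup>q\<close> and the norm of \<open>f\<close> in \<open>L\<^sup>1\<close>. Polar coordinates
  show that the integral of the power \<open>q\<close> of the kernel is at most a constant times \<open>R powr (- d) / d\<close> with
  \<open>d = n * (q - 1) - \<beta> * q\<close>. Since \<open>R powr \<beta> = \<beta> powr (- \<beta>)\<close> is bounded by \<open>exp 1\<close>, this is the second term of
  the estimate.

  On the near part the same bound gives \<open>norm y powr \<beta> \<le> exp 1\<close>. So the kernel has the size of
  \<open>norm y powr (- n)\<close> with a constant that does not see \<open>\<beta>\<close>, and it is a Calderon-Zygmund kernel: its Fourier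
  transform is bounded (\<open>trunc_kernel_fourier\<close>), and it satisfies Hoermander's condition
  (\<open>trunc_kernel_hoermander\<close>), both with constants independent of \<open>\<epsilon>\<close> and \<open>\<beta>\<close>. The Dini condition is what
  makes the Hoermander integral converge, the cancellation is what controls the Fourier transform at small distances,
  and at large distances the Fourier bound follows from Hoermander's condition by a translation through half a period.

  Calderon-Zygmund kernels are bounded on \<open>L\<^sup>q\<close> for all \<open>1 < q\<close> with a bound depending only on these two constants
  (\<open>calderon_zygmund\<close>). On \<open>L\<^sup>2\<close> this is Plancherel's theorem, of which only two inequalities are required; they come
  from pairing with dilated Gaussians (\<open>multiplier_L2_step\<close>). For \<open>q < 2\<close> a nonnegative step function on a dyadic
  grid is decomposed at every height by stopping cubes (\<open>calderon_zygmund_cubes\<close>), and the resulting bound for the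
  distribution function (\<open>cz_weak_type\<close>) is integrated over the heights. Density of the step functions removes the
  restriction on the function, and duality (\<open>Lq_bounded_dual\<close>) gives \<open>q > 2\<close>.
\<close>

section \<open>Changes of variables, Jensen's inequality and convolution\<close>

lemma distr_lborel_affine:
  fixes t :: "'a::euclidean_space" assumes "c = 1 \<or> c = -1"
  shows "distr lborel borel (\<lambda>x. t + c *\<^sub>R x) = lborel"
proof -
  have "c \<noteq> 0" "\<bar>c\<bar> = 1" using assms by auto
  then show ?thesis using lborel_affine[of c t] by (auto simp: density_1)
qed

lemma nn_integral_lborel_shift:
  fixes f :: "'a::euclidean_space \<Rightarrow> ennreal" assumes [measurable]: "f \<in> borel_measurable borel"
  shows "(\<integral>\<^sup>+x. f (x - c) \<partial>lborel) = (\<integral>\<^sup>+x. f x \<partial>lborel)"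
proof -
  have "(\<integral>\<^sup>+x. f x \<partial>lborel) = (\<integral>\<^sup>+x. f x \<partial>distr lborel borel (\<lambda>x. (-c) + 1 *\<^sub>R x))"
    by (subst distr_lborel_affine) auto
  also have "\<dots> = (\<integral>\<^sup>+x. f (x - c) \<partial>lborel)"
    by (subst nn_integral_distr) auto
  finally show ?thesis by simp
qed

lemma nn_integral_lborel_reflect:
  fixes f :: "'a::euclidean_space \<Rightarrow> ennreal" assumes [measurable]: "f \<in> borel_measurable borel"
  shows "(\<integral>\<^sup>+x. f (c - x) \<partial>lborel) = (\<integral>\<^sup>+x. f x \<partial>lborel)"
proof -
  have "(\<integral>\<^sup>+x. f x \<partial>lborel) = (\<integral>\<^sup>+x. f x \<partial>distr lborel borel (\<lambda>x. c + (-1) *\<^sub>R x))"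
    by (subst distr_lborel_affine) auto
  also have "\<dots> = (\<integral>\<^sup>+x. f (c - x) \<partial>lborel)"
    by (subst nn_integral_distr) auto
  finally show ?thesis by simp
qed

lemma nn_integral_lborel_scale:
  fixes f :: "'a::euclidean_space \<Rightarrow> ennreal" assumes [measurable]: "f \<in> borel_measurable borel" and "c \<noteq> 0"
  shows "(\<integral>\<^sup>+x. f x \<partial>lborel) = ennreal (\<bar>c\<bar> ^ DIM('a)) * (\<integral>\<^sup>+x. f (c *\<^sub>R x) \<partial>lborel)"
  using assms(2)
  by (subst lborel_affine[of c 0]) (auto simp: nn_integral_density nn_integral_distr nn_integral_cmult)

lemma integral_lborel_shift:
  fixes f :: "'a::euclidean_space \<Rightarrow> 'b::{banach,second_countable_topology}"
  assumes [measurable]: "f \<in> borel_measurable borel"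
  shows "(\<integral>x. f (x - c) \<partial>lborel) = (\<integral>x. f x \<partial>lborel)"
    and "integrable lborel (\<lambda>x. f (x - c)) \<longleftrightarrow> integrable lborel f"
proof -
  have eq: "distr lborel borel (\<lambda>x::'a. x - c) = lborel"
    using distr_lborel_affine[of 1 "-c"] by simp
  show "(\<integral>x. f (x - c) \<partial>lborel) = (\<integral>x. f x \<partial>lborel)"
    by (subst (2) eq[symmetric], subst integral_distr) auto
  show "integrable lborel (\<lambda>x. f (x - c)) \<longleftrightarrow> integrable lborel f"
    by (subst (2) eq[symmetric], subst integrable_distr_eq) auto
qed

lemma integral_lborel_reflect:
  fixes f :: "'a::euclidean_space \<Rightarrow> 'b::{banach,second_countable_topology}"
  assumes [measurable]: "f \<in> borel_measurable borel"
  shows "(\<integral>x. f (c - x) \<partial>lborel) = (\<integral>x. f x \<partial>lborel)"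
    and "integrable lborel (\<lambda>x. f (c - x)) \<longleftrightarrow> integrable lborel f"
proof -
  have eq: "distr lborel borel (\<lambda>x::'a. c - x) = lborel"
    using distr_lborel_affine[of "-1" "c"] by simp
  show "(\<integral>x. f (c - x) \<partial>lborel) = (\<integral>x. f x \<partial>lborel)"
    by (subst (2) eq[symmetric], subst integral_distr) auto
  show "integrable lborel (\<lambda>x. f (c - x)) \<longleftrightarrow> integrable lborel f"
    by (subst (2) eq[symmetric], subst integrable_distr_eq) auto
qed

lemma young_scaled:
  fixes a b t q :: real
  assumes "1 < q" "0 \<le> a" "0 \<le> b" "0 < t"
  shows "a * b \<le> t powr q / q * a powr q + (q - 1) / q / t powr (q / (q - 1)) * b powr (q / (q - 1))"
proof -
  have "(t * a) * (b / t) \<le> (t * a) powr q / q + (b / t) powr (q / (q - 1)) / (q / (q - 1))"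
    using assms by (intro Youngs_inequality) (auto simp: field_simps)
  then show ?thesis using assms by (simp add: powr_mult powr_divide field_simps)
qed

text \<open>
  The right-hand side minus the left-hand side is \<open>a powr q\<close> minus its tangent at \<open>m\<close>; Young's inequality
  with one factor equal to a power of \<open>m\<close> is exactly this convexity statement.
\<close>

lemma powr_tangent:
  fixes a m q :: real
  assumes "1 < q" "0 \<le> a" "0 \<le> m"
  shows "q * m powr (q - 1) * a \<le> a powr q + (q - 1) * m powr q"
proof -
  have "a * m powr (q - 1) \<le> a powr q / q + (q - 1) / q * m powr q"
    using young_scaled[OF assms(1,2), of "m powr (q - 1)" 1] assms(1) by (simp add: powr_powr)
  then have "q * (a * m powr (q - 1)) \<le> q * (a powr q / q + (q - 1) / q * m powr q)"
    using assms(1) by (intro mult_left_mono) auto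
  also have "\<dots> = a powr q + (q - 1) * m powr q"
    using assms(1) by (simp add: field_simps)
  finally show ?thesis by (simp add: mult_ac)
qed

lemma powr_add_le:
  fixes a b q :: real
  assumes "0 < q"
  shows "\<bar>a + b\<bar> powr q \<le> 2 powr q * (\<bar>a\<bar> powr q + \<bar>b\<bar> powr q)"
proof -
  have "\<bar>a + b\<bar> powr q \<le> (2 * max \<bar>a\<bar> \<bar>b\<bar>) powr q"
    using assms by (intro powr_mono2) auto
  also have "\<dots> = 2 powr q * (max \<bar>a\<bar> \<bar>b\<bar>) powr q" by (simp add: powr_mult)
  also have "(max \<bar>a\<bar> \<bar>b\<bar>) powr q \<le> \<bar>a\<bar> powr q + \<bar>b\<bar> powr q"
    by (simp add: max_def)
  finally show ?thesis by simp
qed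

lemma powr_add_le_nn:
  fixes f g :: "'a \<Rightarrow> real"
  assumes "0 < q" and [measurable]: "f \<in> borel_measurable M" "g \<in> borel_measurable M"
  shows "(\<integral>\<^sup>+x. ennreal (\<bar>f x + g x\<bar> powr q) \<partial>M) \<le>
     ennreal (2 powr q) * ((\<integral>\<^sup>+x. ennreal (\<bar>f x\<bar> powr q) \<partial>M) + (\<integral>\<^sup>+x. ennreal (\<bar>g x\<bar> powr q) \<partial>M))"
proof -
  have "(\<integral>\<^sup>+x. ennreal (\<bar>f x + g x\<bar> powr q) \<partial>M) \<le>
    (\<integral>\<^sup>+x. ennreal (2 powr q) * (ennreal (\<bar>f x\<bar> powr q) + ennreal (\<bar>g x\<bar> powr q)) \<partial>M)"
    using powr_add_le[OF assms(1)]
    by (intro nn_integral_mono) (simp add: ennreal_mult[symmetric] ennreal_plus[symmetric] del: ennreal_plus)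
  then show ?thesis by (simp add: nn_integral_cmult nn_integral_add)
qed

text \<open>
  The tangent inequality at the weighted mean \<open>m\<close> of \<open>u\<close> is integrated against \<open>w\<close>. The weight is left
  unnormalised because it will be \<open>\<bar>K (x - y)\<bar>\<close>. If \<open>w * u\<close> is not integrable, its Bochner integral
  is \<open>0\<close> and so is the left-hand side.
\<close>

lemma jensen_powr:
  fixes w u :: "'a \<Rightarrow> real"
  assumes q: "1 < q" and w: "integrable M w" "\<And>x. 0 \<le> w x"
    and [measurable]: "u \<in> borel_measurable M" and u: "\<And>x. 0 \<le> u x"
  shows "ennreal ((\<integral>x. w x * u x \<partial>M) powr q)
    \<le> ennreal ((\<integral>x. w x \<partial>M) powr (q - 1)) * (\<integral>\<^sup>+x. ennreal (w x * u x powr q) \<partial>M)"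
proof -
  have [measurable]: "w \<in> borel_measurable M" using w by auto
  define W where "W = (\<integral>x. w x \<partial>M)"
  define I where "I = (\<integral>x. w x * u x \<partial>M)"
  have I0: "I \<ge> 0" unfolding I_def by (intro Bochner_Integration.integral_nonneg) (auto simp: w u)
  have W0: "W \<ge> 0" unfolding W_def by (intro Bochner_Integration.integral_nonneg) (auto simp: w)
  show ?thesis
  proof (cases "I = 0")
    case True then show ?thesis by (simp add: I_def)
  next
    case False
    then have I: "I > 0" and intI: "integrable M (\<lambda>x. w x * u x)"
      using I0 not_integrable_integral_eq by (auto simp: I_def)
    have "W \<noteq> 0"
    proof
      assume "W = 0"
      then have "AE x in M. w x = 0"
        using integral_nonneg_eq_0_iff_AE[OF w(1)] w(2) by (auto simp: W_def)
      then have "I = 0" unfolding I_def by (intro integral_eq_zero_AE) auto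
      with I show False by simp
    qed
    with W0 have W: "W > 0" by simp
    show ?thesis
    proof (cases "(\<integral>\<^sup>+x. ennreal (w x * u x powr q) \<partial>M) = \<infinity>")
      case True
      then show ?thesis using W by (simp add: W_def[symmetric] ennreal_mult_top)
    next
      case False
      then have intq: "integrable M (\<lambda>x. w x * u x powr q)"
        by (intro integrableI_nonneg) (auto simp: w less_top)
      define m where "m = I / W"
      have m: "m > 0" using I W by (simp add: m_def)
      have "I powr q = W powr (q - 1) * (q * m powr (q - 1) * I - (q - 1) * m powr q * W)"
      proof -
        have "m powr q = m powr (q - 1) * m" using m by (simp add: powr_diff)
        then have "m powr q * W = m powr (q - 1) * I" using W by (simp add: m_def)
        then have "q * m powr (q - 1) * I - (q - 1) * m powr q * W = m powr q * W"
          by (simp add: algebra_simps)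
        moreover have "W powr (q - 1) * (m powr q * W) = I powr q"
          using W I by (simp add: m_def powr_divide powr_diff)
        ultimately show ?thesis by simp
      qed
      also have "\<dots> = W powr (q - 1) * (\<integral>x. q * m powr (q - 1) * (w x * u x) - (q - 1) * m powr q * w x \<partial>M)"
        using intI w(1) by (simp add: W_def I_def)
      also have "\<dots> \<le> W powr (q - 1) * (\<integral>x. w x * u x powr q \<partial>M)"
      proof (intro mult_left_mono integral_mono)
        fix x
        have "w x * (q * m powr (q - 1) * u x) \<le> w x * (u x powr q + (q - 1) * m powr q)"
          using powr_tangent[OF q u, of m x] m by (intro mult_left_mono w) auto
        then show "q * m powr (q - 1) * (w x * u x) - (q - 1) * m powr q * w x \<le> w x * u x powr q"
          by (simp add: algebra_simps)
      qed (use intI w intq in auto)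
      finally have "ennreal (I powr q) \<le> ennreal (W powr (q - 1) * (\<integral>x. w x * u x powr q \<partial>M))"
        by (rule ennreal_leI)
      also have "\<dots> = ennreal (W powr (q - 1)) * ennreal (\<integral>x. w x * u x powr q \<partial>M)"
        by (intro ennreal_mult) (auto intro!: Bochner_Integration.integral_nonneg simp: w)
      also have "ennreal (\<integral>x. w x * u x powr q \<partial>M) = (\<integral>\<^sup>+x. ennreal (w x * u x powr q) \<partial>M)"
        by (intro nn_integral_eq_integral[symmetric] intq) (auto simp: w)
      finally show ?thesis by (simp add: I_def W_def)
    qed
  qed
qed

abbreviation int_powr :: "real \<Rightarrow> ('a::euclidean_space \<Rightarrow> real) \<Rightarrow> ennreal" where
  "int_powr q f \<equiv> (\<integral>\<^sup>+x. ennreal (\<bar>f x\<bar> powr q) \<partial>lborel)"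

definition conv :: "('a::euclidean_space \<Rightarrow> real) \<Rightarrow> ('a \<Rightarrow> real) \<Rightarrow> 'a \<Rightarrow> real" where
  "conv K f x = (\<integral>y. K (x - y) * f y \<partial>lborel)"

lemma borel_measurable_conv [measurable]:
  assumes [measurable]: "K \<in> borel_measurable borel" "f \<in> borel_measurable borel"
  shows "conv K f \<in> borel_measurable borel"
  unfolding conv_def[abs_def] by measurable

lemma conv_commute:
  assumes [measurable]: "K \<in> borel_measurable borel" "f \<in> borel_measurable borel"
  shows "conv K f x = conv f K x"
  using integral_lborel_reflect(1)[of "\<lambda>y. K (x - y) * f y" x]
  by (simp add: conv_def mult.commute)

text \<open>
  Jensen's inequality in \<open>y\<close> with the weight \<open>\<bar>K (x - y)\<bar>\<close>, then Tonelli. With the roles of kernel and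
  function exchanged this bounds the far part of the operator by the norm of \<open>f\<close> in \<open>L\<^sup>1\<close>; as it stands
  it supplies the qualitative finiteness used in the density and duality arguments.
\<close>

theorem conv_young:
  fixes K f :: "'a::euclidean_space \<Rightarrow> real"
  assumes q: "1 < q" and K: "integrable lborel K" and [measurable]: "f \<in> borel_measurable borel"
  shows "int_powr q (conv K f) \<le>
    ennreal ((\<integral>x. \<bar>K x\<bar> \<partial>lborel) powr q) * int_powr q f"
proof -
  have [measurable]: "K \<in> borel_measurable borel" using K by auto
  define W where "W = (\<integral>x. \<bar>K x\<bar> \<partial>lborel)"
  have W0: "W \<ge> 0" unfolding W_def by (intro Bochner_Integration.integral_nonneg) auto
  have sh: "(\<integral>y. \<bar>K (x - y)\<bar> \<partial>lborel) = W" "integrable lborel (\<lambda>y. \<bar>K (x - y)\<bar>)" for x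
    using integral_lborel_reflect[of "\<lambda>x. \<bar>K x\<bar>" x] K by (auto simp: W_def)
  have "ennreal (\<bar>conv K f x\<bar> powr q) \<le> ennreal (W powr (q - 1)) * (\<integral>\<^sup>+y. ennreal (\<bar>K (x - y)\<bar> * \<bar>f y\<bar> powr q) \<partial>lborel)" for x
  proof -
    have "\<bar>conv K f x\<bar> \<le> (\<integral>y. \<bar>K (x - y)\<bar> * \<bar>f y\<bar> \<partial>lborel)"
      unfolding conv_def using integral_norm_bound[of lborel "\<lambda>y. K (x - y) * f y"] by (simp add: abs_mult)
    then have "ennreal (\<bar>conv K f x\<bar> powr q) \<le> ennreal ((\<integral>y. \<bar>K (x - y)\<bar> * \<bar>f y\<bar> \<partial>lborel) powr q)"
      using q by (intro ennreal_leI powr_mono2) auto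
    also have "\<dots> \<le> ennreal ((\<integral>y. \<bar>K (x - y)\<bar> \<partial>lborel) powr (q - 1)) * (\<integral>\<^sup>+y. ennreal (\<bar>K (x - y)\<bar> * \<bar>f y\<bar> powr q) \<partial>lborel)"
      by (intro jensen_powr q sh) auto
    finally show ?thesis by (simp add: sh)
  qed
  then have "int_powr q (conv K f) \<le>
     (\<integral>\<^sup>+x. ennreal (W powr (q - 1)) * (\<integral>\<^sup>+y. ennreal (\<bar>K (x - y)\<bar> * \<bar>f y\<bar> powr q) \<partial>lborel) \<partial>lborel)"
    by (intro nn_integral_mono)
  also have "\<dots> = ennreal (W powr (q - 1)) * (\<integral>\<^sup>+y. (\<integral>\<^sup>+x. ennreal (\<bar>K (x - y)\<bar> * \<bar>f y\<bar> powr q) \<partial>lborel) \<partial>lborel)"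
    by (subst nn_integral_cmult, measurable, subst lborel_pair.Fubini') auto
  also have "(\<lambda>y. \<integral>\<^sup>+x. ennreal (\<bar>K (x - y)\<bar> * \<bar>f y\<bar> powr q) \<partial>lborel) = (\<lambda>y. ennreal W * ennreal (\<bar>f y\<bar> powr q))"
  proof
    fix y
    have "(\<integral>\<^sup>+x. ennreal (\<bar>K (x - y)\<bar> * \<bar>f y\<bar> powr q) \<partial>lborel) = (\<integral>\<^sup>+x. ennreal \<bar>K x\<bar> * ennreal (\<bar>f y\<bar> powr q) \<partial>lborel)"
      by (subst nn_integral_lborel_shift[of "\<lambda>x. ennreal (\<bar>K x\<bar> * \<bar>f y\<bar> powr q)"]) (auto simp: ennreal_mult)
    also have "\<dots> = (\<integral>\<^sup>+x. ennreal \<bar>K x\<bar> \<partial>lborel) * ennreal (\<bar>f y\<bar> powr q)"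
      by (intro nn_integral_multc) auto
    also have "(\<integral>\<^sup>+x. ennreal \<bar>K x\<bar> \<partial>lborel) = ennreal W"
      unfolding W_def using K by (intro nn_integral_eq_integral) auto
    finally show "(\<integral>\<^sup>+x. ennreal (\<bar>K (x - y)\<bar> * \<bar>f y\<bar> powr q) \<partial>lborel) = ennreal W * ennreal (\<bar>f y\<bar> powr q)" .
  qed
  also have "ennreal (W powr (q - 1)) * (\<integral>\<^sup>+y. ennreal W * ennreal (\<bar>f y\<bar> powr q) \<partial>lborel) =
     ennreal (W powr (q - 1) * W) * int_powr q f"
    using W0 by (simp add: nn_integral_cmult ennreal_mult mult_ac)
  also have "W powr (q - 1) * W = W powr q"
    using W0 by (cases "W = 0") (auto simp: powr_diff)
  finally show ?thesis by (simp add: W_def)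
qed

section \<open>Step functions on dyadic grids\<close>

definition same_cell :: "nat \<Rightarrow> 'a::euclidean_space \<Rightarrow> 'a \<Rightarrow> bool" where
  "same_cell N x y \<longleftrightarrow> (\<forall>b\<in>Basis. \<lfloor>2 ^ N * (x \<bullet> b)\<rfloor> = \<lfloor>2 ^ N * (y \<bullet> b)\<rfloor>)"

lemma same_cell_refl [simp]: "same_cell N x x"
  by (simp add: same_cell_def)

lemma same_cell_sym: "same_cell N x y \<Longrightarrow> same_cell N y x"
  by (simp add: same_cell_def)

lemma same_cell_trans: "same_cell N x y \<Longrightarrow> same_cell N y z \<Longrightarrow> same_cell N x z"
  by (simp add: same_cell_def)

lemma same_cell_mono:
  assumes "N \<le> N'" "same_cell N' x y" shows "same_cell N x y"
proof -
  have *: "\<lfloor>2 ^ N * t\<rfloor> = \<lfloor>2 ^ N' * t\<rfloor> div 2 ^ (N' - N)" for t :: real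
  proof -
    have "2 ^ N * t = 2 ^ N' * t / real_of_int (2 ^ (N' - N))"
      using assms(1) by (simp add: field_simps power_add[symmetric])
    then show ?thesis by (metis floor_divide_real_eq_div zero_le_numeral zero_le_power)
  qed
  show ?thesis using assms(2) by (simp add: same_cell_def *)
qed

lemma same_cell_dist:
  assumes "same_cell N x (y::'a::euclidean_space)" shows "norm (x - y) \<le> real DIM('a) / 2 ^ N"
proof -
  have "\<bar>(x - y) \<bullet> b\<bar> \<le> 1 / 2 ^ N" if "b \<in> Basis" for b
  proof -
    have "\<lfloor>2 ^ N * (x \<bullet> b)\<rfloor> = \<lfloor>2 ^ N * (y \<bullet> b)\<rfloor>" using assms that by (simp add: same_cell_def)
    then have "\<bar>2 ^ N * (x \<bullet> b) - 2 ^ N * (y \<bullet> b)\<bar> \<le> 1" by linarith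
    moreover have "2 ^ N * (x \<bullet> b) - 2 ^ N * (y \<bullet> b) = 2 ^ N * ((x - y) \<bullet> b)"
      by (simp add: inner_diff_left algebra_simps)
    ultimately have "2 ^ N * \<bar>(x - y) \<bullet> b\<bar> \<le> 1" by (simp add: abs_mult)
    then show ?thesis by (simp add: field_simps)
  qed
  then have "(\<Sum>b\<in>Basis. \<bar>(x - y) \<bullet> b\<bar>) \<le> (\<Sum>b\<in>(Basis::'a set). 1 / 2 ^ N)" by (intro sum_mono)
  then show ?thesis using norm_le_l1[of "x - y"] by simp
qed

text \<open>
  Step functions are the dense class for which stopping cubes are a finite construction: below the mesh of
  the grid there is nothing to subdivide, so Lebesgue differentiation is replaced by local constancy.
\<close>

definition step_fun :: "('a::euclidean_space \<Rightarrow> real) \<Rightarrow> bool" where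
  "step_fun f \<longleftrightarrow> (\<exists>N. \<forall>x y. same_cell N x y \<longrightarrow> f x = f y) \<and> (\<exists>B. \<forall>x. \<bar>f x\<bar> \<le> B) \<and>
     bounded {x. f x \<noteq> 0}"

text \<open>
  A cell is coded by a finite list of integers. The codes form a countable type, and any function of a
  measurable code with countably many values is measurable.
\<close>

lemma borel_measurable_cell_const:
  fixes f :: "'a::euclidean_space \<Rightarrow> 'b::topological_space"
  assumes f: "\<And>x y. same_cell N x y \<Longrightarrow> f x = f y"
  shows "f \<in> borel_measurable borel"
proof -
  obtain bs :: "'a list" where bs: "set bs = Basis" using finite_list[OF finite_Basis] by blast
  define g where "g x = map (\<lambda>b. \<lfloor>2 ^ N * (x \<bullet> b)\<rfloor>) bs" for x
  have g_eq: "g x = g y \<longleftrightarrow> same_cell N x y" for x y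
    using bs by (auto simp: g_def same_cell_def)
  have g: "g \<in> measurable borel (count_space UNIV)"
  proof (subst measurable_count_space_eq2_countable, intro conjI ballI countableI_type)
    fix l :: "int list"
    have "g -` {l} \<inter> space borel = (if length l = length bs then {x. \<forall>i\<in>{..<length bs}. \<lfloor>2 ^ N * (x \<bullet> (bs ! i))\<rfloor> = l ! i} else {})"
      by (auto simp: g_def list_eq_iff_nth_eq)
    also have "\<dots> \<in> sets borel" by auto
    finally show "g -` {l} \<inter> space borel \<in> sets borel" .
  qed auto
  define F where "F l = f (SOME x. g x = l)" for l
  have "f x = F (g x)" for x
    unfolding F_def by (rule someI2[of "\<lambda>y. g y = g x" x]) (auto simp: g_eq intro!: f same_cell_sym)
  then have "f = F \<circ> g" by auto
  then show ?thesis using g by (auto intro: measurable_comp)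
qed

lemma step_fun_measurable [measurable_dest]: "step_fun f \<Longrightarrow> f \<in> borel_measurable borel"
  unfolding step_fun_def using borel_measurable_cell_const by blast

lemma step_fun_integrable_powr:
  assumes "step_fun f" "0 < q" shows "integrable lborel (\<lambda>x. \<bar>f x\<bar> powr q)"
proof -
  note [measurable] = step_fun_measurable[OF assms(1)]
  obtain B where B: "\<And>x. \<bar>f x\<bar> \<le> B" and bd: "bounded {x. f x \<noteq> 0}"
    using assms(1) unfolding step_fun_def by blast
  obtain r where r: "{x. f x \<noteq> 0} \<subseteq> cball 0 r"
    using bd by (auto simp: bounded_iff subset_iff)
  show ?thesis
  proof (rule Bochner_Integration.integrable_bound[where f = "\<lambda>x. indicator (cball 0 r) x *\<^sub>R (B powr q)"])
    show "integrable lborel (\<lambda>x. indicator (cball 0 r) x *\<^sub>R (B powr q))"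
      by (intro integrable_scaleR_left integrable_real_indicator) (auto simp: emeasure_bounded_finite[unfolded infinity_ennreal_def])
    show "AE x in lborel. norm (\<bar>f x\<bar> powr q) \<le> norm (indicator (cball 0 r) x *\<^sub>R (B powr q))"
      using r B assms(2) by (intro AE_I2) (auto simp: indicator_def intro!: powr_mono2)
  qed simp
qed

lemma step_fun_integrable:
  assumes "step_fun f" shows "integrable lborel f"
proof -
  note [measurable] = step_fun_measurable[OF assms(1)]
  show ?thesis
    using step_fun_integrable_powr[OF assms, of 1] by (subst integrable_abs_iff[symmetric]) auto
qed

lemma step_fun_add:
  assumes "step_fun f" "step_fun g" shows "step_fun (\<lambda>x. f x + g x)"
proof -
  obtain N1 B1 where 1: "\<forall>x y. same_cell N1 x y \<longrightarrow> f x = f y" "\<forall>x. \<bar>f x\<bar> \<le> B1" "bounded {x. f x \<noteq> 0}"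
    using assms(1) by (auto simp: step_fun_def)
  obtain N2 B2 where 2: "\<forall>x y. same_cell N2 x y \<longrightarrow> g x = g y" "\<forall>x. \<bar>g x\<bar> \<le> B2" "bounded {x. g x \<noteq> 0}"
    using assms(2) by (auto simp: step_fun_def)
  have "\<forall>x y. same_cell (max N1 N2) x y \<longrightarrow> f x + g x = f y + g y"
    using 1(1) 2(1) same_cell_mono[of N1 "max N1 N2"] same_cell_mono[of N2 "max N1 N2"] by (metis max.cobounded1 max.cobounded2)
  moreover have "\<forall>x. \<bar>f x + g x\<bar> \<le> B1 + B2" using 1(2) 2(2) by (meson abs_triangle_ineq add_mono order_trans)
  moreover have "bounded {x. f x + g x \<noteq> 0}"
    by (rule bounded_subset[of "{x. f x \<noteq> 0} \<union> {x. g x \<noteq> 0}"]) (use 1 2 in auto)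
  ultimately show ?thesis unfolding step_fun_def by blast
qed

lemma step_fun_compose:
  assumes f: "step_fun f" and F: "F 0 = 0" "\<And>t. \<bar>F t\<bar> \<le> c * \<bar>t\<bar>"
  shows "step_fun (\<lambda>x. F (f x))"
proof -
  obtain N B where 1: "\<And>x y. same_cell N x y \<longrightarrow> f x = f y" "\<And>x. \<bar>f x\<bar> \<le> B" "bounded {x. f x \<noteq> 0}"
    using assms(1) by (auto simp: step_fun_def)
  have "\<bar>F (f x)\<bar> \<le> \<bar>c\<bar> * B" for x
    using F(2)[of "f x"] 1(2)[of x] mult_mono[of "\<bar>c\<bar>" "\<bar>c\<bar>" "\<bar>f x\<bar>" B] mult_right_mono[of c "\<bar>c\<bar>" "\<bar>f x\<bar>"] by linarith
  moreover have "bounded {x. F (f x) \<noteq> 0}"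
    by (rule bounded_subset[OF 1(3)]) (use F in auto)
  moreover have "\<forall>x y. same_cell N x y \<longrightarrow> F (f x) = F (f y)" using 1(1) by metis
  ultimately show ?thesis unfolding step_fun_def by blast
qed

text \<open>
  The cells of mesh \<open>1 / 2 ^ N\<close> that lie inside \<open>U\<close> and inside the ball of radius \<open>N\<close> exhaust \<open>U\<close> as
  \<open>N\<close> grows.
\<close>

lemma step_fun_approx_open:
  fixes U :: "'a::euclidean_space set"
  assumes U: "open U" "emeasure lborel U < \<infinity>" and e: "0 < e"
  obtains S where "step_fun (indicator S)" "S \<subseteq> U" "S \<in> sets borel" "measure lborel (U - S) < e"
proof -
  define S where "S N = {x. \<forall>y. same_cell N x y \<longrightarrow> y \<in> U \<inter> ball 0 (real N)}" for N
  have cell: "indicator (S N) x = (indicator (S N) y :: real)" if "same_cell N x y" for N x y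
  proof -
    have "x \<in> S N \<longleftrightarrow> y \<in> S N"
      unfolding S_def using that same_cell_sym same_cell_trans by blast
    then show ?thesis by (simp add: indicator_def)
  qed
  have sub: "S N \<subseteq> U \<inter> ball 0 (real N)" for N unfolding S_def by force
  have step: "step_fun (indicator (S N))" for N
    unfolding step_fun_def
  proof (intro conjI exI[of _ N] exI[of _ 1] allI impI)
    show "bounded {x. indicator (S N) x \<noteq> (0::real)}"
      by (rule bounded_subset[OF bounded_ball[of 0 "real N"]]) (use sub in \<open>auto simp: indicator_def\<close>)
  qed (auto simp: cell)
  have Sb [measurable]: "S N \<in> sets borel" for N
    using step_fun_measurable[OF step[of N]] by (simp add: borel_measurable_indicator_iff)
  have [measurable]: "U \<in> sets borel" using U by auto
  have ev: "eventually (\<lambda>N. x \<in> S N) sequentially" if x: "x \<in> U" for x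
  proof -
    obtain r where r: "r > 0" "ball x r \<subseteq> U" using U(1) x openE by blast
    have "(\<lambda>N. real DIM('a) / 2 ^ N) \<longlonglongrightarrow> 0" by real_asymp
    then have "eventually (\<lambda>N. real DIM('a) / 2 ^ N < min r 1) sequentially"
      by (rule order_tendstoD) (use r in auto)
    moreover have "eventually (\<lambda>N. real N > norm x + 1) sequentially"
      by (metis eventually_at_top_dense filterlim_at_top_dense filterlim_real_sequentially)
    ultimately show ?thesis
    proof eventually_elim
      case (elim N)
      { fix y assume "same_cell N x y"
        from same_cell_dist[OF this] elim have "norm (x - y) < min r 1" by linarith
        then have "y \<in> ball x r" "norm y < norm x + 1" 
          using norm_triangle_ineq2[of y x] by (auto simp: dist_norm norm_minus_commute)
        then have "y \<in> U \<inter> ball 0 (real N)" using r elim by auto }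
      then show ?case by (auto simp: S_def)
    qed
  qed
  have "(\<lambda>N. \<integral>x. indicator (U - S N) x \<partial>lborel) \<longlonglongrightarrow> (\<integral>x. (0::real) \<partial>(lborel :: 'a measure))"
  proof (rule integral_dominated_convergence[where w = "indicator U"])
    show "integrable lborel (indicator U :: 'a \<Rightarrow> real)" using U by (intro integrable_real_indicator) auto
    show "AE x in lborel. (\<lambda>N. indicator (U - S N) x) \<longlonglongrightarrow> (0::real)"
    proof (intro AE_I2)
      fix x
      have "eventually (\<lambda>N. indicator (U - S N) x = (0::real)) sequentially"
      proof (cases "x \<in> U")
        case True then show ?thesis by (intro eventually_mono[OF ev[OF True]]) auto
      qed auto
      then show "(\<lambda>N. indicator (U - S N) x) \<longlonglongrightarrow> (0::real)" by (rule tendsto_eventually)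
    qed
    show "AE x in lborel. norm (indicator (U - S N) x :: real) \<le> indicator U x" for N
      by (intro AE_I2) (auto simp: indicator_def)
  qed auto
  then have "(\<lambda>N. measure lborel (U - S N)) \<longlonglongrightarrow> 0" by simp
  then have "eventually (\<lambda>N. measure lborel (U - S N) < e) sequentially"
    using e by (rule order_tendstoD)
  then obtain N where "measure lborel (U - S N) < e" by (auto simp: eventually_sequentially)
  then show thesis using that[of "S N"] step sub Sb by auto
qed

lemma step_fun_dense_L1:
  fixes f :: "'a::euclidean_space \<Rightarrow> real"
  assumes "integrable lborel f"
  shows "\<forall>e>0. \<exists>s. step_fun s \<and> (\<integral>x. \<bar>f x - s x\<bar> \<partial>lborel) < e"
  using assms
proof (induction rule: integrable_induct)
  case (base A c)
  have [measurable]: "A \<in> sets borel" using base by simp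
  show ?case
  proof (intro allI impI)
    fix e :: real assume e: "e > 0"
    define d where "d = e / (2 * (\<bar>c\<bar> + 1))"
    have d: "d > 0" using e by (simp add: d_def)
    obtain U where U: "open U" "A \<subseteq> U" "emeasure lborel (U - A) < ennreal d"
      using outer_regular_lborel[of A d] d by auto
    have [measurable]: "U \<in> sets borel" using U by auto
    have "emeasure lborel (A \<union> (U - A)) \<le> emeasure lborel A + emeasure lborel (U - A)"
      by (intro emeasure_subadditive) auto
    also have "\<dots> < \<infinity>" using base U(3) by (auto simp: less_top[symmetric])
    also have "A \<union> (U - A) = U" using U(2) by auto
    finally have fU: "emeasure lborel U < \<infinity>" .
    obtain S where S: "step_fun (indicator S)" "S \<subseteq> U" "measure lborel (U - S) < d"
      and [measurable]: "S \<in> sets borel"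
      using step_fun_approx_open[OF U(1) fU d] by metis
    have fin: "emeasure lborel (U - X) < \<infinity>" if "X \<in> sets borel" for X
      by (rule le_less_trans[OF emeasure_mono fU]) auto
    have UA: "measure lborel (U - A) < d"
      using U(3) fin[of A] by (simp add: emeasure_eq_ennreal_measure ennreal_less_iff)
    have "(\<integral>x. \<bar>indicator A x *\<^sub>R c - c * indicator S x\<bar> \<partial>lborel) \<le>
        (\<integral>x. \<bar>c\<bar> * (indicator (U - A) x + indicator (U - S) x) \<partial>lborel)"
    proof (rule integral_mono)
      show "integrable lborel (\<lambda>x. \<bar>indicator A x *\<^sub>R c - c * indicator S x\<bar>)"
        using base S(1) by (intro integrable_abs Bochner_Integration.integrable_diff integrable_scaleR_left
          integrable_mult_right integrable_real_indicator step_fun_integrable) auto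
      show "integrable lborel (\<lambda>x. \<bar>c\<bar> * (indicator (U - A) x + indicator (U - S) x))"
        using fin by (intro integrable_mult_right Bochner_Integration.integrable_add integrable_real_indicator) auto
      show "\<bar>indicator A x *\<^sub>R c - c * indicator S x\<bar> \<le> \<bar>c\<bar> * (indicator (U - A) x + indicator (U - S) x)" for x
        using U(2) S(2) by (auto simp: indicator_def)
    qed
    also have "\<dots> = \<bar>c\<bar> * (measure lborel (U - A) + measure lborel (U - S))"
      using fin by (subst integral_mult_right_zero, subst Bochner_Integration.integral_add) auto
    also have "\<dots> \<le> \<bar>c\<bar> * (d + d)" using UA S(3) by (intro mult_left_mono) auto
    also have "\<bar>c\<bar> * (d + d) = e * (\<bar>c\<bar> / (\<bar>c\<bar> + 1))" by (simp add: d_def divide_simps)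
    also have "\<dots> < e * 1" using e by (intro mult_strict_left_mono) auto
    also have "e * 1 = e" by simp
    finally show "\<exists>s. step_fun s \<and> (\<integral>x. \<bar>indicator A x *\<^sub>R c - s x\<bar> \<partial>lborel) < e"
      using step_fun_compose[OF S(1), of "\<lambda>t. c * t" "\<bar>c\<bar>"] by (auto simp: abs_mult)
  qed
next
  case (add f g)
  show ?case
  proof (intro allI impI)
    fix e :: real assume e: "e > 0"
    obtain s t where s: "step_fun s" "(\<integral>x. \<bar>f x - s x\<bar> \<partial>lborel) < e / 2"
      and t: "step_fun t" "(\<integral>x. \<bar>g x - t x\<bar> \<partial>lborel) < e / 2"
      using add.IH e by (meson half_gt_zero)
    have "(\<integral>x. \<bar>f x + g x - (s x + t x)\<bar> \<partial>lborel) \<le> (\<integral>x. \<bar>f x - s x\<bar> + \<bar>g x - t x\<bar> \<partial>lborel)"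
      using add.hyps step_fun_integrable[OF s(1)] step_fun_integrable[OF t(1)] by (intro integral_mono) auto
    also have "\<dots> = (\<integral>x. \<bar>f x - s x\<bar> \<partial>lborel) + (\<integral>x. \<bar>g x - t x\<bar> \<partial>lborel)"
      using add.hyps step_fun_integrable[OF s(1)] step_fun_integrable[OF t(1)] by (intro Bochner_Integration.integral_add) auto
    finally have "(\<integral>x. \<bar>f x + g x - (s x + t x)\<bar> \<partial>lborel) < e" using s t by simp
    then show "\<exists>s. step_fun s \<and> (\<integral>x. \<bar>f x + g x - s x\<bar> \<partial>lborel) < e"
      using step_fun_add[OF s(1) t(1)] by blast
  qed
next
  case (lim f s)
  show ?case
  proof (intro allI impI)
    fix e :: real assume e: "e > 0"
    have [measurable]: "f \<in> borel_measurable borel" "\<And>i. s i \<in> borel_measurable borel"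
      using lim.hyps by auto
    have "(\<lambda>i. \<integral>x. \<bar>f x - s i x\<bar> \<partial>lborel) \<longlonglongrightarrow> (\<integral>x. (0::real) \<partial>(lborel :: 'a measure))"
    proof (rule integral_dominated_convergence[where w = "\<lambda>x. 3 * \<bar>f x\<bar>"])
      show "AE x in lborel. (\<lambda>i. \<bar>f x - s i x\<bar>) \<longlonglongrightarrow> 0"
      proof (intro AE_I2)
        fix x
        have "(\<lambda>i. \<bar>f x - s i x\<bar>) \<longlonglongrightarrow> \<bar>f x - f x\<bar>" using lim.hyps by (intro tendsto_intros) auto
        then show "(\<lambda>i. \<bar>f x - s i x\<bar>) \<longlonglongrightarrow> 0" by simp
      qed
      show "AE x in lborel. norm \<bar>f x - s i x\<bar> \<le> 3 * \<bar>f x\<bar>" for i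
      proof (intro AE_I2)
        fix x show "norm \<bar>f x - s i x\<bar> \<le> 3 * \<bar>f x\<bar>"
          using lim.hyps(3)[of x i] by auto
      qed
    qed (use lim.hyps in auto)
    then have "(\<lambda>i. \<integral>x. \<bar>f x - s i x\<bar> \<partial>lborel) \<longlonglongrightarrow> 0" by simp
    then have "eventually (\<lambda>i. (\<integral>x. \<bar>f x - s i x\<bar> \<partial>lborel) < e / 2) sequentially"
      by (rule order_tendstoD) (use e in simp)
    then obtain i where i: "(\<integral>x. \<bar>f x - s i x\<bar> \<partial>lborel) < e / 2" by (auto simp: eventually_sequentially)
    obtain t where t: "step_fun t" "(\<integral>x. \<bar>s i x - t x\<bar> \<partial>lborel) < e / 2"
      using lim.IH[of i] e by (meson half_gt_zero)
    have "(\<integral>x. \<bar>f x - t x\<bar> \<partial>lborel) \<le> (\<integral>x. \<bar>f x - s i x\<bar> + \<bar>s i x - t x\<bar> \<partial>lborel)"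
      using lim.hyps step_fun_integrable[OF t(1)] by (intro integral_mono) auto
    also have "\<dots> = (\<integral>x. \<bar>f x - s i x\<bar> \<partial>lborel) + (\<integral>x. \<bar>s i x - t x\<bar> \<partial>lborel)"
      using lim.hyps step_fun_integrable[OF t(1)] by (intro Bochner_Integration.integral_add) auto
    finally have "(\<integral>x. \<bar>f x - t x\<bar> \<partial>lborel) < e" using i t by simp
    then show "\<exists>s. step_fun s \<and> (\<integral>x. \<bar>f x - s x\<bar> \<partial>lborel) < e" using t(1) by blast
  qed
qed

text \<open>
  A truncation of \<open>f\<close> in size and in space is integrable, hence close in \<open>L\<^sup>1\<close> to a step function.
\<close>

lemma step_fun_dense_Lq:
  fixes f :: "'a::euclidean_space \<Rightarrow> real"
  assumes q: "1 < q" and [measurable]: "f \<in> borel_measurable borel"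
    and f: "integrable lborel (\<lambda>x. \<bar>f x\<bar> powr q)" and e: "0 < e"
  obtains s where "step_fun s" "(\<integral>\<^sup>+x. ennreal (\<bar>f x - s x\<bar> powr q) \<partial>lborel) < ennreal e"
proof -
  define F where "F M x = (if norm x \<le> real M \<and> \<bar>f x\<bar> \<le> real M then f x else 0)" for M :: nat and x
  have [measurable]: "F M \<in> borel_measurable borel" for M unfolding F_def by measurable
  have Fb: "\<bar>F M x\<bar> \<le> real M" for M x by (auto simp: F_def indicator_def)
  have Fi: "integrable lborel (F M)" for M
  proof (rule Bochner_Integration.integrable_bound[where f = "\<lambda>x. indicator (cball 0 (real M)) x *\<^sub>R real M"])
    show "integrable lborel (\<lambda>x. indicator (cball 0 (real M)) x *\<^sub>R real M)"
      by (intro integrable_scaleR_left integrable_real_indicator) (auto simp: emeasure_bounded_finite[unfolded infinity_ennreal_def])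
  qed (auto simp: F_def indicator_def)
  have "(\<lambda>M. \<integral>x. \<bar>f x - F M x\<bar> powr q \<partial>lborel) \<longlonglongrightarrow> (\<integral>x. (0::real) \<partial>(lborel :: 'a measure))"
  proof (rule integral_dominated_convergence[where w = "\<lambda>x. \<bar>f x\<bar> powr q"])
    show "AE x in lborel. (\<lambda>M. \<bar>f x - F M x\<bar> powr q) \<longlonglongrightarrow> 0"
    proof (intro AE_I2 tendsto_eventually)
      fix x
      have "eventually (\<lambda>M. real M \<ge> max (norm x) \<bar>f x\<bar>) sequentially"
        using filterlim_at_top filterlim_real_sequentially by blast
      then show "eventually (\<lambda>M. \<bar>f x - F M x\<bar> powr q = 0) sequentially"
        by eventually_elim (auto simp: F_def)
    qed
    show "AE x in lborel. norm (\<bar>f x - F M x\<bar> powr q) \<le> \<bar>f x\<bar> powr q" for M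
      using q by (intro AE_I2) (auto simp: F_def indicator_def)
  qed (use f in auto)
  then have "eventually (\<lambda>M. (\<integral>x. \<bar>f x - F M x\<bar> powr q \<partial>lborel) < e / (4 * 2 powr q)) sequentially"
    using e by (intro order_tendstoD) auto
  then obtain M where M: "(\<integral>x. \<bar>f x - F M x\<bar> powr q \<partial>lborel) < e / (4 * 2 powr q)" by (auto simp: eventually_sequentially)
  have int1: "integrable lborel (\<lambda>x. \<bar>f x - F M x\<bar> powr q)"
    by (rule Bochner_Integration.integrable_bound[OF f]) (use q in \<open>auto simp: F_def indicator_def\<close>)
  define d where "d = e / (4 * 2 powr q * ((2 * real M + 1) powr (q - 1)))"
  have d: "d > 0" using e by (simp add: d_def)
  obtain t where t: "step_fun t" "(\<integral>x. \<bar>F M x - t x\<bar> \<partial>lborel) < d"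
    using step_fun_dense_L1[OF Fi] d by blast
  \<comment> \<open>Clamping to the range of the target keeps the error bounded, so that its power \<open>q\<close> is
    controlled by the error itself.\<close>
  define s where "s x = max (- real M) (min (real M) (t x))" for x
  have s: "step_fun s" unfolding s_def by (rule step_fun_compose[OF t(1), of _ 1]) auto
  note [measurable] = step_fun_measurable[OF t(1)] step_fun_measurable[OF s]
  have pt: "\<bar>F M x - s x\<bar> powr q \<le> (2 * real M + 1) powr (q - 1) * \<bar>F M x - t x\<bar>" for x
  proof (cases "F M x = s x")
    case False
    have "\<bar>F M x - s x\<bar> powr q = \<bar>F M x - s x\<bar> powr (q - 1) * \<bar>F M x - s x\<bar>"
      using False by (simp add: powr_diff)
    also have "\<dots> \<le> (2 * real M + 1) powr (q - 1) * \<bar>F M x - t x\<bar>"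
      using Fb[of M x] q by (intro mult_mono powr_mono2) (auto simp: s_def)
    finally show ?thesis .
  qed (use q in auto)
  have "(\<integral>\<^sup>+x. ennreal (\<bar>F M x - s x\<bar> powr q) \<partial>lborel) \<le> (\<integral>\<^sup>+x. ennreal ((2 * real M + 1) powr (q - 1) * \<bar>F M x - t x\<bar>) \<partial>lborel)"
    by (intro nn_integral_mono ennreal_leI pt)
  also have "\<dots> = ennreal (\<integral>x. (2 * real M + 1) powr (q - 1) * \<bar>F M x - t x\<bar> \<partial>lborel)"
    using Fi step_fun_integrable[OF t(1)] by (intro nn_integral_eq_integral) auto
  also have "\<dots> \<le> ennreal (e / (4 * 2 powr q))"
    using t(2) e by (intro ennreal_leI) (auto simp: d_def field_simps)
  finally have 2: "(\<integral>\<^sup>+x. ennreal (\<bar>F M x - s x\<bar> powr q) \<partial>lborel) \<le> ennreal (e / (4 * 2 powr q))" .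
  have 1: "(\<integral>\<^sup>+x. ennreal (\<bar>f x - F M x\<bar> powr q) \<partial>lborel) < ennreal (e / (4 * 2 powr q))"
    using M e int1 by (subst nn_integral_eq_integral) (auto intro!: ennreal_lessI)
  have "(\<integral>\<^sup>+x. ennreal (\<bar>f x - s x\<bar> powr q) \<partial>lborel) \<le>
     ennreal (2 powr q) * ((\<integral>\<^sup>+x. ennreal (\<bar>f x - F M x\<bar> powr q) \<partial>lborel) + (\<integral>\<^sup>+x. ennreal (\<bar>F M x - s x\<bar> powr q) \<partial>lborel))"
    using powr_add_le_nn[of q "\<lambda>x. f x - F M x" lborel "\<lambda>x. F M x - s x"] q by simp
  also have "\<dots> \<le> ennreal (2 powr q) * (ennreal (e / (4 * 2 powr q)) + ennreal (e / (4 * 2 powr q)))"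
    using 1 2 by (intro mult_left_mono add_mono) auto
  also have "\<dots> = ennreal (e / 2)"
    using e by (simp add: ennreal_mult[symmetric] ennreal_plus[symmetric] field_simps del: ennreal_plus)
  also have "\<dots> < ennreal e" using e by (simp add: ennreal_less_iff)
  finally show thesis using that s by blast
qed

section \<open>Stopping cubes\<close>

definition cube :: "'a::euclidean_space \<Rightarrow> real \<Rightarrow> 'a set" where
  "cube c s = {x. \<forall>b\<in>Basis. c \<bullet> b \<le> x \<bullet> b \<and> x \<bullet> b < c \<bullet> b + s}"

lemma cube_borel [measurable]: "cube c s \<in> sets borel"
  unfolding cube_def by measurable

lemma measure_cube:
  fixes c :: "'a::euclidean_space"
  assumes "0 < s"
  shows "emeasure lborel (cube c s) = ennreal (s ^ DIM('a))" and "measure lborel (cube c s) = s ^ DIM('a)"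
proof -
  have box: "emeasure lborel (box c (c + s *\<^sub>R One)) = ennreal (s ^ DIM('a))"
    using assms by (simp add: emeasure_lborel_box_eq inner_add_left inner_diff_left)
  have cbox: "emeasure lborel (cbox c (c + s *\<^sub>R One)) = ennreal (s ^ DIM('a))"
    using assms by (simp add: emeasure_lborel_cbox_eq inner_add_left inner_diff_left)
  have sub: "box c (c + s *\<^sub>R One) \<subseteq> cube c s" "cube c s \<subseteq> cbox c (c + s *\<^sub>R One)"
    by (auto simp: cube_def box_def cbox_def inner_add_left less_imp_le)
  show *: "emeasure lborel (cube c s) = ennreal (s ^ DIM('a))"
    using emeasure_mono[OF sub(1), of lborel] emeasure_mono[OF sub(2), of lborel]
    unfolding box cbox by (intro antisym) auto
  then show "measure lborel (cube c s) = s ^ DIM('a)"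
    using assms by (simp add: measure_def)
qed

lemma cube_dist:
  fixes c :: "'a::euclidean_space"
  assumes "x \<in> cube c s" shows "norm (x - c) \<le> real DIM('a) * s"
proof -
  have "(\<Sum>b\<in>Basis. \<bar>(x - c) \<bullet> b\<bar>) \<le> (\<Sum>b\<in>(Basis::'a set). s)"
    using assms by (intro sum_mono) (force simp: cube_def inner_diff_left)
  then show ?thesis using norm_le_l1[of "x - c"] by simp
qed

text \<open>
  Bisecting all sides of a cube, the children are indexed by the set of coordinates in which the upper half is
  taken.
\<close>

definition child :: "'a::euclidean_space \<Rightarrow> real \<Rightarrow> 'a set \<Rightarrow> 'a" where
  "child c s S = c + (s / 2) *\<^sub>R \<Sum>S"

lemma child_inner:
  assumes "S \<subseteq> Basis" "b \<in> Basis"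
  shows "child c s S \<bullet> b = c \<bullet> b + (if b \<in> S then s / 2 else 0)"
proof -
  have "finite S" using assms(1) finite_Basis finite_subset by blast
  then have "\<Sum>S \<bullet> b = (if b \<in> S then 1 else 0)"
    using assms by (simp add: inner_sum_left inner_Basis subset_iff sum.delta' cong: sum.cong)
  then show ?thesis by (simp add: child_def inner_add_left)
qed

lemma mem_child_iff:
  assumes "0 < s" "S \<subseteq> Basis"
  shows "x \<in> cube (child c s S) (s / 2) \<longleftrightarrow> x \<in> cube c s \<and> S = {b \<in> Basis. c \<bullet> b + s / 2 \<le> x \<bullet> b}"
proof -
  have "(c \<bullet> b + (if b \<in> S then s / 2 else 0) \<le> x \<bullet> b \<and> x \<bullet> b < c \<bullet> b + (if b \<in> S then s / 2 else 0) + s / 2)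
     \<longleftrightarrow> (c \<bullet> b \<le> x \<bullet> b \<and> x \<bullet> b < c \<bullet> b + s) \<and> (b \<in> S \<longleftrightarrow> c \<bullet> b + s / 2 \<le> x \<bullet> b)" for b
    using assms(1) by (cases "b \<in> S"; simp; linarith)
  then have "x \<in> cube (child c s S) (s / 2) \<longleftrightarrow>
     (\<forall>b\<in>Basis. (c \<bullet> b \<le> x \<bullet> b \<and> x \<bullet> b < c \<bullet> b + s) \<and> (b \<in> S \<longleftrightarrow> c \<bullet> b + s / 2 \<le> x \<bullet> b))"
    using assms(2) by (simp add: cube_def child_inner)
  then show ?thesis using assms(2) unfolding cube_def mem_Collect_eq by blast
qed

text \<open>
  The function is constant on each of the cubes obtained from the given one after \<open>d\<close> bisections.
\<close>

fun fine_on :: "nat \<Rightarrow> ('a::euclidean_space \<Rightarrow> real) \<Rightarrow> 'a \<Rightarrow> real \<Rightarrow> bool" where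
  "fine_on 0 f c s \<longleftrightarrow> (\<forall>x\<in>cube c s. \<forall>y\<in>cube c s. f x = f y)"
| "fine_on (Suc d) f c s \<longleftrightarrow> (\<forall>S. S \<subseteq> Basis \<longrightarrow> fine_on d f (child c s S) (s / 2))"

lemma fine_on_dyadic:
  assumes f: "\<And>x y. same_cell N x y \<Longrightarrow> f x = f y"
    and "\<And>b. b \<in> Basis \<Longrightarrow> 2 ^ N * (c \<bullet> b) \<in> \<int>"
  shows "fine_on d f c (2 ^ d / 2 ^ N)"
  using assms(2)
proof (induction d arbitrary: c)
  case 0
  have "\<lfloor>2 ^ N * (x \<bullet> b)\<rfloor> = \<lfloor>2 ^ N * (c \<bullet> b)\<rfloor>" if x: "x \<in> cube c (1 / 2 ^ N)" and b: "b \<in> Basis" for x b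
  proof -
    obtain k where k: "2 ^ N * (c \<bullet> b) = real_of_int k" using 0[OF b] by (auto elim: Ints_cases)
    have "c \<bullet> b \<le> x \<bullet> b" "x \<bullet> b < c \<bullet> b + 1 / 2 ^ N" using x b by (auto simp: cube_def)
    then have "2 ^ N * (c \<bullet> b) \<le> 2 ^ N * (x \<bullet> b)" "2 ^ N * (x \<bullet> b) < 2 ^ N * (c \<bullet> b) + 1"
      by (auto simp: field_simps)
    then have "\<lfloor>2 ^ N * (x \<bullet> b)\<rfloor> = k" using k by (intro floor_unique) auto
    then show ?thesis using k by simp
  qed
  then have "same_cell N x c" if "x \<in> cube c (1 / 2 ^ N)" for x
    using that by (simp add: same_cell_def)
  then show ?case using f by (metis fine_on.simps(1) power_0)
next
  case (Suc d)
  have "2 ^ N * (child c (2 ^ Suc d / 2 ^ N) S \<bullet> b) \<in> \<int>" if "S \<subseteq> Basis" "b \<in> Basis" for S b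
    using Suc.prems[OF that(2)] that by (auto simp: child_inner distrib_left)
  then show ?case using Suc.IH by auto
qed

text \<open>
  Induction on the number of bisections left. A child whose average exceeds \<open>h\<close> is selected; its average is at
  most \<open>2 ^ DIM('a)\<close> times that of the parent, which is at most \<open>h\<close>. The other children are subdivided
  further, and when no bisection is left \<open>f\<close> is constant and equals its average.
\<close>

lemma cz_stopping_cubes:
  fixes f :: "'a::euclidean_space \<Rightarrow> real"
  assumes f: "integrable lborel f" "\<And>x. 0 \<le> f x"
  assumes "fine_on d f c s" "0 < s" "(\<integral>x. indicator (cube c s) x * f x \<partial>lborel) \<le> h * s ^ DIM('a)"
  shows "\<exists>\<Q>. finite \<Q> \<and> disjoint_family_on (\<lambda>(c, s). cube c s) \<Q> \<and>
    (\<forall>(c', s')\<in>\<Q>. 0 < s' \<and> cube c' s' \<subseteq> cube c s \<and>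
       h * s' ^ DIM('a) < (\<integral>x. indicator (cube c' s') x * f x \<partial>lborel) \<and>
       (\<integral>x. indicator (cube c' s') x * f x \<partial>lborel) \<le> 2 ^ DIM('a) * h * s' ^ DIM('a)) \<and>
    (\<forall>x \<in> cube c s - (\<Union>(c', s')\<in>\<Q>. cube c' s'). f x \<le> h)"
  using assms(3-5)
proof (induction d arbitrary: c s)
  case 0
  have "f x \<le> h" if x: "x \<in> cube c s" for x
  proof -
    have const: "f y = f x" if "y \<in> cube c s" for y using 0(1) x that by (metis fine_on.simps(1))
    have "(\<integral>y. indicator (cube c s) y * f y \<partial>lborel) = (\<integral>y. f x * indicator (cube c s) y \<partial>lborel)"
      by (intro Bochner_Integration.integral_cong) (auto simp: indicator_def const)
    also have "\<dots> = f x * s ^ DIM('a)" using 0(2) by (simp add: measure_cube)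
    finally have "f x * s ^ DIM('a) \<le> h * s ^ DIM('a)" using 0(3) by simp
    then show ?thesis using 0(2) by simp
  qed
  then show ?case by (intro exI[of _ "{}"]) (auto simp: disjoint_family_on_def)
next
  case (Suc d)
  let ?I = "\<lambda>c s. (\<integral>x. indicator (cube c s) x * f x \<partial>lborel)"
  let ?P = "\<lambda>c s \<Q>. finite \<Q> \<and> disjoint_family_on (\<lambda>(c, s). cube c s) \<Q> \<and>
    (\<forall>(c', s')\<in>\<Q>. 0 < s' \<and> cube c' s' \<subseteq> cube c s \<and>
       h * s' ^ DIM('a) < ?I c' s' \<and> ?I c' s' \<le> 2 ^ DIM('a) * h * s' ^ DIM('a)) \<and>
    (\<forall>x \<in> cube c s - (\<Union>(c', s')\<in>\<Q>. cube c' s'). f x \<le> h)"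
  have int: "integrable lborel (\<lambda>x. indicator A x * f x)" if "A \<in> sets borel" for A
    using integrable_mult_indicator[OF _ f(1), of A] that by simp
  have "\<exists>\<Q>. ?P (child c s S) (s / 2) \<Q>" if S: "S \<in> Pow Basis" for S
  proof (cases "?I (child c s S) (s / 2) \<le> h * (s / 2) ^ DIM('a)")
    case True
    then show ?thesis using Suc.IH[of "child c s S" "s / 2"] Suc.prems S by simp
  next
    case False
    have "?I (child c s S) (s / 2) \<le> ?I c s"
      using f Suc.prems(2) S by (intro integral_mono int) (auto simp: indicator_def mem_child_iff)
    also have "\<dots> \<le> h * s ^ DIM('a)" by (rule Suc.prems)
    also have "\<dots> = 2 ^ DIM('a) * h * (s / 2) ^ DIM('a)" by (simp add: power_divide)
    finally show ?thesis using False Suc.prems(2)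
      by (intro exI[of _ "{(child c s S, s / 2)}"]) (auto simp: disjoint_family_on_def)
  qed
  then have "\<forall>S\<in>Pow Basis. \<exists>\<Q>. ?P (child c s S) (s / 2) \<Q>" by (rule ballI)
  from bchoice[OF this] obtain Q where Q0: "\<forall>S\<in>Pow Basis. ?P (child c s S) (s / 2) (Q S)" by (rule exE)
  have Q: "?P (child c s S) (s / 2) (Q S)" if "S \<subseteq> Basis" for S
    by (rule bspec[OF Q0]) (rule PowI[OF that])
  have sub: "cube (child c s S) (s / 2) \<subseteq> cube c s" if "S \<subseteq> Basis" for S
    using Suc.prems(2) that by (auto simp: mem_child_iff)
  have "?P c s (\<Union>S\<in>Pow Basis. Q S)"
  proof (intro conjI)
    show "finite (\<Union>S\<in>Pow Basis. Q S)" using Q by (intro finite_UN_I) auto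
    show "disjoint_family_on (\<lambda>(c, s). cube c s) (\<Union>S\<in>Pow Basis. Q S)"
      unfolding disjoint_family_on_def
    proof (intro ballI impI)
      fix p p' assume p: "p \<in> (\<Union>S\<in>Pow Basis. Q S)" "p' \<in> (\<Union>S\<in>Pow Basis. Q S)" and ne: "p \<noteq> p'"
      obtain S S' where S: "S \<subseteq> Basis" "p \<in> Q S" "S' \<subseteq> Basis" "p' \<in> Q S'" using p by auto
      show "(case p of (c, s) \<Rightarrow> cube c s) \<inter> (case p' of (c, s) \<Rightarrow> cube c s) = {}"
      proof (cases "S = S'")
        case True
        then show ?thesis using Q[OF S(1)] S ne unfolding disjoint_family_on_def by blast
      next
        case False
        have "(case p of (c, s) \<Rightarrow> cube c s) \<subseteq> cube (child c s S) (s / 2)"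
          "(case p' of (c, s) \<Rightarrow> cube c s) \<subseteq> cube (child c s S') (s / 2)"
          using Q[OF S(1)] Q[OF S(3)] S by (auto split: prod.splits)
        moreover have "cube (child c s S) (s / 2) \<inter> cube (child c s S') (s / 2) = {}"
          using False Suc.prems(2) S by (auto simp: mem_child_iff)
        ultimately show ?thesis by blast
      qed
    qed
    show "\<forall>(c', s')\<in>\<Union>S\<in>Pow Basis. Q S. 0 < s' \<and> cube c' s' \<subseteq> cube c s \<and>
       h * s' ^ DIM('a) < ?I c' s' \<and> ?I c' s' \<le> 2 ^ DIM('a) * h * s' ^ DIM('a)"
    proof (clarify)
      fix c' s' S assume S: "S \<subseteq> Basis" "(c', s') \<in> Q S"
      then have "0 < s' \<and> cube c' s' \<subseteq> cube (child c s S) (s / 2) \<and>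
       h * s' ^ DIM('a) < ?I c' s' \<and> ?I c' s' \<le> 2 ^ DIM('a) * h * s' ^ DIM('a)"
        using Q[OF S(1)] by blast
      then show "0 < s' \<and> cube c' s' \<subseteq> cube c s \<and>
       h * s' ^ DIM('a) < ?I c' s' \<and> ?I c' s' \<le> 2 ^ DIM('a) * h * s' ^ DIM('a)"
        using sub[OF S(1)] by blast
    qed
    show "\<forall>x \<in> cube c s - (\<Union>(c', s')\<in>(\<Union>S\<in>Pow Basis. Q S). cube c' s'). f x \<le> h"
    proof
      fix x assume x: "x \<in> cube c s - (\<Union>(c', s')\<in>(\<Union>S\<in>Pow Basis. Q S). cube c' s')"
      define S where "S = {b \<in> Basis. c \<bullet> b + s / 2 \<le> x \<bullet> b}"
      have S: "S \<subseteq> Basis" by (auto simp: S_def)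
      then have "x \<in> cube (child c s S) (s / 2)"
        using x Suc.prems(2) by (simp add: mem_child_iff S_def[symmetric])
      moreover have "x \<notin> (\<Union>(c', s')\<in>Q S. cube c' s')" using x S by blast
      ultimately show "f x \<le> h" using Q[OF S] by blast
    qed
  qed
  then show ?case by blast
qed

text \<open>
  Starting from a cube that contains the support and is so large that the average of \<open>f\<close> over it is at most
  \<open>h\<close>.
\<close>

theorem calderon_zygmund_cubes:
  fixes f :: "'a::euclidean_space \<Rightarrow> real"
  assumes f: "step_fun f" "\<And>x. 0 \<le> f x" and h: "0 < h"
  obtains \<Q> where "finite \<Q>" "disjoint_family_on (\<lambda>(c, s). cube c s) \<Q>"
    "\<And>c s. (c, s) \<in> \<Q> \<Longrightarrow> 0 < s"
    "\<And>c s. (c, s) \<in> \<Q> \<Longrightarrow> h * s ^ DIM('a) < (\<integral>x. indicator (cube c s) x * f x \<partial>lborel)"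
    "\<And>c s. (c, s) \<in> \<Q> \<Longrightarrow> (\<integral>x. indicator (cube c s) x * f x \<partial>lborel) \<le> 2 ^ DIM('a) * h * s ^ DIM('a)"
    "\<And>x. x \<notin> (\<Union>(c, s)\<in>\<Q>. cube c s) \<Longrightarrow> f x \<le> h"
proof -
  obtain N where N: "\<And>x y. same_cell N x y \<Longrightarrow> f x = f y" and bd: "bounded {x. f x \<noteq> 0}"
    using f(1) by (auto simp: step_fun_def)
  obtain r where r: "\<And>x. f x \<noteq> 0 \<Longrightarrow> norm x \<le> r" using bd by (auto simp: bounded_iff)
  have int: "integrable lborel f" by (rule step_fun_integrable[OF f(1)])
  obtain k :: nat where k: "max (r + 1) ((\<integral>x. f x \<partial>lborel) / h) < 2 ^ k"
    using real_arch_pow[of 2] by fastforce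
  define s :: real where "s = 2 ^ (k + 1)"
  define c :: 'a where "c = - (2 ^ k *\<^sub>R One)"
  have s: "0 < s" "1 \<le> s" by (simp_all add: s_def del: power_Suc)
  have cb: "c \<bullet> b = - (2 ^ k)" if "b \<in> Basis" for b using that by (simp add: c_def)
  have sup: "x \<in> cube c s" if "f x \<noteq> 0" for x
  proof -
    have "\<bar>x \<bullet> b\<bar> < 2 ^ k" if "b \<in> Basis" for b
      using r[OF \<open>f x \<noteq> 0\<close>] k Basis_le_norm[OF that, of x] by linarith
    then show ?thesis by (fastforce simp: cube_def cb s_def abs_less_iff)
  qed
  have "fine_on (N + k + 1) f c (2 ^ (N + k + 1) / 2 ^ N)"
    by (rule fine_on_dyadic[OF N]) (auto simp: cb)
  then have fine: "fine_on (N + k + 1) f c s"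
    by (simp add: s_def power_add)
  have "(\<integral>x. indicator (cube c s) x * f x \<partial>lborel) = (\<integral>x. f x \<partial>lborel)"
    using sup by (intro Bochner_Integration.integral_cong) (auto simp: indicator_def)
  also have "\<dots> \<le> h * 2 ^ k" using k h by (simp add: field_simps)
  also have "\<dots> \<le> h * s" using h by (simp add: s_def)
  also have "\<dots> \<le> h * s ^ DIM('a)" using h s by (simp add: self_le_power)
  finally have le: "(\<integral>x. indicator (cube c s) x * f x \<partial>lborel) \<le> h * s ^ DIM('a)" .
  obtain \<Q> where Q: "finite \<Q>" "disjoint_family_on (\<lambda>(c, s). cube c s) \<Q>"
    "\<forall>(c', s')\<in>\<Q>. 0 < s' \<and> cube c' s' \<subseteq> cube c s \<and>
       h * s' ^ DIM('a) < (\<integral>x. indicator (cube c' s') x * f x \<partial>lborel) \<and>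
       (\<integral>x. indicator (cube c' s') x * f x \<partial>lborel) \<le> 2 ^ DIM('a) * h * s' ^ DIM('a)"
    "\<forall>x \<in> cube c s - (\<Union>(c', s')\<in>\<Q>. cube c' s'). f x \<le> h"
    using cz_stopping_cubes[OF int f(2) fine s(1) le] by (elim exE conjE) (rule that)
  show thesis
  proof (rule that[OF Q(1,2)])
    fix x assume "x \<notin> (\<Union>(c, s)\<in>\<Q>. cube c s)"
    then show "f x \<le> h" using Q(4) sup[of x] h by (cases "f x = 0") auto
  qed (use Q(3) in auto)
qed

section \<open>The Fourier transform and multipliers on \<open>L\<^sup>2\<close>\<close>

definition fourier :: "('a::euclidean_space \<Rightarrow> real) \<Rightarrow> 'a \<Rightarrow> complex" where
  "fourier h \<xi> = (\<integral>x. h x *\<^sub>R cis (- (\<xi> \<bullet> x)) \<partial>lborel)"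

lemma cis_measurable [measurable]: "cis \<in> borel_measurable borel"
  by (intro borel_measurable_continuous_onI continuous_intros)

lemma fourier_measurable [measurable]:
  assumes [measurable]: "h \<in> borel_measurable borel"
  shows "fourier h \<in> borel_measurable borel"
  unfolding fourier_def[abs_def] by measurable

lemma fourier_integrable:
  assumes "integrable lborel h" shows "integrable lborel (\<lambda>x. h x *\<^sub>R cis (- (\<xi> \<bullet> x)))"
proof -
  have [measurable]: "h \<in> borel_measurable borel" using assms by auto
  show ?thesis by (rule Bochner_Integration.integrable_bound[OF assms]) auto
qed

lemma fourier_norm_le:
  assumes "integrable lborel h" shows "cmod (fourier h \<xi>) \<le> (\<integral>x. \<bar>h x\<bar> \<partial>lborel)"
  unfolding fourier_def using integral_norm_bound[of lborel "\<lambda>x. h x *\<^sub>R cis (- (\<xi> \<bullet> x))"] by simp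

lemma fourier_reflect:
  assumes [measurable]: "h \<in> borel_measurable borel"
  shows "fourier (\<lambda>x. h (- x)) \<xi> = fourier h (- \<xi>)"
  unfolding fourier_def
  using integral_lborel_reflect(1)[of "\<lambda>x. h x *\<^sub>R cis (\<xi> \<bullet> x)" 0] by simp

lemma fourier_uminus: "fourier h (- \<xi>) = cnj (fourier h \<xi>)"
  unfolding fourier_def Bochner_Integration.integral_cnj[symmetric] by (simp add: cis_cnj)

lemma integrable_conv_pair:
  fixes K f :: "'a::euclidean_space \<Rightarrow> real"
  assumes K: "integrable lborel K" and f: "integrable lborel f"
  shows "integrable (lborel \<Otimes>\<^sub>M lborel) (\<lambda>(x, y). K (x - y) * f y)"
proof -
  have [measurable]: "K \<in> borel_measurable borel" "f \<in> borel_measurable borel" using K f by auto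
  have "(\<integral>\<^sup>+x. \<integral>\<^sup>+y. ennreal (norm (K (x - y) * f y)) \<partial>lborel \<partial>lborel) =
     (\<integral>\<^sup>+y. \<integral>\<^sup>+x. ennreal (norm (K (x - y) * f y)) \<partial>lborel \<partial>lborel)"
    by (subst lborel_pair.Fubini') auto
  also have "\<dots> = (\<integral>\<^sup>+y. (\<integral>\<^sup>+x. ennreal \<bar>K x\<bar> \<partial>lborel) * ennreal \<bar>f y\<bar> \<partial>lborel)"
  proof (intro nn_integral_cong)
    fix y
    have "(\<integral>\<^sup>+x. ennreal (norm (K (x - y) * f y)) \<partial>lborel) = (\<integral>\<^sup>+x. ennreal \<bar>K (x - y)\<bar> \<partial>lborel) * ennreal \<bar>f y\<bar>"
      by (subst nn_integral_multc[symmetric]) (auto simp: abs_mult ennreal_mult)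
    then show "(\<integral>\<^sup>+x. ennreal (norm (K (x - y) * f y)) \<partial>lborel) = (\<integral>\<^sup>+x. ennreal \<bar>K x\<bar> \<partial>lborel) * ennreal \<bar>f y\<bar>"
      using nn_integral_lborel_shift[of "\<lambda>x. ennreal \<bar>K x\<bar>" y] by simp
  qed
  also have "\<dots> = (\<integral>\<^sup>+x. ennreal \<bar>K x\<bar> \<partial>lborel) * (\<integral>\<^sup>+y. ennreal \<bar>f y\<bar> \<partial>lborel)"
    by (rule nn_integral_cmult) auto
  also have "\<dots> < \<infinity>"
    using K f by (auto simp: integrable_iff_bounded ennreal_mult_less_top)
  finally show ?thesis
    by (intro integrableI_bounded) (auto simp: lborel.nn_integral_fst[symmetric] split_beta)
qed

lemma integrable_conv:
  assumes "integrable lborel K" "integrable lborel f" shows "integrable lborel (conv K f)"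
  using lborel_pair.integrable_fst[OF integrable_conv_pair[OF assms]] by (simp add: conv_def[abs_def])

lemma fourier_conv:
  fixes K f :: "'a::euclidean_space \<Rightarrow> real"
  assumes K: "integrable lborel K" and f: "integrable lborel f"
  shows "fourier (conv K f) \<xi> = fourier K \<xi> * fourier f \<xi>"
proof -
  have [measurable]: "K \<in> borel_measurable borel" "f \<in> borel_measurable borel" using K f by auto
  have int: "integrable (lborel \<Otimes>\<^sub>M lborel) (\<lambda>(x, y). (K (x - y) * f y) *\<^sub>R cis (- (\<xi> \<bullet> x)))"
    by (rule Bochner_Integration.integrable_bound[OF integrable_conv_pair[OF K f]]) (auto simp: split_beta)
  have "fourier (conv K f) \<xi> = (\<integral>x. \<integral>y. (K (x - y) * f y) *\<^sub>R cis (- (\<xi> \<bullet> x)) \<partial>lborel \<partial>lborel)"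
    unfolding fourier_def conv_def
  proof (intro Bochner_Integration.integral_cong refl)
    fix x show "(\<integral>y. K (x - y) * f y \<partial>lborel) *\<^sub>R cis (- (\<xi> \<bullet> x)) = (\<integral>y. (K (x - y) * f y) *\<^sub>R cis (- (\<xi> \<bullet> x)) \<partial>lborel)"
    proof (cases "integrable lborel (\<lambda>y. K (x - y) * f y)")
      case False
      have "\<not> integrable lborel (\<lambda>y. (K (x - y) * f y) *\<^sub>R cis (- (\<xi> \<bullet> x)))"
      proof
        assume "integrable lborel (\<lambda>y. (K (x - y) * f y) *\<^sub>R cis (- (\<xi> \<bullet> x)))"
        from integrable_norm[OF this] have "integrable lborel (\<lambda>y. \<bar>K (x - y) * f y\<bar>)" by simp
        with False show False by (subst (asm) integrable_abs_iff) auto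
      qed
      with False show ?thesis by (simp add: not_integrable_integral_eq)
    qed simp
  qed
  also have "\<dots> = (\<integral>y. \<integral>x. (K (x - y) * f y) *\<^sub>R cis (- (\<xi> \<bullet> x)) \<partial>lborel \<partial>lborel)"
    using lborel_pair.Fubini_integral[OF int] by simp
  also have "\<dots> = (\<integral>y. fourier K \<xi> * (f y *\<^sub>R cis (- (\<xi> \<bullet> y))) \<partial>lborel)"
  proof (intro Bochner_Integration.integral_cong refl)
    fix y
    have "(\<integral>x. (K (x - y) * f y) *\<^sub>R cis (- (\<xi> \<bullet> x)) \<partial>lborel) = (\<integral>x. (K x *\<^sub>R cis (- (\<xi> \<bullet> x))) * (f y *\<^sub>R cis (- (\<xi> \<bullet> y))) \<partial>lborel)"
      by (subst integral_lborel_shift(1)[of _ y, symmetric])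
         (auto intro!: Bochner_Integration.integral_cong simp: inner_diff_right cis_mult)
    also have "\<dots> = fourier K \<xi> * (f y *\<^sub>R cis (- (\<xi> \<bullet> y)))"
      unfolding fourier_def by (intro Bochner_Integration.integral_mult_left fourier_integrable K)
    finally show "(\<integral>x. (K (x - y) * f y) *\<^sub>R cis (- (\<xi> \<bullet> x)) \<partial>lborel) = fourier K \<xi> * (f y *\<^sub>R cis (- (\<xi> \<bullet> y)))" .
  qed
  also have "\<dots> = fourier K \<xi> * fourier f \<xi>"
    unfolding fourier_def[of f] by (intro Bochner_Integration.integral_mult_right fourier_integrable f)
  finally show ?thesis .
qed

definition gauss :: "'a::euclidean_space \<Rightarrow> real" where
  "gauss x = (\<Prod>b\<in>Basis. std_normal_density (x \<bullet> b))"

lemma gauss_nonneg [simp]: "0 \<le> gauss x"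
  by (simp add: gauss_def prod_nonneg)

lemma gauss_measurable [measurable]: "gauss \<in> borel_measurable borel"
  unfolding gauss_def[abs_def] by measurable

lemma std_normal_integral_iexp:
  "(\<integral>x. std_normal_density x *\<^sub>R cis (t * x) \<partial>lborel) = of_real (exp (- (t ^ 2) / 2))"
proof -
  have "char std_normal_distribution t = (\<integral>x. std_normal_density x *\<^sub>R iexp (t * x) \<partial>lborel)"
    unfolding char_def by (subst integral_density) auto
  then show ?thesis by (simp add: char_std_normal_distribution cis_conv_exp)
qed

lemma integrable_prod_Basis:
  fixes g :: "'a::euclidean_space \<Rightarrow> real \<Rightarrow> 'b::{real_normed_field,banach,second_countable_topology}"
  assumes g: "\<And>b. b \<in> Basis \<Longrightarrow> integrable lborel (g b)"
  shows "integrable lborel (\<lambda>x::'a. \<Prod>b\<in>Basis. g b (x \<bullet> b))"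
    and "(\<integral>x. (\<Prod>b\<in>Basis. g b (x \<bullet> b)) \<partial>(lborel :: 'a measure)) = (\<Prod>b\<in>Basis. \<integral>t. g b t \<partial>lborel)"
proof -
  have m: "g b \<in> borel_measurable borel" if "b \<in> Basis" for b using g[OF that] by auto
  have [measurable]: "(\<lambda>x::'a. \<Prod>b\<in>Basis. g b (x \<bullet> b)) \<in> borel_measurable borel"
    using m by (intro borel_measurable_prod measurable_compose[OF _ m]) auto
  interpret product_sigma_finite "\<lambda>b::'a. lborel :: real measure" ..
  have eq: "(\<Prod>b\<in>Basis. g b ((\<Sum>b\<in>Basis. f b *\<^sub>R b) \<bullet> b)) = (\<Prod>b\<in>Basis. g b (f b))" for f :: "'a \<Rightarrow> real"
    by (intro prod.cong refl) simp
  have "integrable (\<Pi>\<^sub>M b\<in>(Basis::'a set). lborel) (\<lambda>f. \<Prod>b\<in>Basis. g b (f b))"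
    by (intro product_integrable_prod g) auto
  then show "integrable lborel (\<lambda>x::'a. \<Prod>b\<in>Basis. g b (x \<bullet> b))"
    by (subst lborel_eq, subst integrable_distr_eq) (auto simp: eq)
  show "(\<integral>x. (\<Prod>b\<in>Basis. g b (x \<bullet> b)) \<partial>(lborel :: 'a measure)) = (\<Prod>b\<in>Basis. \<integral>t. g b t \<partial>lborel)"
    by (subst lborel_eq, subst integral_distr) (auto simp: eq intro!: product_integral_prod g)
qed

lemma gauss_integrable: "integrable lborel (gauss :: 'a::euclidean_space \<Rightarrow> real)"
  and gauss_integral: "(\<integral>x. gauss x \<partial>(lborel :: 'a measure)) = 1"
proof -
  have n: "integrable lborel std_normal_density" "(\<integral>x. std_normal_density x \<partial>lborel) = 1"
    using std_normal_moment_even[of 0] by (auto simp: has_bochner_integral_iff)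
  show "integrable lborel (gauss :: 'a \<Rightarrow> real)" "(\<integral>x. gauss x \<partial>(lborel :: 'a measure)) = 1"
    unfolding gauss_def[abs_def] using integrable_prod_Basis[where 'a='a and g = "\<lambda>_. std_normal_density"] n
    by simp_all
qed

text \<open>
  The product structure reduces this to the characteristic function of the standard normal distribution.
\<close>

lemma gauss_fourier:
  fixes z :: "'a::euclidean_space"
  shows "fourier gauss z = of_real (sqrt (2 * pi) ^ DIM('a) * gauss z)"
proof -
  have int: "integrable lborel (\<lambda>t. std_normal_density t *\<^sub>R cis (- ((z \<bullet> b) * t)))" for b
    by (rule Bochner_Integration.integrable_bound[where f = std_normal_density]) auto
  have cis_sum: "cis (\<Sum>b\<in>B. a b) = (\<Prod>b\<in>B. cis (a b))" if "finite B" for a :: "'a \<Rightarrow> real" and B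
    using that by (induction B) (auto simp: cis_mult[symmetric])
  have "gauss x *\<^sub>R cis (- (z \<bullet> x)) = (\<Prod>b\<in>Basis. std_normal_density (x \<bullet> b) *\<^sub>R cis (- ((z \<bullet> b) * (x \<bullet> b))))" for x
    by (simp add: gauss_def euclidean_inner[of z x] sum_negf[symmetric] cis_sum scaleR_conv_of_real prod.distrib)
  then have "fourier gauss z = (\<integral>x. (\<Prod>b\<in>Basis. std_normal_density (x \<bullet> b) *\<^sub>R cis (- ((z \<bullet> b) * (x \<bullet> b)))) \<partial>(lborel :: 'a measure))"
    by (simp add: fourier_def)
  also have "\<dots> = (\<Prod>b\<in>Basis. \<integral>t. std_normal_density t *\<^sub>R cis (- ((z \<bullet> b) * t)) \<partial>lborel)"
    by (rule integrable_prod_Basis(2)) (rule int)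
  also have "\<dots> = (\<Prod>b\<in>(Basis::'a set). of_real (sqrt (2 * pi) * std_normal_density (z \<bullet> b)))"
    using std_normal_integral_iexp[of "- (z \<bullet> b)" for b] by (intro prod.cong) (auto simp: std_normal_density_def)
  finally show ?thesis by (simp add: gauss_def prod.distrib)
qed

lemma integral_lborel_scale:
  fixes f :: "'a::euclidean_space \<Rightarrow> 'b::{banach,second_countable_topology}"
  assumes [measurable]: "f \<in> borel_measurable borel" and c: "0 < c"
  shows "(\<integral>x. f x \<partial>lborel) = c ^ DIM('a) *\<^sub>R (\<integral>x. f (c *\<^sub>R x) \<partial>lborel)"
    and "integrable lborel (\<lambda>x. f (c *\<^sub>R x)) \<longleftrightarrow> integrable lborel f"
proof -
  have eq: "lborel = density (distr lborel borel (\<lambda>x::'a. c *\<^sub>R x)) (\<lambda>_. ennreal (c ^ DIM('a)))"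
    using lborel_affine[of c 0] c by simp
  show "(\<integral>x. f x \<partial>lborel) = c ^ DIM('a) *\<^sub>R (\<integral>x. f (c *\<^sub>R x) \<partial>lborel)"
    using c by (subst eq, subst integral_density) (auto simp: integral_distr)
  show "integrable lborel (\<lambda>x. f (c *\<^sub>R x)) \<longleftrightarrow> integrable lborel f"
  proof -
    have "integrable lborel f \<longleftrightarrow> integrable lborel (\<lambda>x. c ^ DIM('a) *\<^sub>R f (c *\<^sub>R x))"
      using c by (subst eq, subst integrable_density) (auto simp: integrable_distr_eq)
    moreover have "integrable lborel (\<lambda>x. f (c *\<^sub>R x))" if "integrable lborel (\<lambda>x. c ^ DIM('a) *\<^sub>R f (c *\<^sub>R x))"
      using integrable_scaleR_right[OF that, of "1 / c ^ DIM('a)"] c by simp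
    ultimately show ?thesis by (auto intro: integrable_scaleR_right)
  qed
qed

text \<open>
  Fubini moves the Fourier transform from \<open>a\<close> to the Gaussian; the dilations by \<open>s\<close> on the two sides
  then cancel.
\<close>

lemma fourier_gauss_pairing:
  fixes a :: "'a::euclidean_space \<Rightarrow> real"
  assumes a: "integrable lborel a" and s: "0 < s"
  shows "(\<integral>\<xi>. gauss (s *\<^sub>R \<xi>) *\<^sub>R fourier a \<xi> \<partial>lborel) =
    of_real (sqrt (2 * pi) ^ DIM('a) * (\<integral>z. gauss z * a (s *\<^sub>R z) \<partial>lborel))"
proof -
  have [measurable]: "a \<in> borel_measurable borel" using a by auto
  have g: "integrable lborel (\<lambda>\<xi>::'a. gauss (s *\<^sub>R \<xi>))"
    using integral_lborel_scale(2)[of "gauss :: 'a \<Rightarrow> real" s] gauss_integrable s by simp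
  have int: "integrable (lborel \<Otimes>\<^sub>M lborel) (\<lambda>(x, \<xi>). (gauss (s *\<^sub>R \<xi>) * a x) *\<^sub>R cis (- (\<xi> \<bullet> x)))"
  proof (rule Bochner_Integration.integrable_bound)
    show "integrable (lborel \<Otimes>\<^sub>M (lborel :: 'a measure)) (\<lambda>(x, \<xi>). gauss (s *\<^sub>R \<xi>) * a x)"
    proof (rule integrableI_bounded)
      have "(\<integral>\<^sup>+p. ennreal (norm (case p of (x, \<xi>) \<Rightarrow> gauss (s *\<^sub>R \<xi>) * a x)) \<partial>(lborel \<Otimes>\<^sub>M (lborel :: 'a measure))) =
        (\<integral>\<^sup>+x. \<integral>\<^sup>+\<xi>. ennreal (norm (gauss (s *\<^sub>R \<xi>) * a x)) \<partial>(lborel :: 'a measure) \<partial>lborel)"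
        by (subst lborel.nn_integral_fst[symmetric]) auto
      also have "\<dots> = (\<integral>\<^sup>+x. (\<integral>\<^sup>+\<xi>. ennreal (gauss (s *\<^sub>R \<xi>)) \<partial>(lborel :: 'a measure)) * ennreal \<bar>a x\<bar> \<partial>lborel)"
        by (subst nn_integral_multc[symmetric]) (auto simp: abs_mult ennreal_mult)
      also have "\<dots> = (\<integral>\<^sup>+\<xi>. ennreal (gauss (s *\<^sub>R \<xi>)) \<partial>(lborel :: 'a measure)) * (\<integral>\<^sup>+x. ennreal \<bar>a x\<bar> \<partial>lborel)"
        by (rule nn_integral_cmult) auto
      also have "\<dots> < \<infinity>"
        using a g by (auto simp: integrable_iff_bounded ennreal_mult_less_top)
      finally show "(\<integral>\<^sup>+p. ennreal (norm (case p of (x, \<xi>) \<Rightarrow> gauss (s *\<^sub>R \<xi>) * a x)) \<partial>(lborel \<Otimes>\<^sub>M (lborel :: 'a measure))) < \<infinity>" .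
    qed auto
  qed (auto simp: split_beta)
  have "(\<integral>\<xi>. gauss (s *\<^sub>R \<xi>) *\<^sub>R fourier a \<xi> \<partial>lborel) =
     (\<integral>\<xi>. \<integral>x. (gauss (s *\<^sub>R \<xi>) * a x) *\<^sub>R cis (- (\<xi> \<bullet> x)) \<partial>lborel \<partial>lborel)"
    unfolding fourier_def integral_scaleR_right[symmetric] by simp
  also have "\<dots> = (\<integral>x. \<integral>\<xi>. (gauss (s *\<^sub>R \<xi>) * a x) *\<^sub>R cis (- (\<xi> \<bullet> x)) \<partial>lborel \<partial>lborel)"
    using lborel_pair.Fubini_integral[OF int] by simp
  also have "\<dots> = s ^ DIM('a) *\<^sub>R (\<integral>x. \<integral>\<xi>. (gauss (s *\<^sub>R \<xi>) * a (s *\<^sub>R x)) *\<^sub>R cis (- (\<xi> \<bullet> (s *\<^sub>R x))) \<partial>lborel \<partial>lborel)"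
    by (rule integral_lborel_scale(1)) (use s in auto)
  also have "\<dots> = (\<integral>x. s ^ DIM('a) *\<^sub>R (\<integral>\<xi>. (gauss (s *\<^sub>R \<xi>) * a (s *\<^sub>R x)) *\<^sub>R cis (- ((s *\<^sub>R \<xi>) \<bullet> x)) \<partial>lborel) \<partial>lborel)"
    by (subst integral_scaleR_right[symmetric]) simp
  also have "\<dots> = (\<integral>x. (\<integral>\<xi>. (gauss \<xi> * a (s *\<^sub>R x)) *\<^sub>R cis (- (\<xi> \<bullet> x)) \<partial>lborel) \<partial>lborel)"
    by (subst integral_lborel_scale(1)[OF _ s, symmetric]) auto
  also have "\<dots> = (\<integral>x. a (s *\<^sub>R x) *\<^sub>R fourier gauss x \<partial>lborel)"
    unfolding fourier_def integral_scaleR_right[symmetric] by (simp add: mult.commute inner_commute)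
  also have "\<dots> = (\<integral>x. of_real (sqrt (2 * pi) ^ DIM('a) * (gauss x * a (s *\<^sub>R x))) \<partial>lborel)"
    by (simp add: gauss_fourier scaleR_conv_of_real mult_ac)
  also have "\<dots> = of_real (\<integral>x. sqrt (2 * pi) ^ DIM('a) * (gauss x * a (s *\<^sub>R x)) \<partial>lborel)"
    by (rule integral_complex_of_real)
  finally show ?thesis by simp
qed

text \<open>
  The Fourier transform of the autocorrelation is the squared modulus of the Fourier transform, and its value
  at the origin is the square of the norm in \<open>L\<^sup>2\<close>.
\<close>

definition autocorr :: "('a::euclidean_space \<Rightarrow> real) \<Rightarrow> 'a \<Rightarrow> real" where
  "autocorr h u = (\<integral>y. h (u + y) * h y \<partial>lborel)"

lemma autocorr_conv:
  assumes [measurable]: "h \<in> borel_measurable borel"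
  shows "autocorr h = conv h (\<lambda>x. h (- x))"
  using integral_lborel_reflect(1)[of "\<lambda>y. h (u + y) * h y" 0 for u]
  by (auto simp: autocorr_def conv_def)

text \<open>
  This takes the place of Plancherel's identity: as \<open>s\<close> tends to \<open>0\<close> the Gaussian weight tends to a constant
  and the right-hand side to a multiple of \<open>autocorr h 0\<close>. For positive \<open>s\<close> all the integrals converge for every
  integrable \<open>h\<close>.
\<close>

lemma gauss_energy:
  fixes h :: "'a::euclidean_space \<Rightarrow> real"
  assumes h: "integrable lborel h" and s: "0 < s"
  shows "integrable lborel (\<lambda>\<xi>. gauss (s *\<^sub>R \<xi>) * (cmod (fourier h \<xi>))\<^sup>2)"
    and "(\<integral>\<xi>. gauss (s *\<^sub>R \<xi>) * (cmod (fourier h \<xi>))\<^sup>2 \<partial>lborel) =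
      sqrt (2 * pi) ^ DIM('a) * (\<integral>z. gauss z * autocorr h (s *\<^sub>R z) \<partial>lborel)"
proof -
  have [measurable]: "h \<in> borel_measurable borel" using h by auto
  have h': "integrable lborel (\<lambda>x. h (- x))"
    using integral_lborel_reflect(2)[of h 0] h by simp
  have g: "integrable lborel (\<lambda>\<xi>::'a. gauss (s *\<^sub>R \<xi>))"
    using integral_lborel_scale(2)[of "gauss :: 'a \<Rightarrow> real" s] gauss_integrable s by simp
  define W where "W = (\<integral>x. \<bar>h x\<bar> \<partial>lborel)"
  show "integrable lborel (\<lambda>\<xi>. gauss (s *\<^sub>R \<xi>) * (cmod (fourier h \<xi>))\<^sup>2)"
  proof (rule Bochner_Integration.integrable_bound)
    show "integrable lborel (\<lambda>\<xi>::'a. gauss (s *\<^sub>R \<xi>) * W\<^sup>2)" using g by simp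
    show "AE \<xi> in lborel. norm (gauss (s *\<^sub>R \<xi>) * (cmod (fourier h \<xi>))\<^sup>2) \<le> norm (gauss (s *\<^sub>R \<xi>) * W\<^sup>2)"
      using fourier_norm_le[OF h] by (intro AE_I2) (auto simp: abs_mult W_def intro!: mult_left_mono power_mono)
  qed simp
  have f: "fourier (autocorr h) \<xi> = of_real ((cmod (fourier h \<xi>))\<^sup>2)" for \<xi>
    by (simp add: autocorr_conv fourier_conv[OF h h'] fourier_reflect fourier_uminus complex_norm_square[symmetric])
  have "of_real (\<integral>\<xi>. gauss (s *\<^sub>R \<xi>) * (cmod (fourier h \<xi>))\<^sup>2 \<partial>lborel) = (\<integral>\<xi>. gauss (s *\<^sub>R \<xi>) *\<^sub>R fourier (autocorr h) \<xi> \<partial>lborel)"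
    unfolding f by (subst integral_complex_of_real[symmetric]) (simp add: scaleR_conv_of_real)
  also have "\<dots> = of_real (sqrt (2 * pi) ^ DIM('a) * (\<integral>z. gauss z * autocorr h (s *\<^sub>R z) \<partial>lborel))"
    by (rule fourier_gauss_pairing[OF _ s]) (simp add: autocorr_conv integrable_conv h h')
  finally show "(\<integral>\<xi>. gauss (s *\<^sub>R \<xi>) * (cmod (fourier h \<xi>))\<^sup>2 \<partial>lborel) =
      sqrt (2 * pi) ^ DIM('a) * (\<integral>z. gauss z * autocorr h (s *\<^sub>R z) \<partial>lborel)"
    unfolding of_real_eq_iff .
qed

lemma autocorr_le:
  assumes [measurable]: "h \<in> borel_measurable borel" and h2: "integrable lborel (\<lambda>x. (h x)\<^sup>2)"
  shows "\<bar>autocorr h u\<bar> \<le> (\<integral>x. (h x)\<^sup>2 \<partial>lborel)"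
proof -
  have sh: "(\<integral>x. (h (u + x))\<^sup>2 \<partial>lborel) = (\<integral>x. (h x)\<^sup>2 \<partial>lborel)" "integrable lborel (\<lambda>x. (h (u + x))\<^sup>2)"
    using integral_lborel_shift[of "\<lambda>x. (h x)\<^sup>2" "- u"] h2 by (simp_all add: add.commute)
  have "\<bar>autocorr h u\<bar> \<le> (\<integral>y. \<bar>h (u + y) * h y\<bar> \<partial>lborel)"
    unfolding autocorr_def by (rule integral_abs_bound)
  also have "\<dots> \<le> (\<integral>y. ((h (u + y))\<^sup>2 + (h y)\<^sup>2) / 2 \<partial>lborel)"
  proof (rule Bochner_Integration.integral_mono')
    fix y show "\<bar>h (u + y) * h y\<bar> \<le> ((h (u + y))\<^sup>2 + (h y)\<^sup>2) / 2"
      using sum_squares_bound[of "\<bar>h (u + y)\<bar>" "\<bar>h y\<bar>"] by (simp add: abs_mult)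
  qed (use h2 sh in auto)
  also have "\<dots> = (\<integral>x. (h x)\<^sup>2 \<partial>lborel)" using sh h2 by simp
  finally show ?thesis .
qed

lemma autocorr_tendsto:
  fixes h :: "'a::euclidean_space \<Rightarrow> real"
  assumes h: "integrable lborel h" and B: "\<And>x. \<bar>h x\<bar> \<le> B" and cont: "\<And>x. isCont h x"
    and u: "u \<longlonglongrightarrow> 0"
  shows "(\<lambda>n. autocorr h (u n)) \<longlonglongrightarrow> (\<integral>x. (h x)\<^sup>2 \<partial>lborel)"
proof -
  have [measurable]: "h \<in> borel_measurable borel" using h by auto
  show ?thesis unfolding autocorr_def
  proof (rule integral_dominated_convergence[where w = "\<lambda>y. B * \<bar>h y\<bar>"])
    show "AE y in lborel. (\<lambda>n. h (u n + y) * h y) \<longlonglongrightarrow> (h y)\<^sup>2"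
    proof (intro AE_I2)
      fix y
      have "(\<lambda>n. u n + y) \<longlonglongrightarrow> 0 + y" by (intro tendsto_intros u)
      then have "(\<lambda>n. h (u n + y)) \<longlonglongrightarrow> h y" using isCont_tendsto_compose[OF cont] by simp
      then show "(\<lambda>n. h (u n + y) * h y) \<longlonglongrightarrow> (h y)\<^sup>2" unfolding power2_eq_square by (intro tendsto_intros)
    qed
    show "AE y in lborel. norm (h (u n + y) * h y) \<le> B * \<bar>h y\<bar>" for n
      using B by (intro AE_I2) (auto simp: abs_mult intro!: mult_right_mono)
  qed (use h in auto)
qed

text \<open>
  The discontinuities of a step function lie on countably many hyperplanes.
\<close>

lemma step_fun_AE_isCont:
  fixes f :: "'a::euclidean_space \<Rightarrow> real"
  assumes "step_fun f" shows "AE y in lborel. isCont f (x - y)"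
proof -
  obtain N where N: "\<And>x y. same_cell N x y \<Longrightarrow> f x = f y" using assms by (auto simp: step_fun_def)
  have null: "AE y in lborel. (x - y) \<bullet> b \<noteq> c" if b: "b \<in> Basis" for b :: 'a and c
  proof -
    have "negligible {y. b \<bullet> y = x \<bullet> b - c}"
      using b by (intro negligible_hyperplane) auto
    moreover have "{y. b \<bullet> y = x \<bullet> b - c} \<in> sets lborel" by simp
    ultimately have "{y. b \<bullet> y = x \<bullet> b - c} \<in> null_sets lborel"
      unfolding negligible_iff_null_sets by (subst (asm) null_sets_completion_iff)
    then have "AE y in lborel. y \<notin> {y. b \<bullet> y = x \<bullet> b - c}" by (rule AE_not_in)
    then show ?thesis by eventually_elim (simp add: inner_diff_left inner_commute[of b] algebra_simps)
  qed
  have "AE y in lborel. \<forall>b\<in>Basis. \<forall>k::int. (x - y) \<bullet> b \<noteq> of_int k / 2 ^ N"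
    by (subst AE_ball_countable) (auto simp: AE_all_countable null countable_finite)
  then show ?thesis
  proof eventually_elim
    case (elim y)
    have "eventually (\<lambda>w. \<forall>b\<in>Basis. \<lfloor>2 ^ N * (w \<bullet> b)\<rfloor> = \<lfloor>2 ^ N * ((x - y) \<bullet> b)\<rfloor>) (at (x - y))"
    proof (intro eventually_ball_finite ballI finite_Basis)
      fix b :: 'a assume b: "b \<in> Basis"
      have "2 ^ N * ((x - y) \<bullet> b) \<notin> \<int>"
      proof
        assume "2 ^ N * ((x - y) \<bullet> b) \<in> \<int>"
        then obtain k where "2 ^ N * ((x - y) \<bullet> b) = of_int k" by (rule Ints_cases)
        then have "(x - y) \<bullet> b = of_int k / 2 ^ N" by (simp add: field_simps)
        with elim b show False by blast
      qed
      then show "eventually (\<lambda>w. \<lfloor>2 ^ N * (w \<bullet> b)\<rfloor> = \<lfloor>2 ^ N * ((x - y) \<bullet> b)\<rfloor>) (at (x - y))"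
        by (intro eventually_floor_eq tendsto_intros)
    qed
    then have "eventually (\<lambda>w. f w = f (x - y)) (at (x - y))"
      by eventually_elim (auto intro!: N simp: same_cell_def)
    then show ?case by (simp add: isCont_def tendsto_eventually)
  qed
qed

text \<open>
  Dominated convergence: for almost every \<open>y\<close> the integrand \<open>K y * f (x - y)\<close> is continuous at the given
  \<open>x\<close>.
\<close>

lemma conv_step_fun:
  fixes f :: "'a::euclidean_space \<Rightarrow> real"
  assumes K: "integrable lborel K" and f: "step_fun f"
  shows "isCont (conv K f) x" and "\<exists>B. \<forall>x. \<bar>conv K f x\<bar> \<le> B"
proof -
  have [measurable]: "K \<in> borel_measurable borel" using K by auto
  note [measurable] = step_fun_measurable[OF f]
  obtain B where B: "\<And>x. \<bar>f x\<bar> \<le> B" using f by (auto simp: step_fun_def)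
  have c: "conv K f = (\<lambda>x. \<integral>y. K y * f (x - y) \<partial>lborel)"
    by (rule ext, subst conv_commute) (auto simp: conv_def mult.commute)
  have B0: "0 \<le> B" using B[of 0] by linarith
  have Bi: "norm (K y * f (x - y)) \<le> B * \<bar>K y\<bar>" for x y
    using mult_right_mono[OF B[of "x - y"], of "\<bar>K y\<bar>"] by (simp add: abs_mult mult.commute)
  show "isCont (conv K f) x"
    unfolding continuous_at_sequentially c
  proof (intro allI impI)
    fix X assume X: "X \<longlonglongrightarrow> x"
    show "((\<lambda>x. \<integral>y. K y * f (x - y) \<partial>lborel) \<circ> X) \<longlonglongrightarrow> (\<integral>y. K y * f (x - y) \<partial>lborel)"
      unfolding o_def
    proof (rule integral_dominated_convergence[where w = "\<lambda>y. B * \<bar>K y\<bar>"])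
      show "AE y in lborel. (\<lambda>n. K y * f (X n - y)) \<longlonglongrightarrow> K y * f (x - y)"
        using step_fun_AE_isCont[OF f, of x]
      proof eventually_elim
        case (elim y)
        have "(\<lambda>n. X n - y) \<longlonglongrightarrow> x - y" by (intro tendsto_intros X)
        then show ?case by (intro tendsto_intros isCont_tendsto_compose[OF elim] X)
      qed
    qed (use K Bi in auto)
  qed
  have "\<bar>conv K f x\<bar> \<le> (\<integral>y. B * \<bar>K y\<bar> \<partial>lborel)" for x
    unfolding c using K Bi B0
    by (intro order_trans[OF integral_abs_bound] Bochner_Integration.integral_mono') auto
  then show "\<exists>B. \<forall>x. \<bar>conv K f x\<bar> \<le> B" by blast
qed

text \<open>
  Compare the Gaussian energies of \<open>conv K f\<close> and of \<open>f\<close>: the first is at most \<open>A\<^sup>2\<close> times the second. The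
  energy of \<open>f\<close> never exceeds the square of its norm, because the autocorrelation is largest at the origin. The
  energy of \<open>conv K f\<close> converges to the square of its norm as the weight flattens, because \<open>conv K f\<close> is bounded,
  continuous and integrable.
\<close>

theorem multiplier_L2_step:
  fixes K f :: "'a::euclidean_space \<Rightarrow> real"
  assumes K: "integrable lborel K" and A: "\<And>\<xi>. cmod (fourier K \<xi>) \<le> A" and f: "step_fun f"
  shows "integrable lborel (\<lambda>x. (conv K f x)\<^sup>2)"
    and "(\<integral>x. (conv K f x)\<^sup>2 \<partial>lborel) \<le> A\<^sup>2 * (\<integral>x. (f x)\<^sup>2 \<partial>lborel)"
proof -
  have [measurable]: "K \<in> borel_measurable borel" using K by auto
  note [measurable] = step_fun_measurable[OF f]
  have f1: "integrable lborel f" by (rule step_fun_integrable[OF f])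
  have f2: "integrable lborel (\<lambda>x. (f x)\<^sup>2)"
    using step_fun_integrable_powr[OF f, of 2] by simp
  define h where "h = conv K f"
  have h: "integrable lborel h" unfolding h_def by (rule integrable_conv[OF K f1])
  have [measurable]: "h \<in> borel_measurable borel" using h by auto
  obtain B where B: "\<And>x. \<bar>h x\<bar> \<le> B" using conv_step_fun(2)[OF K f] by (auto simp: h_def)
  have cont: "isCont h x" for x unfolding h_def by (rule conv_step_fun(1)[OF K f])
  have sq: "(h x)\<^sup>2 \<le> \<bar>B\<bar> * \<bar>h x\<bar>" for x
    using mult_right_mono[OF order_trans[OF B[of x] abs_ge_self], of "\<bar>h x\<bar>"] by (simp add: power2_eq_square)
  have h2: "integrable lborel (\<lambda>x. (h x)\<^sup>2)"
    by (rule Bochner_Integration.integrable_bound[where f = "\<lambda>x. \<bar>B\<bar> * \<bar>h x\<bar>"])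
       (use h in \<open>auto intro!: sq\<close>)
  then show "integrable lborel (\<lambda>x. (conv K f x)\<^sup>2)" by (simp add: h_def)
  define c where "c = sqrt (2 * pi) ^ DIM('a)"
  have c: "c > 0" by (simp add: c_def)
  define E where "E g s = (\<integral>z. gauss z * autocorr g (s *\<^sub>R z) \<partial>lborel)" for g :: "'a \<Rightarrow> real" and s
  have E: "E h s \<le> A\<^sup>2 * (\<integral>x. (f x)\<^sup>2 \<partial>lborel)" if s: "0 < s" for s
  proof -
    have A2: "(cmod (fourier K \<xi>))\<^sup>2 \<le> A\<^sup>2" for \<xi> using A by (intro power_mono) auto
    have "c * E h s = (\<integral>\<xi>. gauss (s *\<^sub>R \<xi>) * (cmod (fourier h \<xi>))\<^sup>2 \<partial>lborel)"
      unfolding E_def c_def gauss_energy(2)[OF h s] ..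
    also have "\<dots> \<le> (\<integral>\<xi>. A\<^sup>2 * (gauss (s *\<^sub>R \<xi>) * (cmod (fourier f \<xi>))\<^sup>2) \<partial>lborel)"
    proof (rule integral_mono)
      fix \<xi>
      have "gauss (s *\<^sub>R \<xi>) * (cmod (fourier h \<xi>))\<^sup>2 = (cmod (fourier K \<xi>))\<^sup>2 * (gauss (s *\<^sub>R \<xi>) * (cmod (fourier f \<xi>))\<^sup>2)"
        unfolding h_def fourier_conv[OF K f1] by (simp add: norm_mult power_mult_distrib)
      also have "\<dots> \<le> A\<^sup>2 * (gauss (s *\<^sub>R \<xi>) * (cmod (fourier f \<xi>))\<^sup>2)"
        by (intro mult_right_mono A2) auto
      finally show "gauss (s *\<^sub>R \<xi>) * (cmod (fourier h \<xi>))\<^sup>2 \<le> A\<^sup>2 * (gauss (s *\<^sub>R \<xi>) * (cmod (fourier f \<xi>))\<^sup>2)" .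
    qed (use gauss_energy(1)[OF h s] gauss_energy(1)[OF f1 s] in auto)
    also have "\<dots> = A\<^sup>2 * (c * E f s)"
      unfolding E_def c_def gauss_energy(2)[OF f1 s, symmetric] by simp
    finally have "c * E h s \<le> c * (A\<^sup>2 * E f s)" by (simp add: mult_ac)
    then have "E h s \<le> A\<^sup>2 * E f s" using c by simp
    also have "E f s \<le> (\<integral>z. gauss z * (\<integral>x. (f x)\<^sup>2 \<partial>lborel) \<partial>(lborel :: 'a measure))"
      unfolding E_def
    proof (rule Bochner_Integration.integral_mono')
      fix z :: 'a
      have "autocorr f (s *\<^sub>R z) \<le> (\<integral>x. (f x)\<^sup>2 \<partial>lborel)"
        using autocorr_le[OF _ f2, of "s *\<^sub>R z"] by simp
      then show "gauss z * autocorr f (s *\<^sub>R z) \<le> gauss z * (\<integral>x. (f x)\<^sup>2 \<partial>lborel)"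
        by (rule mult_left_mono) simp
      show "0 \<le> gauss z * (\<integral>x. (f x)\<^sup>2 \<partial>lborel)"
        by (intro mult_nonneg_nonneg Bochner_Integration.integral_nonneg) auto
    qed (simp add: gauss_integrable)
    also have "\<dots> = (\<integral>x. (f x)\<^sup>2 \<partial>lborel)" by (simp add: gauss_integral)
    finally show ?thesis by (simp add: mult_left_mono)
  qed
  have "(\<lambda>n. E h (1 / real (Suc n))) \<longlonglongrightarrow> (\<integral>z. gauss z * (\<integral>x. (h x)\<^sup>2 \<partial>lborel) \<partial>(lborel :: 'a measure))"
    unfolding E_def
  proof (rule integral_dominated_convergence[where w = "\<lambda>z. gauss z * (\<integral>x. (h x)\<^sup>2 \<partial>lborel)"])
    show "AE z in lborel. (\<lambda>n. gauss z * autocorr h ((1 / real (Suc n)) *\<^sub>R z)) \<longlonglongrightarrow> gauss z * (\<integral>x. (h x)\<^sup>2 \<partial>lborel)"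
    proof (intro AE_I2 tendsto_intros autocorr_tendsto[OF h B cont])
      fix z :: 'a
      have "(\<lambda>n. (1 / real (Suc n)) *\<^sub>R z) \<longlonglongrightarrow> 0 *\<^sub>R z"
        by (intro tendsto_scaleR tendsto_const LIMSEQ_Suc[OF lim_1_over_n])
      then show "(\<lambda>n. (1 / real (Suc n)) *\<^sub>R z) \<longlonglongrightarrow> 0" by simp
    qed
    show "(\<lambda>z. gauss z * autocorr h ((1 / real (Suc n)) *\<^sub>R z)) \<in> borel_measurable lborel" for n
      unfolding autocorr_conv[OF \<open>h \<in> borel_measurable borel\<close>] by measurable
  qed (use autocorr_le[OF _ h2] in \<open>auto simp: abs_mult gauss_integrable intro!: mult_left_mono\<close>)
  then have "(\<integral>z. gauss z * (\<integral>x. (h x)\<^sup>2 \<partial>lborel) \<partial>(lborel :: 'a measure)) \<le> A\<^sup>2 * (\<integral>x. (f x)\<^sup>2 \<partial>lborel)"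
    by (rule LIMSEQ_le_const2) (auto intro!: E)
  then show "(\<integral>x. (conv K f x)\<^sup>2 \<partial>lborel) \<le> A\<^sup>2 * (\<integral>x. (f x)\<^sup>2 \<partial>lborel)"
    by (simp add: gauss_integral h_def)
qed

section \<open>Calderon-Zygmund kernels and the distributional estimate\<close>

lemma conv_integrand_integrable:
  fixes K f :: "'a::euclidean_space \<Rightarrow> real"
  assumes q: "1 \<le> q" and K: "integrable lborel K" "\<And>x. \<bar>K x\<bar> \<le> M"
    and [measurable]: "f \<in> borel_measurable borel" and f: "integrable lborel (\<lambda>x. \<bar>f x\<bar> powr q)"
  shows "integrable lborel (\<lambda>y. K (x - y) * f y)"
proof (rule Bochner_Integration.integrable_bound[where f = "\<lambda>y. \<bar>K (x - y)\<bar> + M * \<bar>f y\<bar> powr q"])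
  have [measurable]: "K \<in> borel_measurable borel" using K by auto
  show "integrable lborel (\<lambda>y. \<bar>K (x - y)\<bar> + M * \<bar>f y\<bar> powr q)"
    using K f integral_lborel_reflect(2)[of K x] by auto
  show "(\<lambda>y. K (x - y) * f y) \<in> borel_measurable lborel" by measurable
  have M: "0 \<le> M" using K(2)[of 0] by linarith
  show "AE y in lborel. norm (K (x - y) * f y) \<le> norm (\<bar>K (x - y)\<bar> + M * \<bar>f y\<bar> powr q)"
  proof (intro AE_I2)
    fix y
    have "\<bar>f y\<bar> \<le> 1 + \<bar>f y\<bar> powr q"
    proof (cases "\<bar>f y\<bar> \<le> 1")
      case False
      then show ?thesis using powr_mono[of 1 q "\<bar>f y\<bar>"] q by simp
    qed (simp add: add_increasing2)
    then have "\<bar>K (x - y)\<bar> * \<bar>f y\<bar> \<le> \<bar>K (x - y)\<bar> * (1 + \<bar>f y\<bar> powr q)"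
      by (rule mult_left_mono) simp
    also have "\<dots> \<le> \<bar>K (x - y)\<bar> + M * \<bar>f y\<bar> powr q"
      using mult_right_mono[OF K(2)[of "x - y"], of "\<bar>f y\<bar> powr q"] by (simp add: algebra_simps)
    finally show "norm (K (x - y) * f y) \<le> norm (\<bar>K (x - y)\<bar> + M * \<bar>f y\<bar> powr q)"
      using M by (simp add: abs_mult)
  qed
qed

lemma conv_integrand_integrable1:
  fixes K f :: "'a::euclidean_space \<Rightarrow> real"
  assumes K: "integrable lborel K" "\<And>x. \<bar>K x\<bar> \<le> M" and f: "integrable lborel f"
  shows "integrable lborel (\<lambda>y. K (x - y) * f y)"
proof -
  have [measurable]: "f \<in> borel_measurable borel" using f by auto
  show ?thesis
    by (rule conv_integrand_integrable[OF _ K, of 1]) (use f in auto)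
qed

text \<open>
  If \<open>s\<close> is a step function close to \<open>f\<close>, the error \<open>conv K (f - s)\<close> is controlled by Young's convolution
  inequality. The norm of \<open>K\<close> in \<open>L\<^sup>1\<close> that enters there is multiplied by an arbitrarily small number, so it
  does not appear in the bound.
\<close>

lemma Lq_bound_extend:
  fixes K :: "'a::euclidean_space \<Rightarrow> real"
  assumes q: "1 < q" and K: "integrable lborel K" "\<And>x. \<bar>K x\<bar> \<le> M" and C: "0 < C"
    and step: "\<And>s. step_fun s \<Longrightarrow> (int_powr q (conv K s)) \<le>
      ennreal C * int_powr q s"
    and [measurable]: "f \<in> borel_measurable borel"
  shows "int_powr q (conv K f) \<le>
      ennreal (2 powr q * 2 powr q * C) * int_powr q f"
proof (cases "int_powr q f = \<infinity>")
  case True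
  then show ?thesis using C by (simp add: ennreal_mult_top)
next
  case False
  have [measurable]: "K \<in> borel_measurable borel" using K by auto
  have fi: "integrable lborel (\<lambda>x. \<bar>f x\<bar> powr q)"
    using False by (intro integrableI_nonneg) (auto simp: less_top)
  define F where "F = (\<integral>x. \<bar>f x\<bar> powr q \<partial>lborel)"
  have F0: "0 \<le> F" unfolding F_def by (intro Bochner_Integration.integral_nonneg) auto
  have F: "int_powr q f = ennreal F"
    unfolding F_def by (intro nn_integral_eq_integral fi) auto
  define W where "W = (\<integral>x. \<bar>K x\<bar> \<partial>lborel) powr q"
  have W0: "0 \<le> W" by (simp add: W_def)
  define P where "P = (2::real) powr q"
  have P: "0 < P" by (simp add: P_def)
  show ?thesis unfolding F P_def[symmetric]
  proof (rule ennreal_le_epsilon)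
    fix e :: real assume e: "0 < e"
    define d where "d = e / (P * P * C + P * W + 1)"
    have den: "0 < P * P * C + P * W + 1" using P C W0 by (simp add: add_pos_nonneg)
    then have d: "0 < d" using e by (simp add: d_def)
    obtain s where s: "step_fun s" and sd: "(\<integral>\<^sup>+x. ennreal (\<bar>f x - s x\<bar> powr q) \<partial>lborel) < ennreal d"
      using step_fun_dense_Lq[OF q _ fi d] by auto
    note [measurable] = step_fun_measurable[OF s]
    have fsi: "integrable lborel (\<lambda>x. \<bar>f x - s x\<bar> powr q)"
      using sd by (intro integrableI_nonneg) (auto simp: less_top[symmetric] top_unique)
    have si: "integrable lborel (\<lambda>x. \<bar>s x\<bar> powr q)" using s q by (intro step_fun_integrable_powr) auto
    have "conv K f x = conv K (\<lambda>x. f x - s x) x + conv K s x" for x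
      unfolding conv_def
      using conv_integrand_integrable[OF less_imp_le[OF q] K _ fsi, of x] conv_integrand_integrable[OF less_imp_le[OF q] K _ si, of x]
      by (subst Bochner_Integration.integral_add[symmetric]) (auto simp: algebra_simps)
    then have "int_powr q (conv K f) \<le> ennreal P *
       (int_powr q (conv K (\<lambda>x. f x - s x)) + int_powr q (conv K s))"
      using powr_add_le_nn[of q "conv K (\<lambda>x. f x - s x)" lborel "conv K s"] q by (simp add: P_def)
    also have "\<dots> \<le> ennreal P * (ennreal W * ennreal d + ennreal C * int_powr q s)"
    proof (intro mult_left_mono add_mono step s)
      have "int_powr q (conv K (\<lambda>x. f x - s x)) \<le>
         ennreal W * (\<integral>\<^sup>+x. ennreal (\<bar>f x - s x\<bar> powr q) \<partial>lborel)"
        unfolding W_def by (rule conv_young[OF q K(1)]) auto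
      also have "\<dots> \<le> ennreal W * ennreal d" using sd by (intro mult_left_mono) auto
      finally show "int_powr q (conv K (\<lambda>x. f x - s x)) \<le> ennreal W * ennreal d" .
    qed auto
    also have "\<dots> \<le> ennreal P * (ennreal W * ennreal d + ennreal C * (ennreal P * (ennreal F + ennreal d)))"
    proof (intro mult_left_mono add_mono order_refl)
      have "int_powr q s \<le> ennreal P * (int_powr q f + (\<integral>\<^sup>+x. ennreal (\<bar>s x - f x\<bar> powr q) \<partial>lborel))"
        using powr_add_le_nn[of q f lborel "\<lambda>x. s x - f x"] q by (simp add: P_def)
      also have "\<dots> \<le> ennreal P * (ennreal F + ennreal d)"
        using sd by (intro mult_left_mono add_mono) (auto simp: F abs_minus_commute)
      finally show "int_powr q s \<le> ennreal P * (ennreal F + ennreal d)" .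
    qed auto
    also have "\<dots> = ennreal (P * (W * d + C * (P * (F + d))))"
      using P W0 C F0 d by (simp add: ennreal_mult[symmetric] ennreal_plus[symmetric] del: ennreal_plus)
    also have "P * (W * d + C * (P * (F + d))) = P * P * C * F + d * (P * P * C + P * W)"
      by (simp add: algebra_simps)
    also have "\<dots> \<le> P * P * C * F + e"
      using d den e by (simp add: d_def field_simps)
    finally show "int_powr q (conv K f) \<le> ennreal (P * P * C) * ennreal F + ennreal e"
      using P C F0 e by (simp add: ennreal_mult[symmetric] ennreal_plus[symmetric] ennreal_leI del: ennreal_plus)
  qed
qed

text \<open>
  Integrability and boundedness make all convolutions absolutely convergent; they are qualitative. Every estimate
  below depends on the kernel through \<open>A\<close> and \<open>H\<close> only, where \<open>H\<close> bounds the integral in Hoermander's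
  condition.
\<close>

definition cz_kernel :: "real \<Rightarrow> real \<Rightarrow> ('a::euclidean_space \<Rightarrow> real) \<Rightarrow> bool" where
  "cz_kernel A H K \<longleftrightarrow> integrable lborel K \<and> (\<exists>M. \<forall>x. \<bar>K x\<bar> \<le> M) \<and>
     (\<forall>\<xi>. cmod (fourier K \<xi>) \<le> A) \<and>
     (\<forall>y. (\<integral>\<^sup>+x. indicator {x. 2 * norm y \<le> norm x} x * ennreal \<bar>K (x - y) - K x\<bar> \<partial>lborel) \<le> ennreal H)"

lemma cz_kernel_reflect:
  assumes "cz_kernel A H K" shows "cz_kernel A H (\<lambda>x. K (- x))"
proof -
  have K: "integrable lborel K" "\<exists>M. \<forall>x. \<bar>K x\<bar> \<le> M" "\<And>\<xi>. cmod (fourier K \<xi>) \<le> A"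
    and H: "\<And>y. (\<integral>\<^sup>+x. indicator {x. 2 * norm y \<le> norm x} x * ennreal \<bar>K (x - y) - K x\<bar> \<partial>lborel) \<le> ennreal H"
    using assms by (auto simp: cz_kernel_def)
  have [measurable]: "K \<in> borel_measurable borel" using K by auto
  have "(\<integral>\<^sup>+x. indicator {x. 2 * norm y \<le> norm x} x * ennreal \<bar>K (- (x - y)) - K (- x)\<bar> \<partial>lborel) \<le> ennreal H" for y
    using H[of "- y"] nn_integral_lborel_reflect[of "\<lambda>x. indicator {x. 2 * norm y \<le> norm x} x * ennreal \<bar>K (x + y) - K x\<bar>" 0]
    by (simp add: indicator_def add.commute)
  then show ?thesis
    using K integral_lborel_reflect(2)[of K 0] by (auto simp: cz_kernel_def fourier_reflect)
qed

lemma cz_kernel_L2: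
  fixes K f :: "'a::euclidean_space \<Rightarrow> real"
  assumes K: "cz_kernel A H K" and A: "0 < A" and [measurable]: "f \<in> borel_measurable borel"
  shows "int_powr 2 (conv K f) \<le>
      ennreal (16 * A\<^sup>2) * int_powr 2 f"
proof -
  obtain M where Ki: "integrable lborel K" "\<And>x. \<bar>K x\<bar> \<le> M" "\<And>\<xi>. cmod (fourier K \<xi>) \<le> A"
    using K by (auto simp: cz_kernel_def)
  have "int_powr 2 (conv K s) \<le>
      ennreal (A\<^sup>2) * int_powr 2 s" if s: "step_fun s" for s
  proof -
    have s2: "integrable lborel (\<lambda>x. (s x)\<^sup>2)" using step_fun_integrable_powr[OF s, of 2] by simp
    note m = multiplier_L2_step[OF Ki(1,3) s]
    have "(\<integral>\<^sup>+x. ennreal ((conv K s x)\<^sup>2) \<partial>lborel) = ennreal (\<integral>x. (conv K s x)\<^sup>2 \<partial>lborel)"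
      by (intro nn_integral_eq_integral m) auto
    also have "\<dots> \<le> ennreal (A\<^sup>2 * (\<integral>x. (s x)\<^sup>2 \<partial>lborel))" by (intro ennreal_leI m)
    also have "\<dots> = ennreal (A\<^sup>2) * ennreal (\<integral>x. (s x)\<^sup>2 \<partial>lborel)"
      by (intro ennreal_mult Bochner_Integration.integral_nonneg) auto
    also have "ennreal (\<integral>x. (s x)\<^sup>2 \<partial>lborel) = (\<integral>\<^sup>+x. ennreal ((s x)\<^sup>2) \<partial>lborel)"
      by (intro nn_integral_eq_integral[symmetric] s2) auto
    finally show ?thesis by simp
  qed
  from Lq_bound_extend[OF _ Ki(1,2) _ this, of f] A show ?thesis by simp
qed

text \<open>
  Since \<open>b\<close> has integral zero, \<open>K (x - y)\<close> may be replaced by \<open>K (x - y) - K (x - c)\<close> in the convolution, and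
  Hoermander's condition applies outside the doubled ball.
\<close>

lemma cz_bad_part:
  fixes K b :: "'a::euclidean_space \<Rightarrow> real"
  assumes K: "cz_kernel A H K" and b: "integrable lborel b" "(\<integral>x. b x \<partial>lborel) = 0"
    and supp: "\<And>y. b y \<noteq> 0 \<Longrightarrow> norm (y - c) \<le> r"
  shows "(\<integral>\<^sup>+x. indicator (- cball c (2 * r)) x * ennreal \<bar>conv K b x\<bar> \<partial>lborel) \<le> ennreal H * ennreal (\<integral>x. \<bar>b x\<bar> \<partial>lborel)"
proof -
  obtain M where Ki: "integrable lborel K" "\<And>x. \<bar>K x\<bar> \<le> M"
    and H: "\<And>y. (\<integral>\<^sup>+x. indicator {x. 2 * norm y \<le> norm x} x * ennreal \<bar>K (x - y) - K x\<bar> \<partial>lborel) \<le> ennreal H"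
    using K by (auto simp: cz_kernel_def)
  have [measurable]: "K \<in> borel_measurable borel" "b \<in> borel_measurable borel" using Ki b by auto
  have pt: "ennreal \<bar>conv K b x\<bar> \<le> (\<integral>\<^sup>+y. ennreal (\<bar>K (x - y) - K (x - c)\<bar> * \<bar>b y\<bar>) \<partial>lborel)" for x
  proof -
    have i1: "integrable lborel (\<lambda>y. K (x - y) * b y)" by (rule conv_integrand_integrable1[OF Ki b(1)])
    have i2: "integrable lborel (\<lambda>y. (K (x - y) - K (x - c)) * b y)"
      using i1 b(1) by (simp add: left_diff_distrib)
    have "conv K b x = (\<integral>y. (K (x - y) - K (x - c)) * b y \<partial>lborel)"
      using i1 b by (simp add: conv_def left_diff_distrib)
    then have "ennreal \<bar>conv K b x\<bar> \<le> ennreal (\<integral>y. \<bar>(K (x - y) - K (x - c)) * b y\<bar> \<partial>lborel)"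
      by (simp add: ennreal_leI)
    also have "\<dots> = (\<integral>\<^sup>+y. ennreal \<bar>(K (x - y) - K (x - c)) * b y\<bar> \<partial>lborel)"
      using i2 by (intro nn_integral_eq_integral[symmetric]) auto
    finally show ?thesis by (simp add: abs_mult)
  qed
  have "(\<integral>\<^sup>+x. indicator (- cball c (2 * r)) x * ennreal \<bar>conv K b x\<bar> \<partial>lborel) \<le>
     (\<integral>\<^sup>+x. indicator (- cball c (2 * r)) x * (\<integral>\<^sup>+y. ennreal (\<bar>K (x - y) - K (x - c)\<bar> * \<bar>b y\<bar>) \<partial>lborel) \<partial>lborel)"
    by (intro nn_integral_mono mult_left_mono pt) auto
  also have "\<dots> = (\<integral>\<^sup>+x. \<integral>\<^sup>+y. indicator (- cball c (2 * r)) x * ennreal (\<bar>K (x - y) - K (x - c)\<bar> * \<bar>b y\<bar>) \<partial>lborel \<partial>lborel)"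
    by (subst nn_integral_cmult) auto
  also have "\<dots> = (\<integral>\<^sup>+y. \<integral>\<^sup>+x. indicator (- cball c (2 * r)) x * ennreal (\<bar>K (x - y) - K (x - c)\<bar> * \<bar>b y\<bar>) \<partial>lborel \<partial>lborel)"
    by (rule lborel_pair.Fubini') measurable
  also have "\<dots> \<le> (\<integral>\<^sup>+y. ennreal H * ennreal \<bar>b y\<bar> \<partial>lborel)"
  proof (rule nn_integral_mono)
    fix y
    show "(\<integral>\<^sup>+x. indicator (- cball c (2 * r)) x * ennreal (\<bar>K (x - y) - K (x - c)\<bar> * \<bar>b y\<bar>) \<partial>lborel) \<le> ennreal H * ennreal \<bar>b y\<bar>"
    proof (cases "b y = 0")
      case False
      have "(\<integral>\<^sup>+x. indicator (- cball c (2 * r)) x * ennreal \<bar>K (x - y) - K (x - c)\<bar> \<partial>lborel) \<le>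
        (\<integral>\<^sup>+x. indicator {x. 2 * norm (y - c) \<le> norm x} (x - c) * ennreal \<bar>K ((x - c) - (y - c)) - K (x - c)\<bar> \<partial>lborel)"
        using supp[OF False] by (intro nn_integral_mono) (auto simp: indicator_def dist_norm norm_minus_commute)
      also have "\<dots> = (\<integral>\<^sup>+x. indicator {x. 2 * norm (y - c) \<le> norm x} x * ennreal \<bar>K (x - (y - c)) - K x\<bar> \<partial>lborel)"
        by (rule nn_integral_lborel_shift) measurable
      also have "\<dots> \<le> ennreal H" by (rule H)
      finally have le: "(\<integral>\<^sup>+x. indicator (- cball c (2 * r)) x * ennreal \<bar>K (x - y) - K (x - c)\<bar> \<partial>lborel) \<le> ennreal H" .
      have "(\<integral>\<^sup>+x. indicator (- cball c (2 * r)) x * ennreal (\<bar>K (x - y) - K (x - c)\<bar> * \<bar>b y\<bar>) \<partial>lborel) =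
         (\<integral>\<^sup>+x. (indicator (- cball c (2 * r)) x * ennreal \<bar>K (x - y) - K (x - c)\<bar>) * ennreal \<bar>b y\<bar> \<partial>lborel)"
        by (intro nn_integral_cong) (simp add: ennreal_mult mult_ac)
      also have "\<dots> = (\<integral>\<^sup>+x. indicator (- cball c (2 * r)) x * ennreal \<bar>K (x - y) - K (x - c)\<bar> \<partial>lborel) * ennreal \<bar>b y\<bar>"
        by (intro nn_integral_multc) measurable
      finally show ?thesis using mult_right_mono[OF le, of "ennreal \<bar>b y\<bar>"] by simp
    qed simp
  qed
  also have "\<dots> = ennreal H * (\<integral>\<^sup>+y. ennreal \<bar>b y\<bar> \<partial>lborel)" by (rule nn_integral_cmult) auto
  also have "(\<integral>\<^sup>+y. ennreal \<bar>b y\<bar> \<partial>lborel) = ennreal (\<integral>x. \<bar>b x\<bar> \<partial>lborel)"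
    using b by (intro nn_integral_eq_integral) auto
  finally show ?thesis .
qed

text \<open>
  Up to the factor \<open>2\<close>, which comes from estimating the measure of the stopping cubes, the three terms are
  the contributions of the good part on the stopping cubes, of the enlarged cubes, and of the bad part outside them.
\<close>

definition weak_const :: "nat \<Rightarrow> real \<Rightarrow> real \<Rightarrow> real" where
  "weak_const n A H =
     2 * (16 * A\<^sup>2 * 4 ^ n + unit_ball_vol (real n) * (2 * real n) ^ n + 2 * 2 ^ n * H)"

text \<open>
  The decomposition at height \<open>h\<close>: \<open>g\<close> is \<open>f\<close> off the stopping cubes and its average on each of
  them, and the differences \<open>bp\<close> have integral zero. The function \<open>g\<close> is treated in \<open>L\<^sup>2\<close>, the union of the
  enlarged cubes by its measure, and the \<open>bp\<close> outside it by the cancellation. The right-hand side retains the part of \<open>f\<close>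
  below \<open>h\<close> in \<open>L\<^sup>2\<close> and the part above \<open>h / 2\<close> in \<open>L\<^sup>1\<close>, which is sharper than the weak type
  \<open>(1, 1)\<close> inequality and makes an estimate in \<open>L\<^sup>q\<close> follow by integrating over \<open>h\<close>.
\<close>

lemma cz_weak_type:
  fixes K f :: "'a::euclidean_space \<Rightarrow> real"
  assumes K: "cz_kernel A H K" and A: "0 < A" and H: "0 < H"
    and f: "step_fun f" "\<And>x. 0 \<le> f x" and h: "0 < h"
  shows "emeasure lborel {x. 2 * h < \<bar>conv K f x\<bar>} \<le>
    ennreal (16 * A\<^sup>2 / h\<^sup>2) * (\<integral>\<^sup>+x. ennreal (indicator {x. f x \<le> h} x * (f x)\<^sup>2) \<partial>lborel) +
    ennreal (weak_const DIM('a) A H / h) * (\<integral>\<^sup>+x. ennreal (indicator {x. h < 2 * f x} x * f x) \<partial>lborel)"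
proof -
  let ?n = "DIM('a)"
  obtain M where Ki: "integrable lborel K" "\<And>x. \<bar>K x\<bar> \<le> M"
    using K by (auto simp: cz_kernel_def)
  have [measurable]: "K \<in> borel_measurable borel" using Ki by auto
  note [measurable] = step_fun_measurable[OF f(1)]
  have fi: "integrable lborel f" by (rule step_fun_integrable[OF f(1)])
  obtain Q where Q: "finite Q" "disjoint_family_on (\<lambda>(c, s). cube c s) Q"
    "\<And>c s. (c, s) \<in> Q \<Longrightarrow> 0 < s"
    "\<And>c s. (c, s) \<in> Q \<Longrightarrow> h * s ^ ?n < (\<integral>x. indicator (cube c s) x * f x \<partial>lborel)"
    "\<And>c s. (c, s) \<in> Q \<Longrightarrow> (\<integral>x. indicator (cube c s) x * f x \<partial>lborel) \<le> 2 ^ ?n * h * s ^ ?n"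
    "\<And>x. x \<notin> (\<Union>(c, s)\<in>Q. cube c s) \<Longrightarrow> f x \<le> h"
    by (rule calderon_zygmund_cubes[OF f h]) (rule that)
  define P where "P p = cube (fst p) (snd p)" for p :: "'a \<times> real"
  define I where "I p = (\<integral>x. indicator (P p) x * f x \<partial>lborel)" for p
  define av where "av p = I p / snd p ^ ?n" for p
  define bp where "bp p x = indicator (P p) x * (f x - av p)" for p x
  define V where "V = (\<Union>p\<in>Q. P p)"
  define mV where "mV = (\<Sum>p\<in>Q. snd p ^ ?n)"
  define b where "b x = (\<Sum>p\<in>Q. bp p x)" for x
  define g where "g x = f x - b x" for x
  have disj: "disjoint_family_on P Q" using Q(2) by (simp add: P_def[abs_def] case_prod_unfold)
  have sp: "0 < snd p" "h * snd p ^ ?n < I p" "I p \<le> 2 ^ ?n * h * snd p ^ ?n" if "p \<in> Q" for p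
    using Q(3-5)[of "fst p" "snd p"] that by (auto simp: I_def P_def)
  have off: "f x \<le> h" if "x \<notin> V" for x
    using Q(6)[of x] that by (simp add: V_def P_def case_prod_unfold)
  have Pm [measurable]: "P p \<in> sets borel" for p by (simp add: P_def)
  have Vm [measurable]: "V \<in> sets borel" unfolding V_def using Q(1) by auto
  have mP: "emeasure lborel (P p) = ennreal (snd p ^ ?n)" "measure lborel (P p) = snd p ^ ?n" if "p \<in> Q" for p
    using measure_cube[OF sp(1)[OF that]] by (auto simp: P_def)
  have mV0: "0 \<le> mV" unfolding mV_def using sp(1) by (intro sum_nonneg) (auto intro: less_imp_le)
  have indV: "(\<Sum>p\<in>Q. indicator (P p) x) = (indicator V x :: real)" for x
    unfolding V_def by (rule indicator_UN_disjoint[OF Q(1) disj, symmetric])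
  have inti: "integrable lborel (\<lambda>x. indicator (P p) x * u x)" if "integrable lborel u" for u :: "'a \<Rightarrow> real" and p
    using integrable_mult_indicator[OF _ that, of "P p"] by simp
  have indi: "integrable lborel (indicator (P p) :: 'a \<Rightarrow> real)" if "p \<in> Q" for p
    using mP(1)[OF that] by (intro integrable_real_indicator) auto
  have I0: "0 \<le> I p" for p unfolding I_def by (intro Bochner_Integration.integral_nonneg) (auto simp: f)
  have avm: "av p * snd p ^ ?n = I p" if "p \<in> Q" for p using sp(1)[OF that] by (simp add: av_def)
  have av: "h \<le> av p" "av p \<le> 2 ^ ?n * h" if "p \<in> Q" for p
    using sp[OF that] by (auto simp: av_def field_simps)
  have bpi: "integrable lborel (bp p)" if "p \<in> Q" for p
    unfolding bp_def right_diff_distrib using inti[OF fi] indi[OF that] by auto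
  have bp0: "(\<integral>x. bp p x \<partial>lborel) = 0" if p: "p \<in> Q" for p
  proof -
    have "(\<integral>x. bp p x \<partial>lborel) = I p - snd p ^ ?n * av p"
      unfolding bp_def right_diff_distrib using inti[OF fi] indi[OF p]
      by (simp add: I_def[symmetric] mP(2)[OF p])
    then show ?thesis using avm[OF p] by (simp add: mult.commute)
  qed
  have bp1: "(\<integral>x. \<bar>bp p x\<bar> \<partial>lborel) \<le> 2 * 2 ^ ?n * h * snd p ^ ?n" if p: "p \<in> Q" for p
  proof -
    have "(\<integral>x. \<bar>bp p x\<bar> \<partial>lborel) \<le> (\<integral>x. indicator (P p) x * f x + indicator (P p) x * av p \<partial>lborel)"
    proof (rule integral_mono)
      show "\<bar>bp p x\<bar> \<le> indicator (P p) x * f x + indicator (P p) x * av p" for x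
        using f(2)[of x] av(1)[OF p] h by (auto simp: bp_def indicator_def)
    qed (use inti[OF fi] indi[OF p] bpi[OF p] in auto)
    also have "\<dots> = I p + snd p ^ ?n * av p"
      using inti[OF fi] indi[OF p] by (simp add: I_def[symmetric] mP(2)[OF p])
    also have "\<dots> = I p + I p" using avm[OF p] by (simp add: mult.commute)
    finally show ?thesis using sp(3)[OF p] by simp
  qed
  have b_in: "b x = f x - av p" if "p \<in> Q" "x \<in> P p" for x p
  proof -
    have "bp p' x = (if p' = p then f x - av p else 0)" if "p' \<in> Q" for p'
      using disj that \<open>p \<in> Q\<close> \<open>x \<in> P p\<close> by (auto simp: bp_def disjoint_family_on_def indicator_def)
    then show ?thesis using Q(1) that by (simp add: b_def)
  qed
  have b_off: "b x = 0" if "x \<notin> V" for x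
    using that unfolding b_def V_def by (intro sum.neutral) (auto simp: bp_def)
  have bi: "integrable lborel b" unfolding b_def using bpi by auto
  have gi: "integrable lborel g" unfolding g_def using fi bi by auto
  have [measurable]: "b \<in> borel_measurable borel" "g \<in> borel_measurable borel" using bi gi by auto
  have g2: "(g x)\<^sup>2 \<le> indicator {x. f x \<le> h} x * (f x)\<^sup>2 + (2 ^ ?n * h)\<^sup>2 * indicator V x" for x
  proof (cases "x \<in> V")
    case True
    then obtain p where p: "p \<in> Q" "x \<in> P p" by (auto simp: V_def)
    have "(g x)\<^sup>2 \<le> (2 ^ ?n * h)\<^sup>2"
      using av[OF p(1)] h by (intro power_mono) (auto simp: g_def b_in[OF p])
    then show ?thesis using True by (simp add: add_increasing)
  next
    case False
    then show ?thesis using off[OF False] by (simp add: g_def b_off)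
  qed
  define F2 where "F2 = (\<integral>\<^sup>+x. ennreal (indicator {x. f x \<le> h} x * (f x)\<^sup>2) \<partial>lborel)"
  define F1 where "F1 = (\<integral>x. indicator {x. h < 2 * f x} x * f x \<partial>lborel)"
  have F1i: "integrable lborel (\<lambda>x. indicator {x. h < 2 * f x} x * f x)"
    using integrable_mult_indicator[OF _ fi, of "{x. h < 2 * f x}"] by simp
  have F10: "0 \<le> F1" unfolding F1_def by (intro Bochner_Integration.integral_nonneg) (auto simp: f)
  have F1: "(\<integral>\<^sup>+x. ennreal (indicator {x. h < 2 * f x} x * f x) \<partial>lborel) = ennreal F1"
    unfolding F1_def by (intro nn_integral_eq_integral F1i) (auto simp: f)
  \<comment> \<open>On a cube of average above \<open>h\<close> the values below \<open>h / 2\<close> account for at most half of the integral.\<close>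
  have mV_le: "mV \<le> 2 / h * F1"
  proof -
    have "I p \<le> (\<integral>x. indicator (P p) x * (indicator {x. h < 2 * f x} x * f x) \<partial>lborel) + h / 2 * snd p ^ ?n"
      if p: "p \<in> Q" for p
    proof -
      have "I p \<le> (\<integral>x. indicator (P p) x * (indicator {x. h < 2 * f x} x * f x) + h / 2 * indicator (P p) x \<partial>lborel)"
        unfolding I_def
      proof (rule integral_mono)
        show "indicator (P p) x * f x \<le> indicator (P p) x * (indicator {x. h < 2 * f x} x * f x) + h / 2 * indicator (P p) x" for x
          using h by (auto simp: indicator_def)
      qed (use inti[OF fi] inti[OF F1i] indi[OF p] in auto)
      also have "\<dots> = (\<integral>x. indicator (P p) x * (indicator {x. h < 2 * f x} x * f x) \<partial>lborel) + h / 2 * snd p ^ ?n"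
        using inti[OF F1i] indi[OF p] by (simp add: mP(2)[OF p])
      finally show ?thesis .
    qed
    then have "h / 2 * snd p ^ ?n \<le> (\<integral>x. indicator (P p) x * (indicator {x. h < 2 * f x} x * f x) \<partial>lborel)" if "p \<in> Q" for p
      using sp(2)[OF that] that by fastforce
    then have "(\<Sum>p\<in>Q. h / 2 * snd p ^ ?n) \<le> (\<Sum>p\<in>Q. \<integral>x. indicator (P p) x * (indicator {x. h < 2 * f x} x * f x) \<partial>lborel)"
      by (intro sum_mono)
    also have "\<dots> = (\<integral>x. indicator V x * (indicator {x. h < 2 * f x} x * f x) \<partial>lborel)"
      using inti[OF F1i] by (subst Bochner_Integration.integral_sum[symmetric]) (auto simp: sum_distrib_right[symmetric] indV)
    also have "\<dots> \<le> F1" unfolding F1_def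
      using F1i f(2) by (intro Bochner_Integration.integral_mono') (auto simp: indicator_def)
    finally have "h / 2 * mV \<le> F1" by (simp add: mV_def sum_distrib_left)
    then show ?thesis using h by (simp add: field_simps)
  qed
  define S where "S = (\<Union>p\<in>Q. cball (fst p) (2 * (real ?n * snd p)))"
  have Sm [measurable]: "S \<in> sets borel" unfolding S_def using Q(1) by (intro sets.finite_UN) auto
  define D where "D = unit_ball_vol (real ?n) * (2 * real ?n) ^ ?n"
  have D0: "0 \<le> D" by (simp add: D_def)
  have eS: "emeasure lborel S \<le> ennreal (D * mV)"
  proof -
    have "emeasure lborel S \<le> (\<Sum>p\<in>Q. emeasure lborel (cball (fst p) (2 * (real ?n * snd p))))"
      unfolding S_def by (intro emeasure_subadditive_finite Q(1)) auto
    also have "\<dots> = (\<Sum>p\<in>Q. ennreal (D * snd p ^ ?n))"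
    proof (intro sum.cong refl)
      fix p assume "p \<in> Q"
      from sp(1)[OF this] show "emeasure lborel (cball (fst p) (2 * (real ?n * snd p))) = ennreal (D * snd p ^ ?n)"
        by (subst emeasure_cball) (auto simp: D_def power_mult_distrib mult_ac)
    qed
    also have "\<dots> = ennreal (D * mV)"
      unfolding mV_def sum_distrib_left using sp(1) D0
      by (intro sum_ennreal) (auto intro!: mult_nonneg_nonneg simp: less_imp_le)
    finally show ?thesis .
  qed
  have eV: "emeasure lborel V \<le> ennreal mV"
  proof -
    have "emeasure lborel V \<le> (\<Sum>p\<in>Q. emeasure lborel (P p))"
      unfolding V_def by (intro emeasure_subadditive_finite Q(1)) auto
    also have "\<dots> = ennreal mV"
      unfolding mV_def using sp(1) by (simp add: mP sum_ennreal less_imp_le)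
    finally show ?thesis .
  qed
  have split: "conv K f x = conv K g x + (\<Sum>p\<in>Q. conv K (bp p) x)" for x
  proof -
    have "(\<Sum>p\<in>Q. conv K (bp p) x) = conv K b x"
      unfolding conv_def b_def sum_distrib_left
      by (intro Bochner_Integration.integral_sum[symmetric] conv_integrand_integrable1[OF Ki] bpi)
    moreover have "conv K g x + conv K b x = conv K f x"
      unfolding conv_def using conv_integrand_integrable1[OF Ki gi, of x] conv_integrand_integrable1[OF Ki bi, of x]
      by (subst Bochner_Integration.integral_add[symmetric]) (auto simp: g_def algebra_simps)
    ultimately show ?thesis by simp
  qed
  have [measurable]: "bp p \<in> borel_measurable borel" for p unfolding bp_def by measurable
  define E1 where "E1 = {x. h < \<bar>conv K g x\<bar>}"
  define E3 where "E3 = {x. x \<notin> S \<and> h < (\<Sum>p\<in>Q. \<bar>conv K (bp p) x\<bar>)}"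
  have [measurable]: "E1 \<in> sets borel" "E3 \<in> sets borel" unfolding E1_def E3_def by measurable
  have e1: "emeasure lborel E1 \<le> ennreal (16 * A\<^sup>2 / h\<^sup>2) * F2 + ennreal (16 * A\<^sup>2 * 4 ^ ?n * mV)"
  proof -
    have "E1 \<subseteq> {x\<in>UNIV. 1 \<le> ennreal (1 / h\<^sup>2) * ennreal (\<bar>conv K g x\<bar> powr 2)}"
    proof
      fix x assume "x \<in> E1"
      then have "h\<^sup>2 \<le> \<bar>conv K g x\<bar>\<^sup>2" using h by (intro power_mono) (auto simp: E1_def)
      then have "1 \<le> 1 / h\<^sup>2 * \<bar>conv K g x\<bar>\<^sup>2" using h by (simp add: field_simps)
      then show "x \<in> {x\<in>UNIV. 1 \<le> ennreal (1 / h\<^sup>2) * ennreal (\<bar>conv K g x\<bar> powr 2)}"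
        by (simp add: ennreal_mult[symmetric])
    qed
    then have "emeasure lborel E1 \<le> emeasure lborel {x\<in>UNIV. 1 \<le> ennreal (1 / h\<^sup>2) * ennreal (\<bar>conv K g x\<bar> powr 2)}"
      by (rule emeasure_mono) measurable
    also have "\<dots> \<le> ennreal (1 / h\<^sup>2) * (\<integral>\<^sup>+x. ennreal (\<bar>conv K g x\<bar> powr 2) * indicator UNIV x \<partial>lborel)"
      by (rule nn_integral_Markov_inequality) auto
    also have "\<dots> \<le> ennreal (1 / h\<^sup>2) * (ennreal (16 * A\<^sup>2) * int_powr 2 g)"
      using cz_kernel_L2[OF K A, of g] by (intro mult_left_mono) auto
    also have "\<dots> \<le> ennreal (1 / h\<^sup>2) * (ennreal (16 * A\<^sup>2) * (F2 + ennreal ((2 ^ ?n * h)\<^sup>2) * ennreal mV))"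
    proof (intro mult_left_mono)
      have "int_powr 2 g \<le>
         (\<integral>\<^sup>+x. ennreal (indicator {x. f x \<le> h} x * (f x)\<^sup>2) + ennreal ((2 ^ ?n * h)\<^sup>2) * indicator V x \<partial>lborel)"
      proof (intro nn_integral_mono)
        fix x
        have "ennreal (\<bar>g x\<bar> powr 2) \<le> ennreal (indicator {x. f x \<le> h} x * (f x)\<^sup>2 + (2 ^ ?n * h)\<^sup>2 * indicator V x)"
          using g2[of x] by (intro ennreal_leI) simp
        also have "\<dots> = ennreal (indicator {x. f x \<le> h} x * (f x)\<^sup>2) + ennreal ((2 ^ ?n * h)\<^sup>2) * indicator V x"
          by (subst ennreal_plus) (auto simp: ennreal_mult ennreal_indicator)
        finally show "ennreal (\<bar>g x\<bar> powr 2) \<le> ennreal (indicator {x. f x \<le> h} x * (f x)\<^sup>2) + ennreal ((2 ^ ?n * h)\<^sup>2) * indicator V x" .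
      qed
      also have "\<dots> = F2 + ennreal ((2 ^ ?n * h)\<^sup>2) * emeasure lborel V"
        unfolding F2_def by (subst nn_integral_add) (auto simp: nn_integral_cmult)
      also have "\<dots> \<le> F2 + ennreal ((2 ^ ?n * h)\<^sup>2) * ennreal mV"
        using eV by (intro add_left_mono mult_left_mono) auto
      finally show "int_powr 2 g \<le> F2 + ennreal ((2 ^ ?n * h)\<^sup>2) * ennreal mV" .
    qed auto
    also have "\<dots> = ennreal (16 * A\<^sup>2 / h\<^sup>2) * F2 + ennreal (16 * A\<^sup>2 / h\<^sup>2 * (2 ^ ?n * h)\<^sup>2 * mV)"
    proof -
      have "ennreal (16 * A\<^sup>2 / h\<^sup>2) = ennreal (1 / h\<^sup>2) * ennreal (16 * A\<^sup>2)"
        by (subst ennreal_mult[symmetric]) auto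
      moreover have "ennreal (16 * A\<^sup>2 / h\<^sup>2 * (2 ^ ?n * h)\<^sup>2 * mV) = ennreal (16 * A\<^sup>2 / h\<^sup>2) * (ennreal ((2 ^ ?n * h)\<^sup>2) * ennreal mV)"
      proof -
        have "ennreal (a * b * m) = ennreal a * (ennreal b * ennreal m)" if "0 \<le> a" "0 \<le> b" "0 \<le> m" for a b m
          using that by (simp add: ennreal_mult mult.assoc)
        then show ?thesis using mV0 by (metis divide_nonneg_nonneg mult_nonneg_nonneg zero_le_numeral zero_le_power2)
      qed
      ultimately show ?thesis by (simp add: distrib_left mult.assoc)
    qed
    also have "16 * A\<^sup>2 / h\<^sup>2 * (2 ^ ?n * h)\<^sup>2 = 16 * A\<^sup>2 * 4 ^ ?n"
      using h by (simp add: power_mult_distrib power_mult[symmetric] mult.commute[of ?n] power_mult)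
    finally show ?thesis .
  qed
  have e3: "emeasure lborel E3 \<le> ennreal (2 * 2 ^ ?n * H * mV)"
  proof -
    have "emeasure lborel E3 \<le> emeasure lborel {x\<in>- S. 1 \<le> ennreal (1 / h) * (\<Sum>p\<in>Q. ennreal \<bar>conv K (bp p) x\<bar>)}"
    proof (rule emeasure_mono)
      show "E3 \<subseteq> {x\<in>- S. 1 \<le> ennreal (1 / h) * (\<Sum>p\<in>Q. ennreal \<bar>conv K (bp p) x\<bar>)}"
        using h by (auto simp: E3_def sum_ennreal ennreal_mult[symmetric] sum_nonneg field_simps)
    qed measurable
    also have "\<dots> \<le> ennreal (1 / h) * (\<integral>\<^sup>+x. (\<Sum>p\<in>Q. ennreal \<bar>conv K (bp p) x\<bar>) * indicator (- S) x \<partial>lborel)"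
      by (rule nn_integral_Markov_inequality) auto
    finally have e3: "emeasure lborel E3 \<le> ennreal (1 / h) * (\<integral>\<^sup>+x. (\<Sum>p\<in>Q. ennreal \<bar>conv K (bp p) x\<bar>) * indicator (- S) x \<partial>lborel)" .
    have "(\<integral>\<^sup>+x. (\<Sum>p\<in>Q. ennreal \<bar>conv K (bp p) x\<bar>) * indicator (- S) x \<partial>lborel) =
        (\<Sum>p\<in>Q. \<integral>\<^sup>+x. ennreal \<bar>conv K (bp p) x\<bar> * indicator (- S) x \<partial>lborel)"
      unfolding sum_distrib_right by (rule nn_integral_sum) measurable
    also have "\<dots> \<le> (\<Sum>p\<in>Q. ennreal H * ennreal (2 * 2 ^ ?n * h * snd p ^ ?n))"
    proof (rule sum_mono)
      fix p assume p: "p \<in> Q"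
      have "(\<integral>\<^sup>+x. ennreal \<bar>conv K (bp p) x\<bar> * indicator (- S) x \<partial>lborel) \<le>
        (\<integral>\<^sup>+x. indicator (- cball (fst p) (2 * (real ?n * snd p))) x * ennreal \<bar>conv K (bp p) x\<bar> \<partial>lborel)"
        using p by (intro nn_integral_mono) (auto simp: indicator_def S_def)
      also have "\<dots> \<le> ennreal H * ennreal (\<integral>x. \<bar>bp p x\<bar> \<partial>lborel)"
        by (rule cz_bad_part[OF K bpi[OF p] bp0[OF p]]) (auto simp: bp_def P_def indicator_def cube_dist split: if_splits)
      also have "\<dots> \<le> ennreal H * ennreal (2 * 2 ^ ?n * h * snd p ^ ?n)"
        using bp1[OF p] by (intro mult_left_mono ennreal_leI) auto
      finally show "(\<integral>\<^sup>+x. ennreal \<bar>conv K (bp p) x\<bar> * indicator (- S) x \<partial>lborel) \<le> ennreal H * ennreal (2 * 2 ^ ?n * h * snd p ^ ?n)" .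
    qed
    also have "\<dots> = ennreal (H * (2 * 2 ^ ?n * h) * mV)"
    proof -
      have "(\<Sum>p\<in>Q. ennreal H * ennreal (2 * 2 ^ ?n * h * snd p ^ ?n)) = (\<Sum>p\<in>Q. ennreal (H * (2 * 2 ^ ?n * h) * snd p ^ ?n))"
        using sp(1) H h by (intro sum.cong refl) (simp add: ennreal_mult[symmetric] mult.assoc less_imp_le)
      also have "\<dots> = ennreal (H * (2 * 2 ^ ?n * h) * mV)"
        unfolding mV_def sum_distrib_left using sp(1) H h
        by (intro sum_ennreal) (auto intro!: mult_nonneg_nonneg simp: less_imp_le)
      finally show ?thesis .
    qed
    finally have "emeasure lborel E3 \<le> ennreal (1 / h) * ennreal (H * (2 * 2 ^ ?n * h) * mV)"
      by (rule order_trans[OF e3 mult_left_mono]) simp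
    also have "\<dots> = ennreal (1 / h * (H * (2 * 2 ^ ?n * h) * mV))"
      using h H mV0 by (intro ennreal_mult[symmetric]) auto
    also have "1 / h * (H * (2 * 2 ^ ?n * h) * mV) = 2 * 2 ^ ?n * H * mV" using h by simp
    finally show ?thesis .
  qed
  have "{x. 2 * h < \<bar>conv K f x\<bar>} \<subseteq> (E1 \<union> S) \<union> E3"
  proof
    fix x assume x: "x \<in> {x. 2 * h < \<bar>conv K f x\<bar>}"
    have "\<bar>conv K f x\<bar> \<le> \<bar>conv K g x\<bar> + (\<Sum>p\<in>Q. \<bar>conv K (bp p) x\<bar>)"
      unfolding split[of x] by (rule order_trans[OF abs_triangle_ineq add_left_mono[OF sum_abs]])
    then show "x \<in> (E1 \<union> S) \<union> E3" using x by (auto simp: E1_def E3_def)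
  qed
  then have "emeasure lborel {x. 2 * h < \<bar>conv K f x\<bar>} \<le> emeasure lborel ((E1 \<union> S) \<union> E3)"
    by (rule emeasure_mono) measurable
  also have "\<dots> \<le> emeasure lborel (E1 \<union> S) + emeasure lborel E3"
    by (rule emeasure_subadditive) auto
  also have "\<dots> \<le> (emeasure lborel E1 + emeasure lborel S) + emeasure lborel E3"
    by (intro add_right_mono emeasure_subadditive) auto
  also have "\<dots> \<le> (ennreal (16 * A\<^sup>2 / h\<^sup>2) * F2 + ennreal (16 * A\<^sup>2 * 4 ^ ?n * mV) + ennreal (D * mV)) + ennreal (2 * 2 ^ ?n * H * mV)"
    by (intro add_mono e1 eS e3)
  also have "\<dots> = ennreal (16 * A\<^sup>2 / h\<^sup>2) * F2 + ennreal ((16 * A\<^sup>2 * 4 ^ ?n + D + 2 * 2 ^ ?n * H) * mV)"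
    using mV0 D0 H by (simp add: add.assoc ennreal_plus[symmetric] distrib_right del: ennreal_plus)
  also have "\<dots> \<le> ennreal (16 * A\<^sup>2 / h\<^sup>2) * F2 + ennreal ((16 * A\<^sup>2 * 4 ^ ?n + D + 2 * 2 ^ ?n * H) * (2 / h * F1))"
    using mV_le D0 H by (intro add_left_mono ennreal_leI mult_left_mono) auto
  also have "(16 * A\<^sup>2 * 4 ^ ?n + D + 2 * 2 ^ ?n * H) * (2 / h * F1) = weak_const DIM('a) A H / h * F1"
    by (simp add: weak_const_def D_def)
  also have "ennreal (weak_const DIM('a) A H / h * F1) = ennreal (weak_const DIM('a) A H / h) * ennreal F1"
    using F10 h H by (intro ennreal_mult) (auto simp: weak_const_def intro!: divide_nonneg_nonneg add_nonneg_nonneg mult_nonneg_nonneg)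
  finally show ?thesis unfolding F2_def F1 .
qed

section \<open>Interpolation and duality\<close>

lemma nn_integral_powr_0:
  fixes a c :: real assumes "-1 < a" "0 \<le> c"
  shows "(\<integral>\<^sup>+t. (if 0 \<le> t \<and> t \<le> c then ennreal (t powr a) else 0) \<partial>lborel) = ennreal (c powr (a + 1) / (a + 1))"
proof -
  have "(\<integral>\<^sup>+t. ennreal (t powr a) * indicator {0..c} t \<partial>lborel) = ennreal (c powr (a + 1) / (a + 1))"
    by (intro nn_integral_has_integral_lebesgue' has_integral_powr_from_0 assms) simp
  also have "(\<integral>\<^sup>+t. ennreal (t powr a) * indicator {0..c} t \<partial>lborel) = (\<integral>\<^sup>+t. (if 0 \<le> t \<and> t \<le> c then ennreal (t powr a) else 0) \<partial>lborel)"
    by (intro nn_integral_cong) auto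
  finally show ?thesis .
qed

lemma nn_integral_powr_inf:
  fixes a c :: real assumes "a < -1" "0 < c"
  shows "(\<integral>\<^sup>+t. (if c \<le> t then ennreal (t powr a) else 0) \<partial>lborel) = ennreal (c powr (a + 1) / (- a - 1))"
proof -
  have eq: "(\<integral>\<^sup>+t. ennreal (t powr a) * indicator {c..} t \<partial>lborel) = ennreal (- (c powr (a + 1)) / (a + 1))"
    by (intro nn_integral_has_integral_lebesgue' has_integral_powr_to_inf assms) simp
  have "- (c powr (a + 1)) / (a + 1) = c powr (a + 1) / (- a - 1)"
    using assms by (simp add: field_simps)
  moreover have "(\<integral>\<^sup>+t. ennreal (t powr a) * indicator {c..} t \<partial>lborel) = (\<integral>\<^sup>+t. (if c \<le> t then ennreal (t powr a) else 0) \<partial>lborel)"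
    by (intro nn_integral_cong) auto
  ultimately show ?thesis using eq by simp
qed

lemma nn_integral_layer_cake:
  fixes u :: "'a::euclidean_space \<Rightarrow> real"
  assumes [measurable]: "u \<in> borel_measurable borel" and u: "\<And>x. 0 \<le> u x" and q: "0 < q"
  shows "(\<integral>\<^sup>+x. ennreal (u x powr q) \<partial>lborel) =
    (\<integral>\<^sup>+t. (if 0 \<le> t then ennreal (q * t powr (q - 1)) * emeasure lborel {x. t \<le> u x} else 0) \<partial>lborel)"
proof -
  have "(\<integral>\<^sup>+x. ennreal (u x powr q) \<partial>lborel) =
    (\<integral>\<^sup>+x. \<integral>\<^sup>+t. ennreal q * (if 0 \<le> t \<and> t \<le> u x then ennreal (t powr (q - 1)) else 0) \<partial>lborel \<partial>lborel)"
    using u q by (intro nn_integral_cong)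
      (subst nn_integral_cmult, measurable, subst nn_integral_powr_0, auto simp: ennreal_mult[symmetric])
  also have "\<dots> = (\<integral>\<^sup>+t. \<integral>\<^sup>+x. ennreal q * (if 0 \<le> t \<and> t \<le> u x then ennreal (t powr (q - 1)) else 0) \<partial>lborel \<partial>lborel)"
    by (rule lborel_pair.Fubini') measurable
  also have "\<dots> = (\<integral>\<^sup>+t. (if 0 \<le> t then ennreal (q * t powr (q - 1)) * emeasure lborel {x. t \<le> u x} else 0) \<partial>lborel)"
  proof (intro nn_integral_cong)
    fix t :: real
    have "(\<integral>\<^sup>+x. ennreal q * (if 0 \<le> t \<and> t \<le> u x then ennreal (t powr (q - 1)) else 0) \<partial>lborel) =
       (\<integral>\<^sup>+x. (if 0 \<le> t then ennreal (q * t powr (q - 1)) else 0) * indicator {x. t \<le> u x} x \<partial>lborel)"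
      using q by (intro nn_integral_cong) (auto simp: indicator_def ennreal_mult)
    then show "(\<integral>\<^sup>+x. ennreal q * (if 0 \<le> t \<and> t \<le> u x then ennreal (t powr (q - 1)) else 0) \<partial>lborel) =
       (if 0 \<le> t then ennreal (q * t powr (q - 1)) * emeasure lborel {x. t \<le> u x} else 0)"
      by (subst (asm) nn_integral_cmult_indicator) auto
  qed
  finally show ?thesis .
qed

lemma weak_const_pos: "0 < A \<Longrightarrow> 0 < H \<Longrightarrow> 0 < weak_const n A H"
  unfolding weak_const_def by (intro mult_pos_pos add_pos_nonneg) (auto intro!: mult_nonneg_nonneg)

text \<open>
  Insert the distributional estimate into the layer cake formula and exchange the integrals. What remains are
  integrals of powers of the height: \<open>t powr (q - 3)\<close> over \<open>t \<ge> 4 * f x\<close>, convergent since \<open>q < 2\<close>, and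
  \<open>t powr (q - 2)\<close> over \<open>t \<le> 8 * f x\<close>, convergent since \<open>q > 1\<close>.
\<close>

lemma cz_interpolation_step_nonneg:
  fixes K f :: "'a::euclidean_space \<Rightarrow> real"
  assumes K: "cz_kernel A H K" and A: "0 < A" and H: "0 < H" and q: "1 < q" "q < 2"
    and f: "step_fun f" "\<And>x. 0 \<le> f x"
  shows "int_powr q (conv K f) \<le>
    ennreal (256 * A\<^sup>2 * q / (2 - q) + 4 * weak_const DIM('a) A H * q * 8 powr (q - 1) / (q - 1)) *
      int_powr q f"
proof -
  define C where "C = weak_const DIM('a) A H"
  have C: "0 < C" unfolding C_def by (rule weak_const_pos[OF A H])
  have [measurable]: "K \<in> borel_measurable borel" using K by (auto simp: cz_kernel_def)
  note [measurable] = step_fun_measurable[OF f(1)]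
  define \<Phi>1 where "\<Phi>1 t x = ennreal (256 * A\<^sup>2 * q * (f x)\<^sup>2) * (if 4 * f x \<le> t then ennreal (t powr (q - 3)) else 0)" for t x
  define \<Phi>2 where "\<Phi>2 t x = ennreal (4 * C * q * f x) * (if 0 \<le> t \<and> t \<le> 8 * f x then ennreal (t powr (q - 2)) else 0)" for t x
  have [measurable]: "(\<lambda>(t, x). \<Phi>1 t x) \<in> borel_measurable (lborel \<Otimes>\<^sub>M lborel)"
    "(\<lambda>(t, x). \<Phi>2 t x) \<in> borel_measurable (lborel \<Otimes>\<^sub>M lborel)"
    unfolding \<Phi>1_def \<Phi>2_def by measurable
  have [measurable]: "\<Phi>1 t \<in> borel_measurable borel" "\<Phi>2 t \<in> borel_measurable borel"
    "(\<lambda>t. \<Phi>1 t x) \<in> borel_measurable borel" "(\<lambda>t. \<Phi>2 t x) \<in> borel_measurable borel" for t x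
    unfolding \<Phi>1_def \<Phi>2_def by measurable
  have "int_powr q (conv K f) =
     (\<integral>\<^sup>+t. (if 0 \<le> t then ennreal (q * t powr (q - 1)) * emeasure lborel {x. t \<le> \<bar>conv K f x\<bar>} else 0) \<partial>lborel)"
    using q by (intro nn_integral_layer_cake) auto
  also have "\<dots> \<le> (\<integral>\<^sup>+t. \<integral>\<^sup>+x. \<Phi>1 t x + \<Phi>2 t x \<partial>lborel \<partial>lborel)"
  proof (intro nn_integral_mono)
    fix t :: real
    show "(if 0 \<le> t then ennreal (q * t powr (q - 1)) * emeasure lborel {x. t \<le> \<bar>conv K f x\<bar>} else 0) \<le> (\<integral>\<^sup>+x. \<Phi>1 t x + \<Phi>2 t x \<partial>lborel)"
    proof (cases "0 < t")
      case True
      \<comment> \<open>The height \<open>t / 4\<close> rather than \<open>t / 2\<close> passes from closed to open superlevel sets.\<close>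
      have "emeasure lborel {x. t \<le> \<bar>conv K f x\<bar>} \<le> emeasure lborel {x. 2 * (t / 4) < \<bar>conv K f x\<bar>}"
        using True by (intro emeasure_mono) auto
      also have "\<dots> \<le> ennreal (16 * A\<^sup>2 / (t / 4)\<^sup>2) * (\<integral>\<^sup>+x. ennreal (indicator {x. f x \<le> t / 4} x * (f x)\<^sup>2) \<partial>lborel) +
         ennreal (C / (t / 4)) * (\<integral>\<^sup>+x. ennreal (indicator {x. t / 4 < 2 * f x} x * f x) \<partial>lborel)"
        unfolding C_def using True by (intro cz_weak_type[OF K A H f]) auto
      finally have "ennreal (q * t powr (q - 1)) * emeasure lborel {x. t \<le> \<bar>conv K f x\<bar>} \<le>
         ennreal (q * t powr (q - 1)) * (ennreal (16 * A\<^sup>2 / (t / 4)\<^sup>2) * (\<integral>\<^sup>+x. ennreal (indicator {x. f x \<le> t / 4} x * (f x)\<^sup>2) \<partial>lborel) +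
         ennreal (C / (t / 4)) * (\<integral>\<^sup>+x. ennreal (indicator {x. t / 4 < 2 * f x} x * f x) \<partial>lborel))"
        by (rule mult_left_mono) simp
      also have "\<dots> = (\<integral>\<^sup>+x. ennreal (q * t powr (q - 1)) * (ennreal (16 * A\<^sup>2 / (t / 4)\<^sup>2) * ennreal (indicator {x. f x \<le> t / 4} x * (f x)\<^sup>2)) \<partial>lborel) +
         (\<integral>\<^sup>+x. ennreal (q * t powr (q - 1)) * (ennreal (C / (t / 4)) * ennreal (indicator {x. t / 4 < 2 * f x} x * f x)) \<partial>lborel)"
        by (simp add: nn_integral_cmult distrib_left)
      also have "\<dots> \<le> (\<integral>\<^sup>+x. \<Phi>1 t x \<partial>lborel) + (\<integral>\<^sup>+x. \<Phi>2 t x \<partial>lborel)"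
      proof (intro add_mono nn_integral_mono)
        fix x
        have m3: "ennreal a * (ennreal b * ennreal c) = ennreal (a * (b * c))" if "0 \<le> a" "0 \<le> b" "0 \<le> c" for a b c
          using that by (simp add: ennreal_mult)
        have e: "t powr (q - 1) / t\<^sup>2 = t powr (q - 3)" "t powr (q - 1) / t = t powr (q - 2)"
          using True powr_diff[of t "q - 1" 2] powr_diff[of t "q - 1" 1] by (simp_all add: powr_numeral)
        have "ennreal (q * t powr (q - 1)) * (ennreal (16 * A\<^sup>2 / (t / 4)\<^sup>2) * ennreal (indicator {x. f x \<le> t / 4} x * (f x)\<^sup>2)) =
          ennreal (q * t powr (q - 1) * (16 * A\<^sup>2 / (t / 4)\<^sup>2 * (indicator {x. f x \<le> t / 4} x * (f x)\<^sup>2)))"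
          by (rule m3) (use q in auto)
        also have "q * t powr (q - 1) * (16 * A\<^sup>2 / (t / 4)\<^sup>2 * (indicator {x. f x \<le> t / 4} x * (f x)\<^sup>2)) =
          256 * A\<^sup>2 * q * (f x)\<^sup>2 * (if 4 * f x \<le> t then t powr (q - 3) else 0)"
          unfolding e(1)[symmetric] by (auto simp: indicator_def power_divide)
        also have "ennreal \<dots> = \<Phi>1 t x" using q by (simp add: \<Phi>1_def ennreal_mult)
        finally show "ennreal (q * t powr (q - 1)) * (ennreal (16 * A\<^sup>2 / (t / 4)\<^sup>2) * ennreal (indicator {x. f x \<le> t / 4} x * (f x)\<^sup>2)) \<le> \<Phi>1 t x"
          by simp
        have "ennreal (q * t powr (q - 1)) * (ennreal (C / (t / 4)) * ennreal (indicator {x. t / 4 < 2 * f x} x * f x)) =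
          ennreal (q * t powr (q - 1) * (C / (t / 4) * (indicator {x. t / 4 < 2 * f x} x * f x)))"
          by (rule m3) (use q C f(2)[of x] True in auto)
        also have "q * t powr (q - 1) * (C / (t / 4) * (indicator {x. t / 4 < 2 * f x} x * f x)) \<le>
          4 * C * q * f x * (if 0 \<le> t \<and> t \<le> 8 * f x then t powr (q - 2) else 0)"
          unfolding e(2)[symmetric] using True f(2)[of x] C q by (auto simp: indicator_def mult_ac)
        also have "ennreal \<dots> = \<Phi>2 t x" using q C f(2)[of x] by (simp add: \<Phi>2_def ennreal_mult)
        finally show "ennreal (q * t powr (q - 1)) * (ennreal (C / (t / 4)) * ennreal (indicator {x. t / 4 < 2 * f x} x * f x)) \<le> \<Phi>2 t x"
          by (simp add: ennreal_leI)
      qed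
      also have "\<dots> = (\<integral>\<^sup>+x. \<Phi>1 t x + \<Phi>2 t x \<partial>lborel)" by (rule nn_integral_add[symmetric]) auto
      finally show ?thesis using True by simp
    qed auto
  qed
  also have "\<dots> = (\<integral>\<^sup>+x. \<integral>\<^sup>+t. \<Phi>1 t x + \<Phi>2 t x \<partial>lborel \<partial>lborel)"
    by (rule lborel_pair.Fubini') measurable
  also have "\<dots> \<le> (\<integral>\<^sup>+x. ennreal (256 * A\<^sup>2 * q / (2 - q) + 4 * C * q * 8 powr (q - 1) / (q - 1)) * ennreal (\<bar>f x\<bar> powr q) \<partial>lborel)"
  proof (intro nn_integral_mono)
    fix x
    show "(\<integral>\<^sup>+t. \<Phi>1 t x + \<Phi>2 t x \<partial>lborel) \<le> ennreal (256 * A\<^sup>2 * q / (2 - q) + 4 * C * q * 8 powr (q - 1) / (q - 1)) * ennreal (\<bar>f x\<bar> powr q)"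
    proof (cases "f x = 0")
      case True
      then show ?thesis by (simp add: \<Phi>1_def \<Phi>2_def)
    next
      case False
      with f(2)[of x] have fx: "0 < f x" by simp
      have "(\<integral>\<^sup>+t. \<Phi>1 t x \<partial>lborel) = ennreal (256 * A\<^sup>2 * q * (f x)\<^sup>2) * ennreal ((4 * f x) powr (q - 2) / (2 - q))"
        unfolding \<Phi>1_def using fx q by (subst nn_integral_cmult) (auto simp: nn_integral_powr_inf)
      also have "\<dots> = ennreal (256 * A\<^sup>2 * q * (f x)\<^sup>2 * ((4 * f x) powr (q - 2) / (2 - q)))"
        by (rule ennreal_mult[symmetric]) (use q in auto)
      also have "\<dots> \<le> ennreal (256 * A\<^sup>2 * q * (f x)\<^sup>2 * (f x powr (q - 2) / (2 - q)))"
        using q fx by (intro ennreal_leI mult_left_mono divide_right_mono powr_mono2') auto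
      also have "256 * A\<^sup>2 * q * (f x)\<^sup>2 * (f x powr (q - 2) / (2 - q)) = 256 * A\<^sup>2 * q / (2 - q) * (f x) powr q"
        using fx by (simp add: powr_diff powr_numeral)
      finally have 1: "(\<integral>\<^sup>+t. \<Phi>1 t x \<partial>lborel) \<le> ennreal (256 * A\<^sup>2 * q / (2 - q) * (f x) powr q)" .
      have "(\<integral>\<^sup>+t. \<Phi>2 t x \<partial>lborel) = ennreal (4 * C * q * f x) * ennreal ((8 * f x) powr (q - 1) / (q - 1))"
        unfolding \<Phi>2_def using fx q by (subst nn_integral_cmult) (auto simp: nn_integral_powr_0)
      also have "\<dots> = ennreal (4 * C * q * f x * ((8 * f x) powr (q - 1) / (q - 1)))"
        by (rule ennreal_mult[symmetric]) (use q C fx in auto)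
      also have "4 * C * q * f x * ((8 * f x) powr (q - 1) / (q - 1)) = 4 * C * q * 8 powr (q - 1) / (q - 1) * (f x) powr q"
      proof -
        have "f x * f x powr (q - 1) = f x powr q" using fx by (simp add: powr_diff)
        then show ?thesis using fx by (simp add: powr_mult mult_ac)
      qed
      finally have 2: "(\<integral>\<^sup>+t. \<Phi>2 t x \<partial>lborel) = ennreal (4 * C * q * 8 powr (q - 1) / (q - 1) * (f x) powr q)" .
      have "(\<integral>\<^sup>+t. \<Phi>1 t x + \<Phi>2 t x \<partial>lborel) = (\<integral>\<^sup>+t. \<Phi>1 t x \<partial>lborel) + (\<integral>\<^sup>+t. \<Phi>2 t x \<partial>lborel)"
        by (rule nn_integral_add) auto
      also have "\<dots> \<le> ennreal (256 * A\<^sup>2 * q / (2 - q) * (f x) powr q) + ennreal (4 * C * q * 8 powr (q - 1) / (q - 1) * (f x) powr q)"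
        unfolding 2 by (intro add_right_mono 1)
      also have "\<dots> = ennreal ((256 * A\<^sup>2 * q / (2 - q) + 4 * C * q * 8 powr (q - 1) / (q - 1)) * (f x) powr q)"
        using q C by (subst ennreal_plus[symmetric]) (auto simp: distrib_right)
      also have "\<dots> = ennreal (256 * A\<^sup>2 * q / (2 - q) + 4 * C * q * 8 powr (q - 1) / (q - 1)) * ennreal (f x powr q)"
        using q C by (intro ennreal_mult) auto
      finally show ?thesis using fx by simp
    qed
  qed
  also have "\<dots> = ennreal (256 * A\<^sup>2 * q / (2 - q) + 4 * C * q * 8 powr (q - 1) / (q - 1)) * int_powr q f"
    by (rule nn_integral_cmult) auto
  finally show ?thesis unfolding C_def .
qed

definition Lq_bounded :: "real \<Rightarrow> real \<Rightarrow> ('a::euclidean_space \<Rightarrow> real) \<Rightarrow> bool" where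
  "Lq_bounded q C K \<longleftrightarrow> (\<forall>f \<in> borel_measurable borel.
     (int_powr q (conv K f)) \<le> ennreal C * int_powr q f)"

lemma cz_bounded_below_2:
  fixes A H q :: real
  assumes A: "0 < A" and H: "0 < H" and q: "1 < q" "q < 2"
  shows "\<exists>C>0. \<forall>K :: 'a::euclidean_space \<Rightarrow> real. cz_kernel A H K \<longrightarrow> Lq_bounded q C K"
proof -
  define C where "C = 256 * A\<^sup>2 * q / (2 - q) + 4 * weak_const DIM('a) A H * q * 8 powr (q - 1) / (q - 1)"
  have C: "0 < C" unfolding C_def using A q weak_const_pos[OF A H]
    by (intro add_pos_pos divide_pos_pos mult_pos_pos) auto
  define P where "P = (2::real) powr q"
  have P: "0 < P" by (simp add: P_def)
  have "Lq_bounded q (P * P * (P * C)) K" if K: "cz_kernel A H K" for K :: "'a \<Rightarrow> real"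
    unfolding Lq_bounded_def
  proof (intro ballI)
    obtain M where Ki: "integrable lborel K" "\<And>x. \<bar>K x\<bar> \<le> M"
      using K by (auto simp: cz_kernel_def)
    have [measurable]: "K \<in> borel_measurable borel" using Ki by auto
    fix f :: "'a \<Rightarrow> real" assume [measurable]: "f \<in> borel_measurable borel"
    show "int_powr q (conv K f) \<le> ennreal (P * P * (P * C)) * int_powr q f"
    proof (rule Lq_bound_extend[OF q(1) Ki, folded P_def])
      fix s :: "'a \<Rightarrow> real" assume s: "step_fun s"
      note [measurable] = step_fun_measurable[OF s]
      define u where "u x = max 0 (s x)" for x
      define v where "v x = max 0 (- s x)" for x
      have su: "step_fun u" unfolding u_def by (rule step_fun_compose[OF s, of _ 1]) auto
      have sv: "step_fun v" unfolding v_def by (rule step_fun_compose[OF s, of _ 1]) auto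
      note [measurable] = step_fun_measurable[OF su] step_fun_measurable[OF sv]
      have "s x = u x - v x" for x by (simp add: u_def v_def)
      then have "conv K s x = conv K u x + - conv K v x" for x
        unfolding conv_def using conv_integrand_integrable1[OF Ki step_fun_integrable[OF su], of x]
          conv_integrand_integrable1[OF Ki step_fun_integrable[OF sv], of x]
        by (simp add: right_diff_distrib)
      then have "int_powr q (conv K s) \<le> ennreal P *
        (int_powr q (conv K u) + int_powr q (conv K v))"
        using powr_add_le_nn[of q "conv K u" lborel "\<lambda>x. - conv K v x"] q by (simp add: P_def)
      also have "\<dots> \<le> ennreal P * (ennreal C * int_powr q u + ennreal C * int_powr q v)"
        unfolding C_def
        by (intro mult_left_mono add_mono cz_interpolation_step_nonneg K A H q su sv) (auto simp: u_def v_def)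
      also have "\<dots> = ennreal P * ennreal C * (int_powr q u + int_powr q v)"
        by (simp add: distrib_left mult.assoc)
      also have "int_powr q u + int_powr q v =
        (\<integral>\<^sup>+x. ennreal (\<bar>u x\<bar> powr q) + ennreal (\<bar>v x\<bar> powr q) \<partial>lborel)"
        by (rule nn_integral_add[symmetric]) auto
      also have "\<dots> = int_powr q s"
        by (intro nn_integral_cong) (auto simp: u_def v_def max_def)
      also have "ennreal P * ennreal C = ennreal (P * C)" using P C by (simp add: ennreal_mult)
      finally show "int_powr q (conv K s) \<le> ennreal (P * C) * int_powr q s" .
    qed (use P C in auto)
  qed
  then show ?thesis using P C by (intro exI[of _ "P * P * (P * C)"]) auto
qed

text \<open>
  With \<open>h = conv K f\<close> and \<open>g = sgn h * \<bar>h\<bar> powr (q - 1)\<close>, the integral \<open>N\<close> of \<open>\<bar>h\<bar> powr q\<close> equals that of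
  \<open>f\<close> times the adjoint operator applied to \<open>g\<close>. The integral of the power \<open>p\<close> of the latter is at most \<open>C * N\<close>, so Young's inequality with the
  parameter \<open>(2 * C) powr (1 / p)\<close> leaves at most \<open>N / 2\<close> on the right, which is absorbed since \<open>N\<close> is
  finite.
\<close>

lemma Lq_bounded_dual:
  fixes K :: "'a::euclidean_space \<Rightarrow> real"
  assumes q: "1 < q" and C: "0 < C" and K: "integrable lborel K"
    and dual: "Lq_bounded (q / (q - 1)) C (\<lambda>x. K (- x))"
  shows "Lq_bounded q (2 * (2 * C) powr (q - 1) / q) K"
  unfolding Lq_bounded_def
proof (intro ballI)
  fix f :: "'a \<Rightarrow> real" assume [measurable]: "f \<in> borel_measurable borel"
  have [measurable]: "K \<in> borel_measurable borel" using K by auto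
  let ?B = "2 * (2 * C) powr (q - 1) / q"
  have B: "0 < ?B" using C q by simp
  show "int_powr q (conv K f) \<le> ennreal ?B * int_powr q f"
  proof (cases "int_powr q f = \<infinity>")
    case True
    have top: "ennreal b * \<infinity> = \<infinity>" if "0 < b" for b using that by (simp add: ennreal_mult_top)
    show ?thesis unfolding True top[OF B] by simp
  next
    case False
    define p where "p = q / (q - 1)"
    have p: "1 < p" using q by (simp add: p_def field_simps)
    have fi: "integrable lborel (\<lambda>x. \<bar>f x\<bar> powr q)"
      using False by (intro integrableI_nonneg) (auto simp: less_top)
    define F where "F = (\<integral>x. \<bar>f x\<bar> powr q \<partial>lborel)"
    have F0: "0 \<le> F" unfolding F_def by (intro Bochner_Integration.integral_nonneg) auto
    have F: "int_powr q f = ennreal F"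
      unfolding F_def by (intro nn_integral_eq_integral fi) auto
    define h where "h = conv K f"
    have [measurable]: "h \<in> borel_measurable borel" unfolding h_def by measurable
    have "int_powr q h < \<infinity>"
      unfolding h_def
      by (rule le_less_trans[OF conv_young[OF q K]]) (auto simp: F ennreal_mult_less_top)
    then have hi: "integrable lborel (\<lambda>x. \<bar>h x\<bar> powr q)"
      by (intro integrableI_nonneg) auto
    define N where "N = (\<integral>x. \<bar>h x\<bar> powr q \<partial>lborel)"
    define g where "g x = sgn (h x) * \<bar>h x\<bar> powr (q - 1)" for x
    have [measurable]: "g \<in> borel_measurable borel" unfolding g_def by measurable
    have gp: "\<bar>g x\<bar> powr p = \<bar>h x\<bar> powr q" for x
      using q by (cases "h x = 0") (auto simp: g_def abs_mult powr_powr p_def)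
    have hg: "h x * g x = \<bar>h x\<bar> powr q" for x
    proof (cases "h x = 0")
      case False
      have "h x * g x = \<bar>h x\<bar> * \<bar>h x\<bar> powr (q - 1)" by (simp add: g_def sgn_mult_abs mult.assoc[symmetric] abs_sgn[symmetric])
      also have "\<dots> = \<bar>h x\<bar> powr q" using False by (simp add: powr_diff)
      finally show ?thesis .
    qed (use q in auto)
    have gi: "integrable lborel (\<lambda>x. \<bar>g x\<bar> powr p)" using hi by (simp add: gp)
    define G where "G = conv (\<lambda>x. K (- x)) g"
    have [measurable]: "G \<in> borel_measurable borel" unfolding G_def by measurable
    have G: "int_powr p G \<le> ennreal (C * N)"
    proof -
      have "int_powr p G \<le> ennreal C * int_powr p g"
        using dual unfolding Lq_bounded_def G_def p_def by auto
      also have "int_powr p g = ennreal N"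
        unfolding gp N_def by (intro nn_integral_eq_integral hi) auto
      finally show ?thesis using C by (simp add: ennreal_mult' )
    qed
    have Gi: "integrable lborel (\<lambda>x. \<bar>G x\<bar> powr p)"
      by (intro integrableI_nonneg) (auto intro: le_less_trans[OF G])
    have GN: "(\<integral>x. \<bar>G x\<bar> powr p \<partial>lborel) \<le> C * N"
    proof -
      have "N \<ge> 0" unfolding N_def by (intro Bochner_Integration.integral_nonneg) auto
      moreover have "ennreal (\<integral>x. \<bar>G x\<bar> powr p \<partial>lborel) \<le> ennreal (C * N)"
        using G nn_integral_eq_integral[OF Gi] by simp
      ultimately show ?thesis using C by (subst (asm) ennreal_le_iff) auto
    qed
    have yng: "a * b \<le> a powr q + b powr p" if "0 \<le> a" "0 \<le> b" for a b
    proof -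
      have "a * b \<le> 1 / q * a powr q + (q - 1) / q * b powr p"
        using young_scaled[OF q that, of 1] by (simp add: p_def)
      also have "\<dots> \<le> 1 * a powr q + 1 * b powr p"
        using q by (intro add_mono mult_right_mono) auto
      finally show ?thesis by simp
    qed
    have int: "integrable (lborel \<Otimes>\<^sub>M lborel) (\<lambda>(x, y). K (x - y) * f y * g x)"
    proof (rule Bochner_Integration.integrable_bound)
      have 1: "integrable (lborel \<Otimes>\<^sub>M lborel) (\<lambda>(x, y). K (x - y) * (\<bar>f y\<bar> powr q))"
        by (rule integrable_conv_pair[OF K fi])
      have "integrable (lborel \<Otimes>\<^sub>M lborel) (\<lambda>(x, y). K (- (x - y)) * (\<bar>g y\<bar> powr p))"
        using integrable_conv_pair[OF _ gi, of "\<lambda>x. K (- x)"] integral_lborel_reflect(2)[of K 0] K by simp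
      then have "integrable (lborel \<Otimes>\<^sub>M lborel) (\<lambda>(x, y). K (- (y - x)) * (\<bar>g x\<bar> powr p))"
        by (subst (asm) lborel_pair.integrable_product_swap_iff[symmetric]) simp
      then have 2: "integrable (lborel \<Otimes>\<^sub>M lborel) (\<lambda>(x, y). K (x - y) * (\<bar>g x\<bar> powr p))" by simp
      show "integrable (lborel \<Otimes>\<^sub>M lborel) (\<lambda>z. \<bar>case z of (x, y) \<Rightarrow> K (x - y) * (\<bar>f y\<bar> powr q)\<bar> + \<bar>case z of (x, y) \<Rightarrow> K (x - y) * (\<bar>g x\<bar> powr p)\<bar>)"
        using 1 2 by auto
      show "AE z in lborel \<Otimes>\<^sub>M lborel. norm (case z of (x, y) \<Rightarrow> K (x - y) * f y * g x) \<le>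
         norm (\<bar>case z of (x, y) \<Rightarrow> K (x - y) * (\<bar>f y\<bar> powr q)\<bar> + \<bar>case z of (x, y) \<Rightarrow> K (x - y) * (\<bar>g x\<bar> powr p)\<bar>)"
      proof (intro AE_I2, clarify)
        fix x y
        show "norm (K (x - y) * f y * g x) \<le> norm (\<bar>K (x - y) * (\<bar>f y\<bar> powr q)\<bar> + \<bar>K (x - y) * (\<bar>g x\<bar> powr p)\<bar>)"
          using mult_left_mono[OF yng[of "\<bar>f y\<bar>" "\<bar>g x\<bar>"], of "\<bar>K (x - y)\<bar>"] by (simp add: abs_mult distrib_left mult.assoc)
      qed
    qed auto
    have "N = (\<integral>x. \<integral>y. K (x - y) * f y * g x \<partial>lborel \<partial>lborel)"
      unfolding N_def hg[symmetric] by (simp add: h_def conv_def)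
    also have "\<dots> = (\<integral>y. \<integral>x. K (x - y) * f y * g x \<partial>lborel \<partial>lborel)"
      using lborel_pair.Fubini_integral[OF int] by simp
    also have "\<dots> = (\<integral>y. f y * G y \<partial>lborel)"
      unfolding G_def conv_def by (subst integral_mult_right_zero[symmetric]) (simp add: mult_ac)
    also have "\<dots> \<le> (\<integral>y. ((2 * C) powr (q - 1) / q * \<bar>f y\<bar> powr q + (q - 1) / q / (2 * C) * \<bar>G y\<bar> powr p) \<partial>lborel)"
    proof (rule Bochner_Integration.integral_mono')
      fix y
      have t: "((2 * C) powr (1 / p)) powr q = (2 * C) powr (q - 1)" "((2 * C) powr (1 / p)) powr p = 2 * C"
        using q p C by (simp_all add: powr_powr p_def)
      have "f y * G y \<le> \<bar>f y\<bar> * \<bar>G y\<bar>" by (simp add: abs_mult[symmetric])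
      also have "\<dots> \<le> (2 * C) powr (q - 1) / q * \<bar>f y\<bar> powr q + (q - 1) / q / (2 * C) * \<bar>G y\<bar> powr p"
        using young_scaled[OF q, of "\<bar>f y\<bar>" "\<bar>G y\<bar>" "(2 * C) powr (1 / p)"] C
        unfolding p_def[symmetric] t by simp
      finally show "f y * G y \<le> (2 * C) powr (q - 1) / q * \<bar>f y\<bar> powr q + (q - 1) / q / (2 * C) * \<bar>G y\<bar> powr p" .
      show "0 \<le> (2 * C) powr (q - 1) / q * \<bar>f y\<bar> powr q + (q - 1) / q / (2 * C) * \<bar>G y\<bar> powr p"
        using q C by (intro add_nonneg_nonneg mult_nonneg_nonneg) auto
    qed (use fi Gi in auto)
    also have "\<dots> = (2 * C) powr (q - 1) / q * F + (q - 1) / q / (2 * C) * (\<integral>x. \<bar>G x\<bar> powr p \<partial>lborel)"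
      using fi Gi by (simp add: F_def)
    also have "\<dots> \<le> (2 * C) powr (q - 1) / q * F + (q - 1) / q / (2 * C) * (C * N)"
      using GN q C by (intro add_left_mono mult_left_mono) auto
    also have "\<dots> \<le> (2 * C) powr (q - 1) / q * F + 1 / 2 * N"
    proof -
      have "N \<ge> 0" unfolding N_def by (intro Bochner_Integration.integral_nonneg) auto
      then have "(q - 1) / q * (1 / 2 * N) \<le> 1 * (1 / 2 * N)" using q by (intro mult_right_mono) auto
      then show ?thesis using C by simp
    qed
    finally have "N \<le> ?B * F" by simp
    then have "ennreal N \<le> ennreal ?B * ennreal F"
      using B F0 by (simp add: ennreal_mult[symmetric] ennreal_leI)
    moreover have "int_powr q h = ennreal N"
      unfolding N_def by (intro nn_integral_eq_integral hi) auto
    ultimately show ?thesis unfolding F h_def by simp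
  qed
qed

text \<open>
  Interpolation between the distributional estimate and \<open>L\<^sup>2\<close> for \<open>q < 2\<close>, the Fourier bound for \<open>q = 2\<close>, and
  duality for \<open>q > 2\<close>, since the reflected kernel satisfies the same hypotheses.
\<close>

theorem calderon_zygmund:
  fixes A H q :: real
  assumes A: "0 < A" and H: "0 < H" and q: "1 < q"
  shows "\<exists>C>0. \<forall>K :: 'a::euclidean_space \<Rightarrow> real. cz_kernel A H K \<longrightarrow> Lq_bounded q C K"
proof -
  consider "q < 2" | "q = 2" | "2 < q" by linarith
  then show ?thesis
  proof cases
    case 1 then show ?thesis using cz_bounded_below_2[OF A H q] by simp
  next
    case 2
    then show ?thesis using A cz_kernel_L2[OF _ A]
      by (intro exI[of _ "16 * A\<^sup>2"]) (auto simp: Lq_bounded_def)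
  next
    case 3
    then have "1 < q / (q - 1)" "q / (q - 1) < 2" by (auto simp: field_simps)
    from cz_bounded_below_2[OF A H this]
    obtain C where C: "0 < C" "\<And>K :: 'a \<Rightarrow> real. cz_kernel A H K \<Longrightarrow> Lq_bounded (q / (q - 1)) C K" by blast
    have "Lq_bounded q (2 * (2 * C) powr (q - 1) / q) K" if "cz_kernel A H K" for K :: "'a \<Rightarrow> real"
      using that by (intro Lq_bounded_dual q C cz_kernel_reflect) (auto simp: cz_kernel_def)
    then show ?thesis using C q by (intro exI[of _ "2 * (2 * C) powr (q - 1) / q"]) auto
  qed
qed

section \<open>Polar coordinates and the angular factor\<close>

lemma DIM_vec [simp]: "DIM(real^'n) = CARD('n)"
  by simp

lemma radial_density_atMost:
  fixes n :: nat assumes n: "0 < n" and a: "0 \<le> a"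
  shows "(\<integral>\<^sup>+r. ennreal (real n * r ^ (n - 1)) * indicator {0<..} r * indicator {..a} r \<partial>lborel) = ennreal (a ^ n)"
proof -
  have "(\<integral>\<^sup>+r. ennreal (real n * r ^ (n - 1)) * indicator {0<..} r * indicator {..a} r \<partial>lborel) =
    (\<integral>\<^sup>+r. ennreal (real n * r ^ (n - 1)) * indicator {0..a} r \<partial>lborel)"
    using AE_lborel_singleton[of "0::real"]
    by (intro nn_integral_cong_AE) (auto elim!: eventually_mono simp: indicator_def)
  also have "\<dots> = ennreal (a ^ n - 0 ^ n)"
  proof (rule nn_integral_FTC_Icc)
    show "((\<lambda>r. r ^ n) has_real_derivative real n * r ^ (n - 1)) (at r)" for r :: real
      by (auto intro!: derivative_eq_intros)
  qed (use a in auto)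
  finally show ?thesis using n by (simp add: power_0_left)
qed

text \<open>
  Polar coordinates with a homogeneous weight. Under the norm, the weighted Lebesgue measure is pushed forward to
  a measure on the half-line which gives \<open>{..a}\<close> the mass \<open>W * a ^ DIM('a)\<close>, by scaling; intervals of this form
  determine the measure. The weight \<open>1\<close> yields the usual formula for radial functions, and the positive and negative
  parts of \<open>\<Omega>\<close> yield the cancellation on all spheres.
\<close>

lemma nn_integral_radial:
  fixes w :: "'a::euclidean_space \<Rightarrow> ennreal" and g :: "real \<Rightarrow> ennreal"
  assumes [measurable]: "w \<in> borel_measurable borel" "g \<in> borel_measurable borel"
    and hom: "\<And>r x. 0 < r \<Longrightarrow> x \<noteq> 0 \<Longrightarrow> w (r *\<^sub>R x) = w x"
    and fin: "(\<integral>\<^sup>+x. w x * indicator (cball 0 1) x \<partial>lborel) < \<infinity>"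
  shows "(\<integral>\<^sup>+x. w x * g (norm x) \<partial>lborel) = (\<integral>\<^sup>+x. w x * indicator (cball 0 1) x \<partial>lborel) *
     (\<integral>\<^sup>+r. ennreal (real DIM('a) * r ^ (DIM('a) - 1)) * indicator {0<..} r * g r \<partial>lborel)"
proof -
  let ?n = "DIM('a)"
  define W where "W = (\<integral>\<^sup>+x. w x * indicator (cball 0 1) x \<partial>lborel)"
  define \<mu> where "\<mu> = distr (density lborel w) borel (norm :: 'a \<Rightarrow> real)"
  define \<nu> where "\<nu> = density lborel (\<lambda>r. W * (ennreal (real ?n * r ^ (?n - 1)) * indicator {0<..} r))"
  have ae0: "AE x in lborel. x \<noteq> (0 :: 'a)" by (rule AE_lborel_singleton)
  have vim: "(norm :: 'a \<Rightarrow> real) -` {..a} = cball 0 a" for a by auto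
  have \<mu>: "emeasure \<mu> {..a} = W * ennreal (a ^ ?n)" if a: "0 < a" for a
  proof -
    have "emeasure \<mu> {..a} = (\<integral>\<^sup>+x. w x * indicator {..a} (norm x) \<partial>lborel)"
      unfolding \<mu>_def by (subst emeasure_distr, simp, simp, subst emeasure_density)
        (auto intro!: nn_integral_cong simp: indicator_def vim)
    also have "\<dots> = ennreal (\<bar>a\<bar> ^ ?n) * (\<integral>\<^sup>+x. w (a *\<^sub>R x) * indicator {..a} (norm (a *\<^sub>R x)) \<partial>lborel)"
      using a by (intro nn_integral_lborel_scale) auto
    also have "(\<integral>\<^sup>+x. w (a *\<^sub>R x) * indicator {..a} (norm (a *\<^sub>R x)) \<partial>lborel) = W"
      unfolding W_def using a ae0
      by (intro nn_integral_cong_AE) (auto elim!: eventually_mono simp: hom indicator_def)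
    finally show ?thesis using a by (simp add: mult.commute)
  qed
  have \<nu>: "emeasure \<nu> {..a} = W * ennreal (a ^ ?n)" if a: "0 \<le> a" for a
    unfolding \<nu>_def using radial_density_atMost[of ?n a] a
    by (simp add: emeasure_density mult.assoc nn_integral_cmult)
  have "\<mu> = \<nu>"
  proof (rule measure_eqI_generator_eq)
    show "Int_stable (range (\<lambda>a::real. {..a}))"
      by (auto simp: Int_stable_def)
    show "range (\<lambda>a::real. {..a}) \<subseteq> Pow UNIV" by simp
    show "sets \<mu> = sigma_sets UNIV (range (\<lambda>a::real. {..a}))" "sets \<nu> = sigma_sets UNIV (range (\<lambda>a::real. {..a}))"
      unfolding \<mu>_def \<nu>_def by (simp_all add: borel_eq_atMost)
    show "range (\<lambda>i::nat. {..real i}) \<subseteq> range (\<lambda>a::real. {..a})" by auto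
    show "(\<Union>i::nat. {..real i}) = UNIV" using real_arch_simple by auto
    show "emeasure \<mu> {..real i} \<noteq> \<infinity>" for i
    proof -
      have "emeasure \<mu> {..real i} \<le> emeasure \<mu> {..real (Suc i)}"
        by (intro emeasure_mono) (auto simp: \<mu>_def)
      also have "\<dots> < \<infinity>" using fin by (subst \<mu>) (auto simp: W_def ennreal_mult_less_top)
      finally show ?thesis by simp
    qed
    fix X assume "X \<in> range (\<lambda>a::real. {..a})"
    then obtain a where X: "X = {..a}" by auto
    show "emeasure \<mu> X = emeasure \<nu> X"
    proof (cases "0 < a")
      case True then show ?thesis using \<mu> \<nu> X by simp
    next
      case False
      have "emeasure \<mu> {..a} = (\<integral>\<^sup>+x. w x * indicator {..a} (norm x) \<partial>lborel)"
        unfolding \<mu>_def by (subst emeasure_distr, simp, simp, subst emeasure_density)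
          (auto intro!: nn_integral_cong simp: indicator_def vim)
      also have "\<dots> = (\<integral>\<^sup>+x. 0 \<partial>(lborel :: 'a measure))"
      proof (rule nn_integral_cong_AE, use ae0 in eventually_elim)
        fix x :: 'a assume "x \<noteq> 0"
        then have "\<not> norm x \<le> a" using False by (smt (verit) zero_less_norm_iff)
        then show "w x * indicator {..a} (norm x) = 0" by simp
      qed
      finally have "emeasure \<mu> {..a} = 0" by simp
      moreover have "emeasure \<nu> {..a} \<le> emeasure \<nu> {..0}"
        using False by (intro emeasure_mono) (auto simp: \<nu>_def)
      moreover have "emeasure \<nu> {..0} = 0" by (subst \<nu>) auto
      ultimately show ?thesis using X by simp
    qed
  qed
  have "(\<integral>\<^sup>+x. w x * g (norm x) \<partial>lborel) = (\<integral>\<^sup>+r. g r \<partial>\<mu>)"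
    unfolding \<mu>_def by (simp add: nn_integral_distr nn_integral_density)
  also have "\<dots> = W * (\<integral>\<^sup>+r. ennreal (real ?n * r ^ (?n - 1)) * indicator {0<..} r * g r \<partial>lborel)"
    unfolding \<open>\<mu> = \<nu>\<close> \<nu>_def by (subst nn_integral_density) (auto simp: mult.assoc nn_integral_cmult)
  finally show ?thesis by (simp add: W_def)
qed

text \<open>
  The area of the unit sphere in dimension \<open>n\<close>: the derivative at \<open>1\<close> of the volume of the ball of
  radius \<open>r\<close>.
\<close>

definition sphere_area :: "nat \<Rightarrow> real" where
  "sphere_area n = unit_ball_vol (real n) * real n"

lemma sphere_area_nonneg [simp]: "0 \<le> sphere_area n"
  by (simp add: sphere_area_def)

lemma nn_integral_norm:
  fixes g :: "real \<Rightarrow> ennreal"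
  assumes [measurable]: "g \<in> borel_measurable borel"
  shows "(\<integral>\<^sup>+x. g (norm x) \<partial>(lborel :: 'a::euclidean_space measure)) =
     ennreal (sphere_area DIM('a)) *
     (\<integral>\<^sup>+r. (if 0 < r then ennreal (r ^ (DIM('a) - 1)) * g r else 0) \<partial>lborel)"
proof -
  have W: "(\<integral>\<^sup>+x. 1 * indicator (cball 0 1) x \<partial>(lborel :: 'a measure)) = ennreal (unit_ball_vol (real DIM('a)))"
    by (simp add: emeasure_cball)
  have "(\<integral>\<^sup>+x. 1 * g (norm x) \<partial>(lborel :: 'a measure)) = ennreal (unit_ball_vol (real DIM('a))) *
     (\<integral>\<^sup>+r. ennreal (real DIM('a) * r ^ (DIM('a) - 1)) * indicator {0<..} r * g r \<partial>lborel)"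
    unfolding W[symmetric] by (rule nn_integral_radial) (auto simp: emeasure_bounded_finite[unfolded infinity_ennreal_def])
  also have "(\<integral>\<^sup>+r. ennreal (real DIM('a) * r ^ (DIM('a) - 1)) * indicator {0<..} r * g r \<partial>lborel) =
    (\<integral>\<^sup>+r. ennreal (real DIM('a)) * (if 0 < r then ennreal (r ^ (DIM('a) - 1)) * g r else 0) \<partial>lborel)"
    by (intro nn_integral_cong) (auto simp: ennreal_mult mult.assoc)
  also have "\<dots> = ennreal (real DIM('a)) * (\<integral>\<^sup>+r. (if 0 < r then ennreal (r ^ (DIM('a) - 1)) * g r else 0) \<partial>lborel)"
    by (rule nn_integral_cmult) auto
  finally show ?thesis by (simp add: sphere_area_def ennreal_mult mult.assoc)
qed

lemma sphere_modulus:
  fixes \<Omega> :: "real^'n \<Rightarrow> real"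
  assumes B: "\<And>x. x \<noteq> 0 \<Longrightarrow> \<bar>\<Omega> x\<bar> \<le> B1"
  shows "norm x = 1 \<Longrightarrow> norm x' = 1 \<Longrightarrow> norm (x - x') \<le> \<delta> \<Longrightarrow> \<bar>\<Omega> x - \<Omega> x'\<bar> \<le> sphere_modulus \<Omega> \<delta>"
    and "0 \<le> \<delta> \<Longrightarrow> \<delta> \<le> \<delta>' \<Longrightarrow> sphere_modulus \<Omega> \<delta> \<le> sphere_modulus \<Omega> \<delta>'"
    and "0 \<le> \<delta> \<Longrightarrow> 0 \<le> sphere_modulus \<Omega> \<delta>"
proof -
  define S where "S \<delta> = {\<bar>\<Omega> x - \<Omega> x'\<bar> | x x'. norm (x - x') \<le> \<delta> \<and> norm x = 1 \<and> norm x' = 1}" for \<delta>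
  have \<omega>: "sphere_modulus \<Omega> \<delta> = Sup (S \<delta>)" for \<delta> by (simp add: sphere_modulus_def S_def)
  have bdd: "bdd_above (S \<delta>)" for \<delta>
  proof (rule bdd_aboveI)
    fix s assume "s \<in> S \<delta>"
    then obtain x x' where "s = \<bar>\<Omega> x - \<Omega> x'\<bar>" "norm x = 1" "norm x' = 1" by (auto simp: S_def)
    then show "s \<le> 2 * B1" using B[of x] B[of x'] by (cases "x = 0"; cases "x' = 0") auto
  qed
  show up: "\<bar>\<Omega> x - \<Omega> x'\<bar> \<le> sphere_modulus \<Omega> \<delta>" if "norm x = 1" "norm x' = 1" "norm (x - x') \<le> \<delta>" for x x' \<delta>
    unfolding \<omega> using that by (intro cSup_upper bdd) (auto simp: S_def)
  obtain e :: "real^'n" where e: "norm e = 1" using vector_choose_size[of 1] by auto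
  have ne: "0 \<in> S \<delta>" if "0 \<le> \<delta>" for \<delta> using e that by (auto simp: S_def intro!: exI[of _ e])
  show "sphere_modulus \<Omega> \<delta> \<le> sphere_modulus \<Omega> \<delta>'" if "0 \<le> \<delta>" "\<delta> \<le> \<delta>'"
  proof -
    have "S \<delta> \<subseteq> S \<delta>'" unfolding S_def using that(2) by (blast intro: order_trans)
    then show ?thesis unfolding \<omega> using ne[OF that(1)] by (intro cSup_subset_mono bdd) auto
  qed
  show "0 \<le> sphere_modulus \<Omega> \<delta>" if "0 \<le> \<delta>"
    using up[OF e e, of \<delta>] that by simp
qed

text \<open>
  The modulus is nondecreasing, so if it stayed above \<open>e\<close> the Dini integral would dominate that of \<open>e / \<delta>\<close>,
  which diverges at \<open>0\<close>.
\<close>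

lemma sphere_modulus_small:
  fixes \<Omega> :: "real^'n \<Rightarrow> real"
  assumes \<Omega>: "dini_kernel B1 B2 \<Omega>" and e: "0 < e"
  shows "\<exists>\<delta>>0. sphere_modulus \<Omega> \<delta> < e"
proof (rule ccontr)
  have B: "\<And>x. x \<noteq> 0 \<Longrightarrow> \<bar>\<Omega> x\<bar> \<le> B1"
    and D: "(\<integral>\<^sup>+\<delta>\<in>{0<..1}. ennreal (sphere_modulus \<Omega> \<delta> / \<delta>) \<partial>lborel) = ennreal B2"
    using \<Omega> by (auto simp: dini_kernel_def)
  assume "\<not> (\<exists>\<delta>>0. sphere_modulus \<Omega> \<delta> < e)"
  then have ge: "e \<le> sphere_modulus \<Omega> \<delta>" if "0 < \<delta>" for \<delta> using that by force
  \<comment> \<open>With this cutoff the integral of \<open>e / \<delta>\<close> over \<open>{s..1}\<close> equals \<open>\<bar>B2\<bar> + 1\<close>.\<close>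
  define s where "s = exp (- (\<bar>B2\<bar> + 1) / e)"
  have s: "0 < s" "s \<le> 1" "ln s = - (\<bar>B2\<bar> + 1) / e" using e by (auto simp: s_def divide_nonpos_pos)
  have "(\<integral>\<^sup>+\<delta>. ennreal (e / \<delta>) * indicator {s..1} \<delta> \<partial>lborel) = ennreal (e * ln 1 - e * ln s)"
    by (rule nn_integral_FTC_Icc) (use s e in \<open>auto intro!: derivative_eq_intros\<close>)
  also have "e * ln 1 - e * ln s = \<bar>B2\<bar> + 1" using e s by simp
  finally have "ennreal (\<bar>B2\<bar> + 1) = (\<integral>\<^sup>+\<delta>. ennreal (e / \<delta>) * indicator {s..1} \<delta> \<partial>lborel)" by simp
  also have "\<dots> \<le> (\<integral>\<^sup>+\<delta>\<in>{0<..1}. ennreal (sphere_modulus \<Omega> \<delta> / \<delta>) \<partial>lborel)"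
    using s(1) by (intro nn_integral_mono) (auto simp: indicator_def intro!: ennreal_leI divide_right_mono ge)
  finally have "ennreal (\<bar>B2\<bar> + 1) \<le> ennreal B2" by (simp add: D)
  also have "\<dots> \<le> ennreal \<bar>B2\<bar>" by (intro ennreal_leI) simp
  finally show False by (subst (asm) ennreal_le_iff) auto
qed

lemma unit_vector_diff:
  fixes x y :: "'a::real_normed_vector"
  assumes "x \<noteq> 0" "y \<noteq> 0"
  shows "norm (x /\<^sub>R norm x - y /\<^sub>R norm y) \<le> 2 * norm (x - y) / norm x"
proof -
  have "x /\<^sub>R norm x - y /\<^sub>R norm y = (x - y) /\<^sub>R norm x + (inverse (norm x) - inverse (norm y)) *\<^sub>R y"
    by (simp add: algebra_simps)
  also have "norm \<dots> \<le> norm ((x - y) /\<^sub>R norm x) + norm ((inverse (norm x) - inverse (norm y)) *\<^sub>R y)"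
    by (rule norm_triangle_ineq)
  also have "norm ((x - y) /\<^sub>R norm x) = norm (x - y) / norm x" by (simp add: divide_inverse mult.commute)
  also have "norm ((inverse (norm x) - inverse (norm y)) *\<^sub>R y) = \<bar>norm y - norm x\<bar> / norm x"
  proof -
    have "norm ((inverse (norm x) - inverse (norm y)) *\<^sub>R y) = \<bar>(inverse (norm x) - inverse (norm y)) * norm y\<bar>"
      by (simp add: abs_mult)
    also have "(inverse (norm x) - inverse (norm y)) * norm y = (norm y - norm x) / norm x"
      using assms by (simp add: field_simps)
    finally show ?thesis by simp
  qed
  also have "\<bar>norm y - norm x\<bar> / norm x \<le> norm (x - y) / norm x"
    using norm_triangle_ineq3[of y x] by (intro divide_right_mono) (auto simp: norm_minus_commute)
  finally show ?thesis by (simp add: add_divide_distrib)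
qed

lemma dini_kernel_diff:
  fixes \<Omega> :: "real^'n \<Rightarrow> real"
  assumes \<Omega>: "dini_kernel B1 B2 \<Omega>" and x: "x \<noteq> 0" "y \<noteq> 0" and \<delta>: "2 * norm (x - y) / norm x \<le> \<delta>"
  shows "\<bar>\<Omega> x - \<Omega> y\<bar> \<le> sphere_modulus \<Omega> \<delta>"
proof -
  have B: "\<And>x. x \<noteq> 0 \<Longrightarrow> \<bar>\<Omega> x\<bar> \<le> B1" and hom: "\<And>r x. 0 < r \<Longrightarrow> x \<noteq> 0 \<Longrightarrow> \<Omega> (r *\<^sub>R x) = \<Omega> x"
    using \<Omega> by (auto simp: dini_kernel_def)
  have "\<bar>\<Omega> (x /\<^sub>R norm x) - \<Omega> (y /\<^sub>R norm y)\<bar> \<le> sphere_modulus \<Omega> \<delta>"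
    using unit_vector_diff[OF x] \<delta> x by (intro sphere_modulus(1)[OF B]) auto
  then show ?thesis using x by (simp add: hom)
qed

lemma dini_kernel_continuous:
  fixes \<Omega> :: "real^'n \<Rightarrow> real"
  assumes \<Omega>: "dini_kernel B1 B2 \<Omega>"
  shows "continuous_on (- {0}) \<Omega>"
proof (rule continuous_on_iff[THEN iffD2], intro ballI allI impI)
  fix x :: "real^'n" and e :: real assume x: "x \<in> - {0}" and e: "0 < e"
  obtain \<delta> where \<delta>: "0 < \<delta>" "sphere_modulus \<Omega> \<delta> < e" using sphere_modulus_small[OF \<Omega> e] by blast
  show "\<exists>d>0. \<forall>x'\<in>- {0}. dist x' x < d \<longrightarrow> dist (\<Omega> x') (\<Omega> x) < e"
  proof (intro exI conjI ballI impI)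
    show "0 < \<delta> * norm x / 2" using x \<delta> by simp
    fix x' assume x': "x' \<in> - {0}" "dist x' x < \<delta> * norm x / 2"
    then have "2 * norm (x - x') / norm x \<le> \<delta>" using x by (simp add: dist_norm norm_minus_commute field_simps)
    then have "\<bar>\<Omega> x - \<Omega> x'\<bar> \<le> sphere_modulus \<Omega> \<delta>" using x x' by (intro dini_kernel_diff[OF \<Omega>]) auto
    then show "dist (\<Omega> x') (\<Omega> x) < e" using \<delta> by (simp add: dist_real_def abs_minus_commute)
  qed
qed

text \<open>
  The value of \<open>\<Omega>\<close> at the origin is arbitrary; setting it to \<open>0\<close> keeps homogeneity on the whole space.
\<close>

lemma dini_kernel_borel:
  fixes \<Omega> :: "real^'n \<Rightarrow> real"
  assumes "dini_kernel B1 B2 \<Omega>"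
  shows "(\<lambda>x. if x = 0 then 0 else \<Omega> x) \<in> borel_measurable borel"
proof -
  have "(\<lambda>x. indicator (- {0}) x *\<^sub>R \<Omega> x) \<in> borel_measurable borel"
    using dini_kernel_continuous[OF assms] by (intro borel_measurable_continuous_on_indicator) auto
  also have "(\<lambda>x. indicator (- {0}) x *\<^sub>R \<Omega> x) = (\<lambda>x. if x = 0 then 0 else \<Omega> x)" by auto
  finally show ?thesis .
qed

lemma nn_integral_surface_measure:
  fixes w :: "real^'n \<Rightarrow> ennreal"
  assumes [measurable]: "w \<in> borel_measurable borel" and hom: "\<And>r x. 0 < r \<Longrightarrow> x \<noteq> 0 \<Longrightarrow> w (r *\<^sub>R x) = w x"
  shows "(\<integral>\<^sup>+x. w x \<partial>surface_measure) = of_nat CARD('n) * (\<integral>\<^sup>+x. w x * indicator (cball 0 1) x \<partial>lborel)"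
proof -
  let ?M = "restrict_space lborel (cball 0 1 - {0}) :: (real^'n) measure"
  let ?N = "restrict_space borel (sphere 0 1) :: (real^'n) measure"
  have meas: "(\<lambda>x::real^'n. x /\<^sub>R norm x) \<in> measurable ?M ?N"
    by (intro measurable_restrict_space3) (auto simp: measurable_lborel1)
  have wN: "w \<in> borel_measurable ?N" by (rule measurable_restrict_space1) simp
  have "(\<integral>\<^sup>+x. w x \<partial>surface_measure) = of_nat CARD('n) * (\<integral>\<^sup>+x. w x \<partial>distr ?M ?N (\<lambda>x. x /\<^sub>R norm x))"
    unfolding surface_measure_def using wN by (intro nn_integral_scale_measure) simp
  also have "(\<integral>\<^sup>+x. w x \<partial>distr ?M ?N (\<lambda>x. x /\<^sub>R norm x)) = (\<integral>\<^sup>+x. w (x /\<^sub>R norm x) \<partial>?M)"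
    using meas wN by (intro nn_integral_distr) auto
  also have "\<dots> = (\<integral>\<^sup>+x. w (x /\<^sub>R norm x) * indicator (cball 0 1 - {0}) x \<partial>lborel)"
    by (rule nn_integral_restrict_space) auto
  also have "\<dots> = (\<integral>\<^sup>+x. w x * indicator (cball 0 1) x \<partial>lborel)"
    by (rule nn_integral_cong_AE, use AE_lborel_singleton[of "0::real^'n"] in eventually_elim)
       (simp add: hom indicator_def)
  finally show ?thesis .
qed

text \<open>
  The cancellation on the sphere says that the positive and the negative part of \<open>\<Omega>\<close> have the same integral
  over the unit ball, and by the polar coordinate formula this integral is all that matters. If the integrand is not
  integrable, the Bochner integral is \<open>0\<close> by convention.
\<close>

lemma dini_kernel_cancellation:
  fixes \<Omega> :: "real^'n \<Rightarrow> real" and g :: "real \<Rightarrow> real"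
  assumes \<Omega>: "dini_kernel B1 B2 \<Omega>" and [measurable]: "g \<in> borel_measurable borel" and g: "\<And>r. 0 \<le> g r" "g 0 = 0"
  shows "(\<integral>x. \<Omega> x * g (norm x) \<partial>lborel) = 0"
proof -
  have B: "\<And>x. x \<noteq> 0 \<Longrightarrow> \<bar>\<Omega> x\<bar> \<le> B1" and hom: "\<And>r x. 0 < r \<Longrightarrow> x \<noteq> 0 \<Longrightarrow> \<Omega> (r *\<^sub>R x) = \<Omega> x"
    and canc: "(\<integral>x. \<Omega> x \<partial>surface_measure) = 0"
    using \<Omega> by (auto simp: dini_kernel_def)
  define \<Omega>0 where "\<Omega>0 x = (if x = 0 then 0 else \<Omega> x)" for x
  have [measurable]: "\<Omega>0 \<in> borel_measurable borel" unfolding \<Omega>0_def[abs_def] by (rule dini_kernel_borel[OF \<Omega>])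
  have hom0: "\<Omega>0 (r *\<^sub>R x) = \<Omega>0 x" if "0 < r" for r x using that by (simp add: \<Omega>0_def hom)
  have surf: "space surface_measure = sphere (0 :: real^'n) 1" by (rule space_surface_measure)
  have sets: "sets surface_measure = sets (restrict_space borel (sphere (0 :: real^'n) 1))" by (rule sets_surface_measure)
  have \<Omega>0m: "\<Omega>0 \<in> borel_measurable surface_measure"
    unfolding measurable_cong_sets[OF sets refl] by (rule measurable_restrict_space1) simp
  define W where "W s = (\<integral>\<^sup>+x. ennreal (s * \<Omega>0 x) * indicator (cball 0 1) x \<partial>lborel)" for s :: real
  have B0: "0 \<le> B1" using B[of "axis undefined 1"] by (auto simp: axis_eq_0_iff intro: order_trans[OF abs_ge_zero])
  have Wfin: "W s < \<infinity>" if s: "\<bar>s\<bar> \<le> 1" for s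
  proof -
    have "s * \<Omega>0 x \<le> B1" for x
    proof -
      have "s * \<Omega>0 x \<le> \<bar>s\<bar> * \<bar>\<Omega>0 x\<bar>" by (simp add: abs_mult[symmetric])
      also have "\<dots> \<le> 1 * B1" using s B B0 by (intro mult_mono) (auto simp: \<Omega>0_def)
      finally show ?thesis by simp
    qed
    then have "W s \<le> (\<integral>\<^sup>+x. ennreal B1 * indicator (cball 0 1) x \<partial>(lborel :: (real^'n) measure))"
      unfolding W_def by (intro nn_integral_mono mult_right_mono ennreal_leI) auto
    also have "\<dots> < \<infinity>" by (subst nn_integral_cmult_indicator) (auto simp: ennreal_mult_less_top emeasure_bounded_finite[unfolded infinity_ennreal_def])
    finally show ?thesis .
  qed
  have WS: "(\<integral>\<^sup>+x. ennreal (s * \<Omega>0 x) \<partial>surface_measure) = of_nat CARD('n) * W s" for s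
    unfolding W_def by (rule nn_integral_surface_measure) (auto simp: hom0)
  have fin: "of_nat CARD('n) * W s \<noteq> \<infinity>" if "\<bar>s\<bar> \<le> 1" for s
    using Wfin[OF that] by (auto simp: ennreal_mult_eq_top_iff)
  have int: "integrable surface_measure \<Omega>0"
  proof (rule real_integrable_def[THEN iffD2], intro conjI \<Omega>0m)
    show "(\<integral>\<^sup>+x. ennreal (\<Omega>0 x) \<partial>surface_measure) \<noteq> \<infinity>" "(\<integral>\<^sup>+x. ennreal (- \<Omega>0 x) \<partial>surface_measure) \<noteq> \<infinity>"
      using WS[of 1] WS[of "-1"] fin[of 1] fin[of "-1"] by auto
  qed
  have "(\<integral>x. \<Omega>0 x \<partial>surface_measure) = (\<integral>x. \<Omega> x \<partial>surface_measure)"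
    by (intro Bochner_Integration.integral_cong) (auto simp: \<Omega>0_def surf)
  then have "enn2real (\<integral>\<^sup>+x. ennreal (\<Omega>0 x) \<partial>surface_measure) = enn2real (\<integral>\<^sup>+x. ennreal (- \<Omega>0 x) \<partial>surface_measure)"
    using real_lebesgue_integral_def[OF int] canc by simp
  then have "enn2real (of_nat CARD('n) * W 1) = enn2real (of_nat CARD('n) * W (- 1))"
    using WS[of 1] WS[of "-1"] by simp
  moreover have "ennreal (enn2real (of_nat CARD('n) * W 1)) = of_nat CARD('n) * W 1"
    "ennreal (enn2real (of_nat CARD('n) * W (- 1))) = of_nat CARD('n) * W (- 1)"
    using fin[of 1] fin[of "- 1"] by (auto simp: less_top)
  ultimately have "of_nat CARD('n) * W 1 = of_nat CARD('n) * W (- 1)" by metis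
  then have W: "W 1 = W (- 1)" by (simp add: ennreal_mult_cancel_left)
  have rad: "(\<integral>\<^sup>+x. ennreal (s * \<Omega>0 x) * ennreal (g (norm x)) \<partial>lborel) = W s *
     (\<integral>\<^sup>+r. ennreal (real DIM(real^'n) * r ^ (DIM(real^'n) - 1)) * indicator {0<..} r * ennreal (g r) \<partial>lborel)" if "\<bar>s\<bar> \<le> 1" for s
    unfolding W_def using Wfin[OF that] by (intro nn_integral_radial) (auto simp: hom0 W_def)
  have eq: "(\<integral>\<^sup>+x. ennreal (\<Omega>0 x * g (norm x)) \<partial>lborel) = (\<integral>\<^sup>+x. ennreal (- (\<Omega>0 x * g (norm x))) \<partial>lborel)"
    using rad[of 1] rad[of "-1"] W g(1) by (simp add: ennreal_mult''[symmetric])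
  have "(\<integral>x. \<Omega>0 x * g (norm x) \<partial>lborel) = 0"
  proof (cases "integrable lborel (\<lambda>x. \<Omega>0 x * g (norm x))")
    case True
    then show ?thesis by (simp add: real_lebesgue_integral_def eq)
  qed (simp add: not_integrable_integral_eq)
  moreover have "(\<lambda>x. \<Omega>0 x * g (norm x)) = (\<lambda>x. \<Omega> x * g (norm x))" using g(2) by (auto simp: \<Omega>0_def)
  ultimately show ?thesis by simp
qed

section \<open>Integrals of radial functions\<close>

lemma DIM_power: "r ^ DIM('a::euclidean_space) = r * r ^ (DIM('a) - 1)" for r :: real
  using DIM_positive[where 'a='a] by (simp add: power_eq_if)

lemma nn_integral_norm_near:
  assumes a: "0 \<le> a"
  shows "(\<integral>\<^sup>+x. (if norm x < a then ennreal (1 / norm x ^ (DIM('a) - 1)) else 0) \<partial>(lborel :: 'a::euclidean_space measure)) \<le>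
    ennreal (sphere_area DIM('a) * a)"
proof -
  have "(\<integral>\<^sup>+x. (if norm x < a then ennreal (1 / norm x ^ (DIM('a) - 1)) else 0) \<partial>(lborel :: 'a measure)) =
    ennreal (sphere_area DIM('a)) * (\<integral>\<^sup>+r. (if 0 < r then ennreal (r ^ (DIM('a) - 1)) * (if r < a then ennreal (1 / r ^ (DIM('a) - 1)) else 0) else 0) \<partial>lborel)"
    by (rule nn_integral_norm) measurable
  also have "(\<integral>\<^sup>+r. (if 0 < r then ennreal (r ^ (DIM('a) - 1)) * (if r < a then ennreal (1 / r ^ (DIM('a) - 1)) else 0) else 0) \<partial>lborel) =
    (\<integral>\<^sup>+r. indicator {0<..<a} r \<partial>lborel)"
    by (intro nn_integral_cong) (auto simp: ennreal_mult[symmetric])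
  also have "\<dots> = ennreal a" using a by simp
  finally show ?thesis using a by (simp add: ennreal_mult)
qed

lemma nn_integral_norm_annulus:
  assumes s: "0 < s"
  shows "(\<integral>\<^sup>+x. (if s / 2 \<le> norm x \<and> norm x \<le> 2 * s then ennreal (1 / norm x ^ DIM('a)) else 0) \<partial>(lborel :: 'a::euclidean_space measure)) \<le>
    ennreal (sphere_area DIM('a) * 3)"
proof -
  have "(\<integral>\<^sup>+x. (if s / 2 \<le> norm x \<and> norm x \<le> 2 * s then ennreal (1 / norm x ^ DIM('a)) else 0) \<partial>(lborel :: 'a measure)) =
    ennreal (sphere_area DIM('a)) * (\<integral>\<^sup>+r. (if 0 < r then ennreal (r ^ (DIM('a) - 1)) * (if s / 2 \<le> r \<and> r \<le> 2 * s then ennreal (1 / r ^ DIM('a)) else 0) else 0) \<partial>lborel)"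
    by (rule nn_integral_norm) measurable
  also have "\<dots> \<le> ennreal (sphere_area DIM('a)) * (\<integral>\<^sup>+r. ennreal (2 / s) * indicator {s / 2..2 * s} r \<partial>lborel)"
  proof (intro mult_left_mono nn_integral_mono)
    fix r :: real
    show "(if 0 < r then ennreal (r ^ (DIM('a) - 1)) * (if s / 2 \<le> r \<and> r \<le> 2 * s then ennreal (1 / r ^ DIM('a)) else 0) else 0) \<le>
      ennreal (2 / s) * indicator {s / 2..2 * s} r"
    proof (cases "s / 2 \<le> r \<and> r \<le> 2 * s")
      case True
      then have r: "0 < r" using s by linarith
      have "ennreal (r ^ (DIM('a) - 1)) * ennreal (1 / r ^ DIM('a)) = ennreal (1 / r)"
        using r unfolding DIM_power by (subst ennreal_mult[symmetric]) auto
      also have "\<dots> \<le> ennreal (2 / s)" using True s r by (intro ennreal_leI) (simp add: field_simps)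
      finally show ?thesis using True r by simp
    qed auto
  qed auto
  also have "(\<integral>\<^sup>+r. ennreal (2 / s) * indicator {s / 2..2 * s} r \<partial>lborel) = ennreal 3"
    using s by (subst nn_integral_cmult_indicator) (auto simp: ennreal_mult[symmetric])
  finally show ?thesis by (simp add: ennreal_mult)
qed

lemma nn_integral_norm_far:
  assumes R: "0 < R" and p: "real DIM('a) < p"
  shows "(\<integral>\<^sup>+x. (if R \<le> norm x then ennreal (norm x powr (- p)) else 0) \<partial>(lborel :: 'a::euclidean_space measure)) =
    ennreal (sphere_area DIM('a) * (R powr (real DIM('a) - p) / (p - real DIM('a))))"
proof -
  have "(\<integral>\<^sup>+x. (if R \<le> norm x then ennreal (norm x powr (- p)) else 0) \<partial>(lborel :: 'a measure)) =
    ennreal (sphere_area DIM('a)) * (\<integral>\<^sup>+r. (if 0 < r then ennreal (r ^ (DIM('a) - 1)) * (if R \<le> r then ennreal (r powr (- p)) else 0) else 0) \<partial>lborel)"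
    by (rule nn_integral_norm) measurable
  also have "(\<integral>\<^sup>+r. (if 0 < r then ennreal (r ^ (DIM('a) - 1)) * (if R \<le> r then ennreal (r powr (- p)) else 0) else 0) \<partial>lborel) =
    (\<integral>\<^sup>+r. (if R \<le> r then ennreal (r powr (real DIM('a) - 1 - p)) else 0) \<partial>lborel)"
  proof (intro nn_integral_cong)
    fix r :: real
    have "r ^ (DIM('a) - 1) * r powr (- p) = r powr (real DIM('a) - 1 - p)" if "0 < r"
      using that DIM_positive[where 'a='a] by (simp add: powr_realpow[symmetric] powr_add[symmetric] of_nat_diff)
    then show "(if 0 < r then ennreal (r ^ (DIM('a) - 1)) * (if R \<le> r then ennreal (r powr (- p)) else 0) else 0) =
      (if R \<le> r then ennreal (r powr (real DIM('a) - 1 - p)) else 0)"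
      using R by (auto simp: ennreal_mult[symmetric])
  qed
  also have "\<dots> = ennreal (R powr (real DIM('a) - p) / (p - real DIM('a)))"
    using nn_integral_powr_inf[of "real DIM('a) - 1 - p" R] R p by simp
  finally show ?thesis by (subst ennreal_mult) (use p in auto)
qed

text \<open>
  The substitution \<open>t = a / r\<close>, carried out on bounded intervals and written as \<open>- a / r\<close> because an increasing
  function is required; then the intervals exhaust the half-line.
\<close>

lemma nn_integral_inversion_le:
  fixes h :: "real \<Rightarrow> real"
  assumes [measurable]: "h \<in> borel_measurable borel" and h: "\<And>t. 0 \<le> h t" and a: "0 < a"
  shows "(\<integral>\<^sup>+r. (if a \<le> r then ennreal (h (a / r) / r) else 0) \<partial>lborel) \<le>
     (\<integral>\<^sup>+t. (if 0 < t \<and> t \<le> 1 then ennreal (h t / t) else 0) \<partial>lborel)" (is "?L \<le> ?R")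
proof -
  have N: "(\<integral>\<^sup>+r. ennreal (h (a / r) / r) * indicator {a..a * real (N + 2)} r \<partial>lborel) \<le> ?R" for N
  proof -
    let ?f = "\<lambda>t. ennreal (h (- t) / (- t))"
    have "(\<integral>\<^sup>+t. ?f t * indicator {- a / a..- a / (a * real (N + 2))} t \<partial>lborel) =
       (\<integral>\<^sup>+r. ?f (- a / r) * ennreal (a / r\<^sup>2) * indicator {a..a * real (N + 2)} r \<partial>lborel)"
    proof (rule nn_integral_substitution_aux)
        show "((\<lambda>r. - a / r) has_real_derivative a / r\<^sup>2) (at r)" if "r \<in> {a..a * real (N + 2)}" for r
          using that a by (auto intro!: derivative_eq_intros simp: power2_eq_square)
        show "continuous_on {a..a * real (N + 2)} (\<lambda>r. a / r\<^sup>2)"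
          using a by (intro continuous_intros) auto
    qed (use a in auto)
    moreover have "?f (- a / r) * ennreal (a / r\<^sup>2) * indicator {a..a * real (N + 2)} r =
        ennreal (h (a / r) / r) * indicator {a..a * real (N + 2)} r" for r
    proof (cases "a \<le> r")
      case True
      then have "h (a / r) / (a / r) * (a / r\<^sup>2) = h (a / r) / r" using a by (simp add: power2_eq_square field_simps)
      then show ?thesis using True a h by (simp add: ennreal_mult[symmetric])
    qed auto
    ultimately have "(\<integral>\<^sup>+r. ennreal (h (a / r) / r) * indicator {a..a * real (N + 2)} r \<partial>lborel) =
      (\<integral>\<^sup>+t. ?f t * indicator {- a / a..- a / (a * real (N + 2))} t \<partial>lborel)" by simp
    also have "\<dots> \<le> (\<integral>\<^sup>+t. (\<lambda>t. if 0 < t \<and> t \<le> 1 then ennreal (h t / t) else 0) (0 - t) \<partial>lborel)"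
    proof (intro nn_integral_mono)
      fix t :: real
      have "- a / (a * real (N + 2)) < 0" using a by (intro divide_neg_pos mult_pos_pos) auto
      then have "t < 0" if "t \<in> {- a / a..- a / (a * real (N + 2))}"
        using that unfolding atLeastAtMost_iff by linarith
      then show "?f t * indicator {- a / a..- a / (a * real (N + 2))} t \<le>
          (\<lambda>t. if 0 < t \<and> t \<le> 1 then ennreal (h t / t) else 0) (0 - t)"
        using a by (cases "t \<in> {- a / a..- a / (a * real (N + 2))}") auto
    qed
    also have "\<dots> = ?R" by (rule nn_integral_lborel_reflect) measurable
    finally show ?thesis .
  qed
  have "?L = (\<integral>\<^sup>+r. (SUP N. ennreal (h (a / r) / r) * indicator {a..a * real (N + 2)} r) \<partial>lborel)"
  proof (intro nn_integral_cong antisym)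
    fix r :: real
    obtain N where "r / a \<le> real N" using real_arch_simple by blast
    then have "r \<le> a * real (N + 2)" using a by (simp add: field_simps)
    then show "(if a \<le> r then ennreal (h (a / r) / r) else 0) \<le> (SUP N. ennreal (h (a / r) / r) * indicator {a..a * real (N + 2)} r)"
      by (intro SUP_upper2[of N]) auto
    show "(SUP N. ennreal (h (a / r) / r) * indicator {a..a * real (N + 2)} r) \<le> (if a \<le> r then ennreal (h (a / r) / r) else 0)"
      by (intro SUP_least) (auto simp: indicator_def)
  qed
  also have "\<dots> = (SUP N. \<integral>\<^sup>+r. ennreal (h (a / r) / r) * indicator {a..a * real (N + 2)} r \<partial>lborel)"
  proof (rule nn_integral_monotone_convergence_SUP)
    show "incseq (\<lambda>N r. ennreal (h (a / r) / r) * indicator {a..a * real (N + 2)} r)"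
    proof (intro incseq_SucI le_funI mult_left_mono)
      fix N r
      have "a * real (N + 2) \<le> a * real (Suc N + 2)" using a by (intro mult_left_mono) auto
      then show "(indicator {a..a * real (N + 2)} r :: ennreal) \<le> indicator {a..a * real (Suc N + 2)} r"
        by (auto simp: indicator_def simp del: of_nat_Suc)
    qed auto
  qed measurable
  also have "\<dots> \<le> ?R" by (intro SUP_least N)
  finally show ?thesis .
qed

lemma nn_integral_norm_inversion:
  fixes h :: "real \<Rightarrow> real"
  assumes [measurable]: "h \<in> borel_measurable borel" and h: "\<And>t. 0 \<le> h t" and a: "0 < a"
  shows "(\<integral>\<^sup>+x. (if a \<le> norm x then ennreal (h (a / norm x) / norm x ^ DIM('a)) else 0) \<partial>(lborel :: 'a::euclidean_space measure)) \<le>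
    ennreal (sphere_area DIM('a)) * (\<integral>\<^sup>+t. (if 0 < t \<and> t \<le> 1 then ennreal (h t / t) else 0) \<partial>lborel)"
proof -
  have "(\<integral>\<^sup>+x. (if a \<le> norm x then ennreal (h (a / norm x) / norm x ^ DIM('a)) else 0) \<partial>(lborel :: 'a measure)) =
    ennreal (sphere_area DIM('a)) * (\<integral>\<^sup>+r. (if 0 < r then ennreal (r ^ (DIM('a) - 1)) * (if a \<le> r then ennreal (h (a / r) / r ^ DIM('a)) else 0) else 0) \<partial>lborel)"
    by (rule nn_integral_norm) measurable
  also have "(\<integral>\<^sup>+r. (if 0 < r then ennreal (r ^ (DIM('a) - 1)) * (if a \<le> r then ennreal (h (a / r) / r ^ DIM('a)) else 0) else 0) \<partial>lborel) =
    (\<integral>\<^sup>+r. (if a \<le> r then ennreal (h (a / r) / r) else 0) \<partial>lborel)"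
    using a h unfolding DIM_power by (intro nn_integral_cong) (auto simp: ennreal_mult[symmetric])
  also have "ennreal (sphere_area DIM('a)) * \<dots> \<le> ennreal (sphere_area DIM('a)) * (\<integral>\<^sup>+t. (if 0 < t \<and> t \<le> 1 then ennreal (h t / t) else 0) \<partial>lborel)"
    by (intro mult_left_mono nn_integral_inversion_le h a) auto
  finally show ?thesis .
qed

text \<open>
  The mean value theorem for \<open>t powr (- \<gamma>)\<close> between \<open>1\<close> and \<open>s / r\<close>, both of which are at least \<open>1 / 2\<close>.
\<close>

lemma powr_neg_diff:
  fixes r s \<gamma> n :: real
  assumes r: "0 < r" and s: "r / 2 \<le> s" and \<gamma>: "0 < \<gamma>" "\<gamma> \<le> n"
  shows "\<bar>1 / s powr \<gamma> - 1 / r powr \<gamma>\<bar> \<le> n * 2 powr (n + 1) * (\<bar>s - r\<bar> / r) / r powr \<gamma>"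
proof -
  have "norm ((s / r) powr (- \<gamma>) - 1 powr (- \<gamma>)) \<le> n * 2 powr (n + 1) * norm (s / r - 1)"
  proof (rule field_differentiable_bound[of "{1/2..}" _ "\<lambda>t. - \<gamma> * t powr (- \<gamma> - 1)"])
    fix t :: real assume t: "t \<in> {1/2..}"
    show "((\<lambda>t. t powr (- \<gamma>)) has_real_derivative - \<gamma> * t powr (- \<gamma> - 1)) (at t within {1/2..})"
      using t by (auto intro!: derivative_eq_intros)
    have "t powr (- \<gamma> - 1) \<le> (1 / 2) powr (- \<gamma> - 1)" using t \<gamma> by (intro powr_mono2') auto
    also have "\<dots> = 2 powr (\<gamma> + 1)" by (simp add: powr_divide powr_minus_divide[symmetric] powr_minus[symmetric] add.commute)
    also have "\<dots> \<le> 2 powr (n + 1)" using \<gamma> by (intro powr_mono) auto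
    finally show "norm (- \<gamma> * t powr (- \<gamma> - 1)) \<le> n * 2 powr (n + 1)"
      using \<gamma> by (auto simp: abs_mult intro!: mult_mono)
  qed (use r s in \<open>auto simp: field_simps\<close>)
  also have "norm (s / r - 1) = \<bar>s - r\<bar> / r" using r by (simp add: field_simps abs_divide[symmetric])
  finally have "\<bar>(s / r) powr (- \<gamma>) - 1\<bar> / r powr \<gamma> \<le> n * 2 powr (n + 1) * (\<bar>s - r\<bar> / r) / r powr \<gamma>"
    by (intro divide_right_mono) auto
  moreover have "\<bar>(s / r) powr (- \<gamma>) - 1\<bar> / r powr \<gamma> = \<bar>1 / s powr \<gamma> - 1 / r powr \<gamma>\<bar>"
  proof -
    have "s > 0" using r s by linarith
    then have "((s / r) powr (- \<gamma>) - 1) / r powr \<gamma> = 1 / s powr \<gamma> - 1 / r powr \<gamma>"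
      using r by (simp add: powr_minus_divide powr_divide field_simps)
    from arg_cong[OF this, of abs] show ?thesis by (simp add: abs_divide)
  qed
  ultimately show ?thesis by simp
qed

section \<open>Truncated kernels\<close>

definition trunc_kernel :: "(real^'n \<Rightarrow> real) \<Rightarrow> real \<Rightarrow> real \<Rightarrow> real \<Rightarrow> real^'n \<Rightarrow> real" where
  "trunc_kernel \<Omega> \<gamma> \<epsilon> R y = (if \<epsilon> \<le> norm y \<and> norm y < R then \<Omega> y / norm y powr \<gamma> else 0)"

text \<open>
  The terms are the contributions of the modulus of continuity of \<open>\<Omega>\<close>, of the smoothness of the radial factor,
  and of the two shells near the truncation radii.
\<close>

definition hoermander_const :: "nat \<Rightarrow> real \<Rightarrow> real \<Rightarrow> real \<Rightarrow> real" where
  "hoermander_const n B1 B2 C0 =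
     sphere_area n * (C0 * B2 + B1 * C0 * real n * 2 powr (real n + 1) + 6 * B1 * C0 * 2 ^ n)"

text \<open>
  The first term is the contribution of the points with \<open>norm y < 2 * pi / norm \<xi>\<close>, the second that of the others.
\<close>

definition fourier_const :: "nat \<Rightarrow> real \<Rightarrow> real \<Rightarrow> real \<Rightarrow> real" where
  "fourier_const n B1 B2 C0 = 2 * pi * B1 * C0 * sphere_area n +
     (hoermander_const n B1 B2 C0 + 3 * B1 * C0 * sphere_area n) / 2"

lemma borel_measurable_if_dini:
  fixes \<Omega> :: "real^'n \<Rightarrow> real"
  assumes \<Omega>: "dini_kernel B1 B2 \<Omega>" and \<epsilon>: "0 < \<epsilon>" and [measurable]: "Measurable.pred borel P"
  shows "(\<lambda>y. if \<epsilon> \<le> norm y \<and> P y then \<Omega> y / norm y powr \<gamma> else 0) \<in> borel_measurable borel"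
proof -
  define \<Omega>0 where "\<Omega>0 x = (if x = 0 then 0 else \<Omega> x)" for x
  have [measurable]: "\<Omega>0 \<in> borel_measurable borel" unfolding \<Omega>0_def[abs_def] by (rule dini_kernel_borel[OF \<Omega>])
  have "(\<lambda>y. if \<epsilon> \<le> norm y \<and> P y then \<Omega>0 y / norm y powr \<gamma> else 0) \<in> borel_measurable borel"
    by measurable
  also have "(\<lambda>y. if \<epsilon> \<le> norm y \<and> P y then \<Omega>0 y / norm y powr \<gamma> else 0) =
     (\<lambda>y. if \<epsilon> \<le> norm y \<and> P y then \<Omega> y / norm y powr \<gamma> else 0)"
    using \<epsilon> by (auto simp: \<Omega>0_def)
  finally show ?thesis .
qed

text \<open>
  Here \<open>\<gamma>\<close> stands for \<open>n - \<beta>\<close>. By the last assumption, below the radius \<open>R1\<close> the kernel has the size of a kernel of homogeneity \<open>- n\<close>, with a constant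
  \<open>C0\<close> that will not depend on \<open>\<beta>\<close>.
\<close>

context
  fixes \<Omega> :: "real^'n \<Rightarrow> real" and B1 B2 \<gamma> C0 R1 :: real
  assumes \<Omega>: "dini_kernel B1 B2 \<Omega>" and B1: "0 < B1" and B2: "0 < B2"
    and \<gamma>: "0 < \<gamma>" "\<gamma> \<le> real CARD('n)" and C0: "0 < C0"
    and size: "\<And>r. 0 < r \<Longrightarrow> r < R1 \<Longrightarrow> 1 / r powr \<gamma> \<le> C0 / r ^ CARD('n)"
begin

lemma \<Omega>_bound: "x \<noteq> 0 \<Longrightarrow> \<bar>\<Omega> x\<bar> \<le> B1"
  using \<Omega> by (auto simp: dini_kernel_def)

lemma trunc_kernel_measurable: "0 < \<epsilon> \<Longrightarrow> trunc_kernel \<Omega> \<gamma> \<epsilon> R \<in> borel_measurable borel"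
  unfolding trunc_kernel_def[abs_def] by (intro borel_measurable_if_dini[OF \<Omega>]) auto

lemma trunc_kernel_size:
  assumes "0 < \<epsilon>" "R \<le> R1"
  shows "\<bar>trunc_kernel \<Omega> \<gamma> \<epsilon> R y\<bar> \<le> B1 * C0 / norm y ^ CARD('n)"
proof (cases "\<epsilon> \<le> norm y \<and> norm y < R")
  case True
  then have y: "0 < norm y" "norm y < R1" using assms by auto
  have "\<bar>\<Omega> y\<bar> * (1 / norm y powr \<gamma>) \<le> B1 * (C0 / norm y ^ CARD('n))"
    using y B1 by (intro mult_mono size \<Omega>_bound) auto
  then show ?thesis using True by (simp add: trunc_kernel_def abs_divide)
qed (use B1 C0 in \<open>auto simp: trunc_kernel_def\<close>)

lemma trunc_kernel_bounded:
  assumes "0 < \<epsilon>"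
  shows "\<bar>trunc_kernel \<Omega> \<gamma> \<epsilon> R y\<bar> \<le> B1 / \<epsilon> powr \<gamma>"
proof (cases "\<epsilon> \<le> norm y \<and> norm y < R")
  case True
  then have "\<bar>\<Omega> y\<bar> / norm y powr \<gamma> \<le> B1 / \<epsilon> powr \<gamma>"
    using assms \<gamma> B1 by (intro frac_le \<Omega>_bound powr_mono2) auto
  then show ?thesis using True by (simp add: trunc_kernel_def abs_divide)
qed (use B1 in \<open>auto simp: trunc_kernel_def\<close>)

lemma trunc_kernel_integrable:
  assumes \<epsilon>: "0 < \<epsilon>"
  shows "integrable lborel (trunc_kernel \<Omega> \<gamma> \<epsilon> R)"
proof (rule Bochner_Integration.integrable_bound[where f = "\<lambda>x. indicator (cball 0 R) x *\<^sub>R (B1 / \<epsilon> powr \<gamma>)"])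
  show "integrable lborel (\<lambda>x::real^'n. indicator (cball 0 R) x *\<^sub>R (B1 / \<epsilon> powr \<gamma>))"
    by (intro integrable_scaleR_left integrable_real_indicator) (auto simp: emeasure_bounded_finite[unfolded infinity_ennreal_def])
  show "AE y in lborel. norm (trunc_kernel \<Omega> \<gamma> \<epsilon> R y) \<le> norm (indicator (cball 0 R) y *\<^sub>R (B1 / \<epsilon> powr \<gamma>))"
  proof (intro AE_I2)
    fix y
    show "norm (trunc_kernel \<Omega> \<gamma> \<epsilon> R y) \<le> norm (indicator (cball 0 R) y *\<^sub>R (B1 / \<epsilon> powr \<gamma>))"
      using trunc_kernel_bounded[OF \<epsilon>, of R y] B1 by (cases "norm y \<le> R") (auto simp: trunc_kernel_def)
  qed
qed (simp add: trunc_kernel_measurable[OF \<epsilon>])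

text \<open>
  If both points lie in the shell, the difference splits into an angular and a radial one. If only one of them
  does, then \<open>norm x\<close> is comparable to one of the truncation radii, since \<open>norm (x - y)\<close> lies between
  \<open>norm x / 2\<close> and \<open>3 / 2 * norm x\<close>, and the size of the kernel suffices.
\<close>

lemma trunc_kernel_diff:
  assumes \<epsilon>: "0 < \<epsilon>" and R: "R \<le> R1" and y: "y \<noteq> 0" "2 * norm y \<le> norm x"
  shows "\<bar>trunc_kernel \<Omega> \<gamma> \<epsilon> R (x - y) - trunc_kernel \<Omega> \<gamma> \<epsilon> R x\<bar> \<le>
    C0 * (sphere_modulus \<Omega> (2 * norm y / norm x) / norm x ^ CARD('n)) +
    B1 * C0 * real CARD('n) * 2 powr (real CARD('n) + 1) * (2 * norm y / (norm x * norm x ^ CARD('n))) +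
    B1 * C0 * 2 ^ CARD('n) * (if \<epsilon> / 2 \<le> norm x \<and> norm x \<le> 2 * \<epsilon> then 1 / norm x ^ CARD('n) else 0) +
    B1 * C0 * 2 ^ CARD('n) * (if R / 2 \<le> norm x \<and> norm x \<le> 2 * R then 1 / norm x ^ CARD('n) else 0)"
    (is "?L \<le> ?T1 + ?T2 + ?T3 + ?T4")
proof -
  let ?n = "CARD('n)"
  have ny: "0 < norm y" using y(1) by simp
  have nx: "0 < norm x" using ny y(2) by linarith
  have x: "x \<noteq> 0" using nx by auto
  have lo: "norm x / 2 \<le> norm (x - y)" using norm_triangle_ineq2[of x y] y(2) by linarith
  have hi: "norm (x - y) \<le> 3 / 2 * norm x" using norm_triangle_ineq4[of x y] y(2) by linarith
  have x': "x - y \<noteq> 0" using lo nx by auto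
  have T: "0 \<le> ?T1" "0 \<le> ?T2" "0 \<le> ?T3" "0 \<le> ?T4"
    using C0 B1 sphere_modulus(3)[of \<Omega>, OF \<Omega>_bound] by (auto intro!: mult_nonneg_nonneg divide_nonneg_nonneg)
  have two: "1 \<le> (2::real) ^ ?n" by simp
  have szx: "\<bar>trunc_kernel \<Omega> \<gamma> \<epsilon> R x\<bar> \<le> B1 * C0 * 2 ^ ?n * (1 / norm x ^ ?n)"
  proof -
    have "B1 * C0 * (1 / norm x ^ ?n) \<le> B1 * C0 * 2 ^ ?n * (1 / norm x ^ ?n)"
      using B1 C0 two by (intro mult_right_mono) auto
    then show ?thesis using trunc_kernel_size[OF \<epsilon> R, of x] by simp
  qed
  have szx': "\<bar>trunc_kernel \<Omega> \<gamma> \<epsilon> R (x - y)\<bar> \<le> B1 * C0 * 2 ^ ?n * (1 / norm x ^ ?n)"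
  proof -
    have "(norm x / 2) ^ ?n \<le> norm (x - y) ^ ?n" using lo nx by (intro power_mono) auto
    then have "B1 * C0 / norm (x - y) ^ ?n \<le> B1 * C0 / (norm x / 2) ^ ?n"
      using B1 C0 nx x' by (intro divide_left_mono mult_pos_pos) auto
    also have "\<dots> = B1 * C0 * 2 ^ ?n * (1 / norm x ^ ?n)" by (simp add: power_divide)
    finally show ?thesis using trunc_kernel_size[OF \<epsilon> R, of "x - y"] by linarith
  qed
  consider (both) "\<epsilon> \<le> norm x" "norm x < R" "\<epsilon> \<le> norm (x - y)" "norm (x - y) < R"
    | (only_x) "\<epsilon> \<le> norm x" "norm x < R" "\<not> (\<epsilon> \<le> norm (x - y) \<and> norm (x - y) < R)"
    | (only_x') "\<not> (\<epsilon> \<le> norm x \<and> norm x < R)" "\<epsilon> \<le> norm (x - y)" "norm (x - y) < R"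
    | (none) "\<not> (\<epsilon> \<le> norm x \<and> norm x < R)" "\<not> (\<epsilon> \<le> norm (x - y) \<and> norm (x - y) < R)"
    by blast
  then show ?thesis
  proof cases
    case both
    let ?r = "norm x" and ?s = "norm (x - y)"
    have sz: "1 / ?r powr \<gamma> \<le> C0 / ?r ^ ?n" using both R nx by (intro size) auto
    have "?L = \<bar>(\<Omega> (x - y) - \<Omega> x) * (1 / ?r powr \<gamma>) + \<Omega> (x - y) * (1 / ?s powr \<gamma> - 1 / ?r powr \<gamma>)\<bar>"
      using both by (simp add: trunc_kernel_def algebra_simps)
    also have "\<dots> \<le> \<bar>\<Omega> (x - y) - \<Omega> x\<bar> * (1 / ?r powr \<gamma>) + \<bar>\<Omega> (x - y)\<bar> * \<bar>1 / ?s powr \<gamma> - 1 / ?r powr \<gamma>\<bar>"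
      by (rule order_trans[OF abs_triangle_ineq]) (simp add: abs_mult)
    also have "\<bar>\<Omega> (x - y) - \<Omega> x\<bar> * (1 / ?r powr \<gamma>) \<le> sphere_modulus \<Omega> (2 * norm y / norm x) * (C0 / ?r ^ ?n)"
    proof (intro mult_mono sz)
      show "\<bar>\<Omega> (x - y) - \<Omega> x\<bar> \<le> sphere_modulus \<Omega> (2 * norm y / norm x)"
        using dini_kernel_diff[OF \<Omega> x x', of "2 * norm y / norm x"] by (simp add: abs_minus_commute)
      show "0 \<le> sphere_modulus \<Omega> (2 * norm y / norm x)" by (rule sphere_modulus(3)[OF \<Omega>_bound]) auto
    qed auto
    also have "\<bar>\<Omega> (x - y)\<bar> * \<bar>1 / ?s powr \<gamma> - 1 / ?r powr \<gamma>\<bar> \<le>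
       B1 * (real ?n * 2 powr (real ?n + 1) * (2 * norm y / ?r) * (C0 / ?r ^ ?n))"
    proof (intro mult_mono \<Omega>_bound x')
      have "\<bar>?s - ?r\<bar> \<le> norm y" using norm_triangle_ineq3[of "x - y" x] by simp
      then have d: "\<bar>?s - ?r\<bar> / ?r \<le> 2 * norm y / ?r" using nx ny by (intro divide_right_mono) auto
      have "\<bar>1 / ?s powr \<gamma> - 1 / ?r powr \<gamma>\<bar> \<le> real ?n * 2 powr (real ?n + 1) * (\<bar>?s - ?r\<bar> / ?r) / ?r powr \<gamma>"
        by (rule powr_neg_diff[OF nx lo \<gamma>])
      also have "\<dots> = real ?n * 2 powr (real ?n + 1) * (\<bar>?s - ?r\<bar> / ?r) * (1 / ?r powr \<gamma>)" by simp
      also have "\<dots> \<le> real ?n * 2 powr (real ?n + 1) * (2 * norm y / ?r) * (C0 / ?r ^ ?n)"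
        using d nx by (intro mult_mono sz) auto
      finally show "\<bar>1 / ?s powr \<gamma> - 1 / ?r powr \<gamma>\<bar> \<le> real ?n * 2 powr (real ?n + 1) * (2 * norm y / ?r) * (C0 / ?r ^ ?n)" .
    qed (use B1 in auto)
    finally have "?L \<le> ?T1 + ?T2" by (simp add: mult_ac)
    then show ?thesis using T by linarith
  next
    case only_x
    have "trunc_kernel \<Omega> \<gamma> \<epsilon> R (x - y) = 0" using only_x(3) by (auto simp: trunc_kernel_def)
    then have L: "?L = \<bar>trunc_kernel \<Omega> \<gamma> \<epsilon> R x\<bar>" by simp
    have "norm x \<le> 2 * \<epsilon> \<or> R / 2 \<le> norm x" using only_x lo hi by linarith
    then show ?thesis
    proof
      assume "norm x \<le> 2 * \<epsilon>"
      then have "?L \<le> ?T3" using szx only_x \<epsilon> unfolding L by auto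
      then show ?thesis using T by linarith
    next
      assume "R / 2 \<le> norm x"
      then have "?L \<le> ?T4" using szx only_x \<epsilon> nx unfolding L by auto
      then show ?thesis using T by linarith
    qed
  next
    case only_x'
    have "trunc_kernel \<Omega> \<gamma> \<epsilon> R x = 0" using only_x'(1) by (auto simp: trunc_kernel_def)
    then have L: "?L = \<bar>trunc_kernel \<Omega> \<gamma> \<epsilon> R (x - y)\<bar>" by simp
    have "(\<epsilon> / 2 \<le> norm x \<and> norm x \<le> 2 * \<epsilon>) \<or> (R / 2 \<le> norm x \<and> norm x \<le> 2 * R)" using only_x' lo hi \<epsilon> by linarith
    then show ?thesis
    proof
      assume "\<epsilon> / 2 \<le> norm x \<and> norm x \<le> 2 * \<epsilon>"
      then have "?L \<le> ?T3" using szx' unfolding L by auto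
      then show ?thesis using T by linarith
    next
      assume "R / 2 \<le> norm x \<and> norm x \<le> 2 * R"
      then have "?L \<le> ?T4" using szx' unfolding L by auto
      then show ?thesis using T by linarith
    qed
  next
    case none
    have "trunc_kernel \<Omega> \<gamma> \<epsilon> R x = 0" "trunc_kernel \<Omega> \<gamma> \<epsilon> R (x - y) = 0"
      using none by (auto simp: trunc_kernel_def)
    then have "?L = 0" by simp
    then show ?thesis using T by linarith
  qed
qed

text \<open>
  Integrating the pointwise bound, the angular term becomes the Dini integral after inverting the radius, and the
  others are integrals of powers that scale out.
\<close>

lemma trunc_kernel_hoermander:
  assumes \<epsilon>: "0 < \<epsilon>" and R: "0 < R" "R \<le> R1"
  shows "(\<integral>\<^sup>+x. indicator {x. 2 * norm y \<le> norm x} x *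
       ennreal \<bar>trunc_kernel \<Omega> \<gamma> \<epsilon> R (x - y) - trunc_kernel \<Omega> \<gamma> \<epsilon> R x\<bar> \<partial>lborel) \<le>
    ennreal (hoermander_const CARD('n) B1 B2 C0)"
proof (cases "y = 0")
  case False
  let ?n = "CARD('n)"
  define a where "a = 2 * norm y"
  have a: "0 < a" using False by (simp add: a_def)
  \<comment> \<open>For negative arguments the modulus is the supremum of the empty set; with the value \<open>0\<close> there it
    is monotone on the whole line, hence measurable.\<close>
  define h where "h t = (if t < 0 then 0 else sphere_modulus \<Omega> t)" for t
  note \<omega> = sphere_modulus[of \<Omega>, OF \<Omega>_bound]
  have "mono h" unfolding h_def using \<omega>(2,3) by (intro monoI) (auto simp: not_less intro: order_trans)
  then have [measurable]: "h \<in> borel_measurable borel" by (rule borel_measurable_mono)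
  have h0: "0 \<le> h t" for t using \<omega>(3) by (simp add: h_def)
  let ?D = "B1 * C0 * real ?n * 2 powr (real ?n + 1)" and ?E = "B1 * C0 * 2 ^ ?n"
  define f1 where "f1 x = (if a \<le> norm x then ennreal (h (a / norm x) / norm x ^ ?n) else 0)" for x :: "real^'n"
  define f2 where "f2 x = (if a \<le> norm x then ennreal (norm x powr - (real ?n + 1)) else 0)" for x :: "real^'n"
  define f3 where "f3 s x = (if s / 2 \<le> norm x \<and> norm x \<le> 2 * s then ennreal (1 / norm x ^ ?n) else 0)" for s and x :: "real^'n"
  have [measurable]: "f1 \<in> borel_measurable borel" "f2 \<in> borel_measurable borel" "f3 s \<in> borel_measurable borel" for s
    unfolding f1_def f2_def f3_def by measurable
  have D: "0 \<le> ?D" and E: "0 \<le> ?E" using B1 C0 by auto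
  have "(\<integral>\<^sup>+x. indicator {x. 2 * norm y \<le> norm x} x * ennreal \<bar>trunc_kernel \<Omega> \<gamma> \<epsilon> R (x - y) - trunc_kernel \<Omega> \<gamma> \<epsilon> R x\<bar> \<partial>lborel) \<le>
    (\<integral>\<^sup>+x. ennreal C0 * f1 x + ennreal (?D * a) * f2 x + ennreal ?E * f3 \<epsilon> x + ennreal ?E * f3 R x \<partial>lborel)"
  proof (intro nn_integral_mono)
    fix x :: "real^'n"
    show "indicator {x. 2 * norm y \<le> norm x} x * ennreal \<bar>trunc_kernel \<Omega> \<gamma> \<epsilon> R (x - y) - trunc_kernel \<Omega> \<gamma> \<epsilon> R x\<bar> \<le>
      ennreal C0 * f1 x + ennreal (?D * a) * f2 x + ennreal ?E * f3 \<epsilon> x + ennreal ?E * f3 R x"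
    proof (cases "a \<le> norm x")
      case True
      then have nx: "0 < norm x" using a by linarith
      have pw: "norm x powr - (real ?n + 1) = 1 / (norm x * norm x ^ ?n)"
      proof -
        have "norm x powr (real ?n + 1) = norm x * norm x ^ ?n"
          using powr_realpow[OF nx, of "Suc ?n"] by (simp add: add.commute)
        then show ?thesis unfolding powr_minus_divide by simp
      qed
      have hx: "h (a / norm x) = sphere_modulus \<Omega> (a / norm x)" using divide_pos_pos[OF a nx] unfolding h_def by simp
      have "ennreal \<bar>trunc_kernel \<Omega> \<gamma> \<epsilon> R (x - y) - trunc_kernel \<Omega> \<gamma> \<epsilon> R x\<bar> \<le> ennreal (
        C0 * (h (a / norm x) / norm x ^ ?n) + ?D * (a / (norm x * norm x ^ ?n)) +
        ?E * (if \<epsilon> / 2 \<le> norm x \<and> norm x \<le> 2 * \<epsilon> then 1 / norm x ^ ?n else 0) +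
        ?E * (if R / 2 \<le> norm x \<and> norm x \<le> 2 * R then 1 / norm x ^ ?n else 0))"
        using trunc_kernel_diff[OF \<epsilon> R(2) False, of x, folded a_def] True
        unfolding hx by (intro ennreal_leI)
      also have "\<dots> = ennreal (C0 * (h (a / norm x) / norm x ^ ?n)) + ennreal (?D * (a / (norm x * norm x ^ ?n))) +
        ennreal (?E * (if \<epsilon> / 2 \<le> norm x \<and> norm x \<le> 2 * \<epsilon> then 1 / norm x ^ ?n else 0)) +
        ennreal (?E * (if R / 2 \<le> norm x \<and> norm x \<le> 2 * R then 1 / norm x ^ ?n else 0))"
      proof -
        have "ennreal (p + q + r + s) = ennreal p + ennreal q + ennreal r + ennreal s"
          if "0 \<le> p" "0 \<le> q" "0 \<le> r" "0 \<le> s" for p q r s using that by simp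
        note plus4 = this
        show ?thesis
          by (rule plus4) (use C0 h0 D E a in \<open>auto intro!: mult_nonneg_nonneg divide_nonneg_nonneg\<close>)
      qed
      also have "\<dots> = ennreal C0 * f1 x + ennreal (?D * a) * f2 x + ennreal ?E * f3 \<epsilon> x + ennreal ?E * f3 R x"
      proof -
        have 1: "ennreal (C0 * (h (a / norm x) / norm x ^ ?n)) = ennreal C0 * f1 x"
          unfolding f1_def using True C0 h0 by (subst ennreal_mult) auto
        have 2: "ennreal (?D * (a / (norm x * norm x ^ ?n))) = ennreal (?D * a) * f2 x"
        proof -
          have "?D * (a / (norm x * norm x ^ ?n)) = ?D * a * norm x powr - (real ?n + 1)" unfolding pw by simp
          then show ?thesis unfolding f2_def using True D a by (simp only: if_True) (intro ennreal_mult, auto)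
        qed
        have 3: "ennreal (?E * (if s / 2 \<le> norm x \<and> norm x \<le> 2 * s then 1 / norm x ^ ?n else 0)) = ennreal ?E * f3 s x" for s
          unfolding f3_def using E by (subst ennreal_mult) auto
        show ?thesis unfolding 1 2 3 ..
      qed
      finally show ?thesis using True by (simp add: a_def)
    qed (simp add: a_def)
  qed
  also have "\<dots> = ennreal C0 * (\<integral>\<^sup>+x. f1 x \<partial>lborel) + ennreal (?D * a) * (\<integral>\<^sup>+x. f2 x \<partial>lborel) +
      ennreal ?E * (\<integral>\<^sup>+x. f3 \<epsilon> x \<partial>lborel) + ennreal ?E * (\<integral>\<^sup>+x. f3 R x \<partial>lborel)"
    by (simp add: nn_integral_add nn_integral_cmult)
  also have "\<dots> \<le> ennreal C0 * (ennreal (sphere_area ?n) * ennreal B2) + ennreal (?D * a) * ennreal (sphere_area ?n * (1 / a)) +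
      ennreal ?E * ennreal (sphere_area ?n * 3) + ennreal ?E * ennreal (sphere_area ?n * 3)"
  proof (intro add_mono mult_left_mono)
    have "(\<integral>\<^sup>+t. (if 0 < t \<and> t \<le> 1 then ennreal (h t / t) else 0) \<partial>lborel) = (\<integral>\<^sup>+\<delta>\<in>{0<..1}. ennreal (sphere_modulus \<Omega> \<delta> / \<delta>) \<partial>lborel)"
      by (intro nn_integral_cong) (auto simp: h_def)
    also have "\<dots> = ennreal B2" using \<Omega> by (simp add: dini_kernel_def)
    finally show "(\<integral>\<^sup>+x. f1 x \<partial>lborel) \<le> ennreal (sphere_area ?n) * ennreal B2"
      using nn_integral_norm_inversion[of h a, where 'a="real^'n", unfolded DIM_vec] h0 a by (simp add: f1_def)
    show "(\<integral>\<^sup>+x. f2 x \<partial>lborel) \<le> ennreal (sphere_area ?n * (1 / a))"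
      using nn_integral_norm_far[OF a, of "real ?n + 1", where 'a="real^'n", unfolded DIM_vec] a by (simp add: f2_def powr_minus_divide)
    show "(\<integral>\<^sup>+x. f3 \<epsilon> x \<partial>lborel) \<le> ennreal (sphere_area ?n * 3)" "(\<integral>\<^sup>+x. f3 R x \<partial>lborel) \<le> ennreal (sphere_area ?n * 3)"
      using nn_integral_norm_annulus[OF \<epsilon>, where 'a="real^'n", unfolded DIM_vec] nn_integral_norm_annulus[OF R(1), where 'a="real^'n", unfolded DIM_vec]
      by (simp_all add: f3_def)
  qed auto
  also have "\<dots> = ennreal (C0 * (sphere_area ?n * B2) + ?D * a * (sphere_area ?n * (1 / a)) + ?E * (sphere_area ?n * 3) + ?E * (sphere_area ?n * 3))"
  proof -
    have "ennreal c * (ennreal s * ennreal b) + ennreal d * ennreal t + ennreal e * ennreal u + ennreal e * ennreal u =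
      ennreal (c * (s * b) + d * t + e * u + e * u)"
      if "0 \<le> c" "0 \<le> s" "0 \<le> b" "0 \<le> d" "0 \<le> t" "0 \<le> e" "0 \<le> u" for c s b d t e u
      using that by (simp add: ennreal_mult[symmetric] ennreal_plus[symmetric] del: ennreal_plus)
    then show ?thesis
      using C0 B2 D E a by (metis less_imp_le sphere_area_nonneg mult_nonneg_nonneg divide_nonneg_nonneg zero_le_one zero_le_numeral)
  qed
  also have "C0 * (sphere_area ?n * B2) + ?D * a * (sphere_area ?n * (1 / a)) + ?E * (sphere_area ?n * 3) + ?E * (sphere_area ?n * 3) =
     hoermander_const ?n B1 B2 C0"
    using a by (simp add: hoermander_const_def algebra_simps)
  finally show ?thesis .
qed simp

text \<open>
  On the scale below \<open>a = 2 * pi / norm \<xi>\<close> the cancellation allows to subtract \<open>1\<close> from the exponential, which is then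
  at most \<open>norm \<xi> * norm x\<close>. For the rest, translating by the half period \<open>z\<close> changes the sign of the exponential, so
  that twice the Fourier transform is bounded by the integral of \<open>\<bar>K2 (x - z) - K2 x\<bar>\<close>: Hoermander's condition covers
  \<open>norm x \<ge> 2 * norm z\<close>, and elsewhere \<open>K2 x\<close> vanishes and \<open>x - z\<close> ranges over one shell of fixed ratio.
\<close>

lemma trunc_kernel_fourier:
  assumes \<epsilon>: "0 < \<epsilon>" and R: "0 < R" "R \<le> R1"
  shows "cmod (fourier (trunc_kernel \<Omega> \<gamma> \<epsilon> R) \<xi>) \<le> fourier_const CARD('n) B1 B2 C0"
proof (cases "\<xi> = 0")
  case True
  have H: "0 \<le> hoermander_const CARD('n) B1 B2 C0"
    using B1 B2 C0 unfolding hoermander_const_def by (intro mult_nonneg_nonneg add_nonneg_nonneg) auto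
  have "(\<integral>x. trunc_kernel \<Omega> \<gamma> \<epsilon> R x \<partial>lborel) = (\<integral>x. \<Omega> x * (if \<epsilon> \<le> norm x \<and> norm x < R then 1 / norm x powr \<gamma> else 0) \<partial>lborel)"
    by (intro Bochner_Integration.integral_cong) (auto simp: trunc_kernel_def)
  also have "\<dots> = 0"
    by (rule dini_kernel_cancellation[OF \<Omega>, of "\<lambda>r. if \<epsilon> \<le> r \<and> r < R then 1 / r powr \<gamma> else 0"]) (use \<epsilon> in auto)
  finally have "fourier (trunc_kernel \<Omega> \<gamma> \<epsilon> R) \<xi> = 0"
    using True by (simp add: fourier_def scaleR_conv_of_real)
  then show ?thesis using H B1 C0 by (simp add: fourier_const_def)
next
  case False
  let ?n = "CARD('n)"
  define z where "z = (pi / (norm \<xi>)\<^sup>2) *\<^sub>R \<xi>"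
  define a where "a = 2 * norm z"
  have nz: "norm z = pi / norm \<xi>" using False by (simp add: z_def power2_eq_square)
  have a: "0 < a" "a * norm \<xi> = 2 * pi" using False by (auto simp: a_def nz)
  define K where "K = trunc_kernel \<Omega> \<gamma> \<epsilon> R"
  define K1 where "K1 = trunc_kernel \<Omega> \<gamma> \<epsilon> (min R a)"
  define K2 where "K2 = trunc_kernel \<Omega> \<gamma> (max \<epsilon> a) R"
  have K12: "K x = K1 x + K2 x" for x by (auto simp: K_def K1_def K2_def trunc_kernel_def)
  have i1: "integrable lborel K1" unfolding K1_def by (rule trunc_kernel_integrable[OF \<epsilon>])
  have i2: "integrable lborel K2" unfolding K2_def using \<epsilon> by (intro trunc_kernel_integrable) auto
  have [measurable]: "K1 \<in> borel_measurable borel" "K2 \<in> borel_measurable borel" using i1 i2 by auto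
  have split: "fourier K \<xi> = fourier K1 \<xi> + fourier K2 \<xi>"
    unfolding fourier_def K12 scaleR_add_left
    by (intro Bochner_Integration.integral_add fourier_integrable i1 i2)
  have F1: "cmod (fourier K1 \<xi>) \<le> 2 * pi * B1 * C0 * sphere_area ?n"
  proof -
    have "(\<integral>x. K1 x \<partial>lborel) = (\<integral>x. \<Omega> x * (if \<epsilon> \<le> norm x \<and> norm x < min R a then 1 / norm x powr \<gamma> else 0) \<partial>lborel)"
      by (intro Bochner_Integration.integral_cong) (auto simp: K1_def trunc_kernel_def)
    also have "\<dots> = 0"
      by (rule dini_kernel_cancellation[OF \<Omega>, of "\<lambda>r. if \<epsilon> \<le> r \<and> r < min R a then 1 / r powr \<gamma> else 0"]) (use \<epsilon> in auto)
    finally have c: "(\<integral>x. K1 x *\<^sub>R (1::complex) \<partial>lborel) = 0" using i1 by simp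
    have i1': "integrable lborel (\<lambda>x. K1 x *\<^sub>R (1::complex))" using i1 by simp
    have "fourier K1 \<xi> = (\<integral>x. K1 x *\<^sub>R (cis (- (\<xi> \<bullet> x)) - 1) \<partial>lborel)"
      unfolding fourier_def scaleR_diff_right
      using fourier_integrable[OF i1] i1' c by (subst Bochner_Integration.integral_diff) auto
    then have "ennreal (cmod (fourier K1 \<xi>)) \<le> (\<integral>\<^sup>+x. ennreal (cmod (K1 x *\<^sub>R (cis (- (\<xi> \<bullet> x)) - 1))) \<partial>lborel)"
      using integral_norm_bound_ennreal[of lborel "\<lambda>x. K1 x *\<^sub>R (cis (- (\<xi> \<bullet> x)) - 1)"] fourier_integrable[OF i1, of \<xi>] i1'
      by (simp add: scaleR_diff_right)
    also have "\<dots> \<le> (\<integral>\<^sup>+x. ennreal (B1 * C0 * norm \<xi>) * (if norm x < a then ennreal (1 / norm x ^ (?n - 1)) else 0) \<partial>(lborel :: (real^'n) measure))"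
    proof (intro nn_integral_mono)
      fix x :: "real^'n"
      show "ennreal (cmod (K1 x *\<^sub>R (cis (- (\<xi> \<bullet> x)) - 1))) \<le> ennreal (B1 * C0 * norm \<xi>) * (if norm x < a then ennreal (1 / norm x ^ (?n - 1)) else 0)"
      proof (cases "K1 x = 0")
        case False
        then have x: "norm x < a" "0 < norm x" using \<epsilon> by (auto simp: K1_def trunc_kernel_def split: if_splits)
        have "cmod (cis (- (\<xi> \<bullet> x)) - 1) \<le> \<bar>\<xi> \<bullet> x\<bar>"
          using iexp_approx1[of "- (\<xi> \<bullet> x)" 0] by (simp add: cis_conv_exp)
        also have "\<dots> \<le> norm \<xi> * norm x" by (rule Cauchy_Schwarz_ineq2)
        finally have osc: "cmod (cis (- (\<xi> \<bullet> x)) - 1) \<le> norm \<xi> * norm x" .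
        have "\<bar>K1 x\<bar> \<le> B1 * C0 / norm x ^ ?n"
          unfolding K1_def using R by (intro trunc_kernel_size \<epsilon>) auto
        then have "cmod (K1 x *\<^sub>R (cis (- (\<xi> \<bullet> x)) - 1)) \<le> B1 * C0 / norm x ^ ?n * (norm \<xi> * norm x)"
          unfolding norm_scaleR using osc B1 C0 by (intro mult_mono) auto
        also have "\<dots> = B1 * C0 * norm \<xi> * (1 / norm x ^ (?n - 1))"
          using x DIM_power[where 'a="real^'n", of "norm x"] by simp
        finally have "ennreal (cmod (K1 x *\<^sub>R (cis (- (\<xi> \<bullet> x)) - 1))) \<le> ennreal (B1 * C0 * norm \<xi> * (1 / norm x ^ (?n - 1)))"
          by (rule ennreal_leI)
        also have "\<dots> = ennreal (B1 * C0 * norm \<xi>) * ennreal (1 / norm x ^ (?n - 1))"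
          using B1 C0 by (intro ennreal_mult) auto
        finally show ?thesis using x by simp
      qed simp
    qed
    also have "\<dots> = ennreal (B1 * C0 * norm \<xi>) * (\<integral>\<^sup>+x. (if norm x < a then ennreal (1 / norm x ^ (?n - 1)) else 0) \<partial>(lborel :: (real^'n) measure))"
      by (rule nn_integral_cmult) measurable
    also have "\<dots> \<le> ennreal (B1 * C0 * norm \<xi>) * ennreal (sphere_area ?n * a)"
      using nn_integral_norm_near[of a, where 'a="real^'n", unfolded DIM_vec] a by (intro mult_left_mono) auto
    also have "\<dots> = ennreal (B1 * C0 * norm \<xi> * (sphere_area ?n * a))"
      using B1 C0 a by (intro ennreal_mult[symmetric]) auto
    also have "B1 * C0 * norm \<xi> * (sphere_area ?n * a) = B1 * C0 * sphere_area ?n * (a * norm \<xi>)" by simp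
    also have "\<dots> = 2 * pi * B1 * C0 * sphere_area ?n" unfolding a(2) by simp
    finally show ?thesis using B1 C0 by (subst (asm) ennreal_le_iff) auto
  qed
  have F2: "2 * cmod (fourier K2 \<xi>) \<le> hoermander_const ?n B1 B2 C0 + 3 * B1 * C0 * sphere_area ?n"
  proof -
    have \<xi>z: "\<xi> \<bullet> z = pi" using False by (simp add: z_def power2_norm_eq_inner)
    have "fourier K2 \<xi> = (\<integral>x. K2 (x - z) *\<^sub>R cis (- (\<xi> \<bullet> (x - z))) \<partial>lborel)"
      unfolding fourier_def by (rule integral_lborel_shift(1)[symmetric]) measurable
    also have "\<dots> = (\<integral>x. - (K2 (x - z) *\<^sub>R cis (- (\<xi> \<bullet> x))) \<partial>lborel)"
    proof (intro Bochner_Integration.integral_cong refl)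
      fix x
      have "cis (- (\<xi> \<bullet> (x - z))) = cis (- (\<xi> \<bullet> x)) * cis pi"
        unfolding cis_mult by (simp add: inner_diff_right \<xi>z)
      then show "K2 (x - z) *\<^sub>R cis (- (\<xi> \<bullet> (x - z))) = - (K2 (x - z) *\<^sub>R cis (- (\<xi> \<bullet> x)))" by simp
    qed
    finally have sh: "fourier K2 \<xi> = - (\<integral>x. K2 (x - z) *\<^sub>R cis (- (\<xi> \<bullet> x)) \<partial>lborel)" by simp
    have i2': "integrable lborel (\<lambda>x. K2 (x - z))" using integral_lborel_shift(2)[of K2 z] i2 by simp
    have "(\<integral>x. (K2 x - K2 (x - z)) *\<^sub>R cis (- (\<xi> \<bullet> x)) \<partial>lborel) = fourier K2 \<xi> - fourier (\<lambda>x. K2 (x - z)) \<xi>"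
      unfolding fourier_def scaleR_diff_left
      by (intro Bochner_Integration.integral_diff fourier_integrable i2 i2')
    moreover have "fourier (\<lambda>x. K2 (x - z)) \<xi> = - fourier K2 \<xi>" using sh by (simp add: fourier_def)
    ultimately have "2 * fourier K2 \<xi> = (\<integral>x. (K2 x - K2 (x - z)) *\<^sub>R cis (- (\<xi> \<bullet> x)) \<partial>lborel)" by simp
    then have "ennreal (cmod (2 * fourier K2 \<xi>)) \<le> (\<integral>\<^sup>+x. ennreal (cmod ((K2 x - K2 (x - z)) *\<^sub>R cis (- (\<xi> \<bullet> x)))) \<partial>lborel)"
      using integral_norm_bound_ennreal[OF fourier_integrable[of "\<lambda>x. K2 x - K2 (x - z)" \<xi>]] i2 i2' by simp
    also have "\<dots> = (\<integral>\<^sup>+x. ennreal \<bar>K2 (x - z) - K2 x\<bar> \<partial>lborel)"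
      by (intro nn_integral_cong) (simp add: abs_minus_commute)
    also have "\<dots> \<le> (\<integral>\<^sup>+x. indicator {x. 2 * norm z \<le> norm x} x * ennreal \<bar>K2 (x - z) - K2 x\<bar> +
        ennreal (B1 * C0) * (\<lambda>x. if a / 2 \<le> norm x \<and> norm x \<le> 2 * a then ennreal (1 / norm x ^ ?n) else 0) (x - z) \<partial>lborel)"
    proof (intro nn_integral_mono)
      fix x :: "real^'n"
      show "ennreal \<bar>K2 (x - z) - K2 x\<bar> \<le> indicator {x. 2 * norm z \<le> norm x} x * ennreal \<bar>K2 (x - z) - K2 x\<bar> +
        ennreal (B1 * C0) * (\<lambda>x. if a / 2 \<le> norm x \<and> norm x \<le> 2 * a then ennreal (1 / norm x ^ ?n) else 0) (x - z)"
      proof (cases "2 * norm z \<le> norm x \<or> K2 (x - z) = 0")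
        case True
        then show ?thesis
          by (auto simp: K2_def trunc_kernel_def[of _ _ _ _ x] a_def)
      next
        case False
        then have "K2 x = 0" by (auto simp: K2_def trunc_kernel_def a_def)
        have "a \<le> norm (x - z)" using False by (auto simp: K2_def trunc_kernel_def split: if_splits)
        moreover have "norm (x - z) \<le> 2 * a"
        proof -
          have "norm x < 2 * norm z" using False by auto
          then show ?thesis using norm_triangle_ineq4[of x z] norm_ge_zero[of z] unfolding a_def by linarith
        qed
        moreover have "ennreal \<bar>K2 (x - z)\<bar> \<le> ennreal (B1 * C0) * ennreal (1 / norm (x - z) ^ ?n)"
        proof -
          have "\<bar>K2 (x - z)\<bar> \<le> B1 * C0 * (1 / norm (x - z) ^ ?n)"
            using trunc_kernel_size[of "max \<epsilon> a" R "x - z"] R \<epsilon> by (simp add: K2_def)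
          then have "ennreal \<bar>K2 (x - z)\<bar> \<le> ennreal (B1 * C0 * (1 / norm (x - z) ^ ?n))" by (rule ennreal_leI)
          also have "\<dots> = ennreal (B1 * C0) * ennreal (1 / norm (x - z) ^ ?n)"
            using B1 C0 by (intro ennreal_mult) auto
          finally show ?thesis .
        qed
        ultimately show ?thesis using \<open>K2 x = 0\<close> False a by simp
      qed
    qed
    also have "\<dots> = (\<integral>\<^sup>+x. indicator {x. 2 * norm z \<le> norm x} x * ennreal \<bar>K2 (x - z) - K2 x\<bar> \<partial>lborel) +
        ennreal (B1 * C0) * (\<integral>\<^sup>+x. (\<lambda>x. if a / 2 \<le> norm x \<and> norm x \<le> 2 * a then ennreal (1 / norm x ^ ?n) else 0) (x - z) \<partial>(lborel :: (real^'n) measure))"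
      by (subst nn_integral_add) (auto simp: nn_integral_cmult)
    also have "(\<integral>\<^sup>+x. (\<lambda>x. if a / 2 \<le> norm x \<and> norm x \<le> 2 * a then ennreal (1 / norm x ^ ?n) else 0) (x - z) \<partial>(lborel :: (real^'n) measure)) =
        (\<integral>\<^sup>+x. (if a / 2 \<le> norm x \<and> norm x \<le> 2 * a then ennreal (1 / norm x ^ ?n) else 0) \<partial>(lborel :: (real^'n) measure))"
      by (rule nn_integral_lborel_shift) measurable
    also have "(\<integral>\<^sup>+x. indicator {x. 2 * norm z \<le> norm x} x * ennreal \<bar>K2 (x - z) - K2 x\<bar> \<partial>lborel) +
        ennreal (B1 * C0) * (\<integral>\<^sup>+x. (if a / 2 \<le> norm x \<and> norm x \<le> 2 * a then ennreal (1 / norm x ^ ?n) else 0) \<partial>(lborel :: (real^'n) measure))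
      \<le> ennreal (hoermander_const ?n B1 B2 C0) + ennreal (B1 * C0) * ennreal (sphere_area ?n * 3)"
      using trunc_kernel_hoermander[of "max \<epsilon> a" R z] \<epsilon> R nn_integral_norm_annulus[OF a(1), where 'a="real^'n", unfolded DIM_vec]
      by (intro add_mono mult_left_mono) (auto simp: K2_def)
    also have "\<dots> = ennreal (hoermander_const ?n B1 B2 C0 + B1 * C0 * (sphere_area ?n * 3))"
    proof -
      have "0 \<le> hoermander_const CARD('n) B1 B2 C0"
        using B1 B2 C0 unfolding hoermander_const_def by (intro mult_nonneg_nonneg add_nonneg_nonneg) auto
      then show ?thesis using B1 C0 by (simp add: ennreal_mult)
    qed
    finally have "cmod (2 * fourier K2 \<xi>) \<le> hoermander_const ?n B1 B2 C0 + B1 * C0 * (sphere_area ?n * 3)"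
      using B1 B2 C0 unfolding hoermander_const_def
      by (subst (asm) ennreal_le_iff) (auto intro!: add_nonneg_nonneg mult_nonneg_nonneg)
    then show ?thesis by (simp add: norm_mult mult_ac)
  qed
  have "cmod (fourier K \<xi>) \<le> cmod (fourier K1 \<xi>) + cmod (fourier K2 \<xi>)"
    unfolding split by (rule norm_triangle_ineq)
  also have "\<dots> \<le> 2 * pi * B1 * C0 * sphere_area ?n + (hoermander_const ?n B1 B2 C0 + 3 * B1 * C0 * sphere_area ?n) / 2"
    using F1 F2 by (intro add_mono) auto
  finally show ?thesis unfolding fourier_const_def K_def .
qed

lemma trunc_kernel_cz:
  assumes \<epsilon>: "0 < \<epsilon>" and R: "0 < R" "R \<le> R1"
  shows "cz_kernel (fourier_const CARD('n) B1 B2 C0) (hoermander_const CARD('n) B1 B2 C0) (trunc_kernel \<Omega> \<gamma> \<epsilon> R)"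
  unfolding cz_kernel_def
  using trunc_kernel_integrable[OF \<epsilon>] trunc_kernel_bounded[OF \<epsilon>] trunc_kernel_fourier[OF assms] trunc_kernel_hoermander[OF assms]
  by blast

end

section \<open>The truncated fractional operators\<close>

lemma powr_root_add_le:
  fixes a b q :: real
  assumes "1 \<le> q" "0 \<le> a" "0 \<le> b"
  shows "(a + b) powr (1 / q) \<le> a powr (1 / q) + b powr (1 / q)"
proof -
  define u where "u = a powr (1 / q)"
  define v where "v = b powr (1 / q)"
  have uv: "0 \<le> u" "0 \<le> v" by (auto simp: u_def v_def)
  have "u powr q = a" "v powr q = b" using assms by (simp_all add: u_def v_def powr_powr)
  moreover have mono: "w powr q \<le> w * (u + v) powr (q - 1)" if "0 \<le> w" "w \<le> u + v" for w
  proof (cases "w = 0")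
    case False
    then have "w powr q = w * w powr (q - 1)" using that by (simp add: powr_diff)
    also have "\<dots> \<le> w * (u + v) powr (q - 1)" using that assms by (intro mult_left_mono powr_mono2) auto
    finally show ?thesis .
  qed (use assms in auto)
  moreover have "(u + v) * (u + v) powr (q - 1) = (u + v) powr q"
    using uv by (cases "u + v = 0") (auto simp: powr_diff)
  ultimately have "a + b \<le> (u + v) powr q"
    using mono[of u] mono[of v] uv by (simp add: distrib_right)
  then have "(a + b) powr (1 / q) \<le> ((u + v) powr q) powr (1 / q)"
    using assms by (intro powr_mono2) auto
  also have "\<dots> = u + v" using uv assms by (simp add: powr_powr)
  finally show ?thesis by (simp add: u_def v_def)
qed

lemma Lp_space_representative:
  fixes f f' :: "real^'n \<Rightarrow> real"
  assumes f: "f \<in> Lp_space p" and [measurable]: "f' \<in> borel_measurable borel" and ae: "AE x in lborel. f x = f' x"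
  shows "integrable lborel (\<lambda>x. \<bar>f' x\<bar> powr p)"
    and "(\<integral>x. \<bar>f x\<bar> powr p \<partial>lebesgue) = (\<integral>x. \<bar>f' x\<bar> powr p \<partial>lborel)"
proof -
  have [measurable]: "f \<in> borel_measurable lebesgue" and fi: "integrable lebesgue (\<lambda>x. \<bar>f x\<bar> powr p)"
    using f by (auto simp: Lp_space_def)
  have m: "(\<lambda>x. \<bar>f' x\<bar> powr p) \<in> borel_measurable lborel" by measurable
  have m': "(\<lambda>x. \<bar>f' x\<bar> powr p) \<in> borel_measurable lebesgue" by (rule measurable_completion[OF m])
  have ae': "AE x in lebesgue. \<bar>f x\<bar> powr p = \<bar>f' x\<bar> powr p"
    using AE_completion[OF ae] by eventually_elim simp
  have mf: "(\<lambda>x. \<bar>f x\<bar> powr p) \<in> borel_measurable lebesgue" by measurable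
  show "integrable lborel (\<lambda>x. \<bar>f' x\<bar> powr p)"
    using fi integrable_cong_AE[OF mf m' ae'] integrable_completion[OF m] by simp
  show "(\<integral>x. \<bar>f x\<bar> powr p \<partial>lebesgue) = (\<integral>x. \<bar>f' x\<bar> powr p \<partial>lborel)"
    using integral_cong_AE[OF mf m' ae'] integral_completion[OF m] by simp
qed

text \<open>
  A Lebesgue measurable function differs from a Borel representative on a null set, and reflections and
  translations preserve null sets; so the operator may be evaluated on the representative.
\<close>

lemma T_op_eq_conv:
  fixes f f' :: "real^'n \<Rightarrow> real"
  assumes \<Omega>: "dini_kernel B1 B2 \<Omega>" and \<epsilon>: "0 < \<epsilon>"
    and [measurable]: "f' \<in> borel_measurable borel" and ae: "AE x in lborel. f x = f' x"
  shows "T_op \<Omega> \<beta> \<epsilon> f x = conv (\<lambda>y. if \<epsilon> \<le> norm y then \<Omega> y / norm y powr (real CARD('n) - \<beta>) else 0) f' x"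
proof -
  define K where "K y = (if \<epsilon> \<le> norm y then \<Omega> y / norm y powr (real CARD('n) - \<beta>) else 0)" for y :: "real^'n"
  have [measurable]: "K \<in> borel_measurable borel"
    using borel_measurable_if_dini[OF \<Omega> \<epsilon>, of "\<lambda>_. True"] by (simp add: K_def[abs_def])
  have m: "(\<lambda>y. f' (x - y) * K y) \<in> borel_measurable lborel" by measurable
  have m': "(\<lambda>y. f' (x - y) * K y) \<in> borel_measurable lebesgue" by (rule measurable_completion[OF m])
  have refl: "distr lborel borel (\<lambda>y. x - y) = lborel" using distr_lborel_affine[of "-1" x] by simp
  have "AE z in distr lborel borel (\<lambda>y. x - y). f z = f' z" unfolding refl by (rule ae)
  then have "AE y in lborel. f (x - y) = f' (x - y)" by (rule AE_distrD[rotated]) simp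
  then have ae2: "AE y in lebesgue. f' (x - y) * K y =
      indicator {y. \<epsilon> \<le> norm y} y *\<^sub>R (\<Omega> y / norm y powr (real CARD('n) - \<beta>) * f (x - y))"
    by (rule eventually_mono[OF AE_completion]) (auto simp: K_def)
  have "T_op \<Omega> \<beta> \<epsilon> f x = (\<integral>y. f' (x - y) * K y \<partial>lebesgue)"
    unfolding T_op_def set_lebesgue_integral_def
    by (rule integral_cong_AE[OF borel_measurable_AE[OF m' ae2] m']) (use ae2 in \<open>auto simp: eq_commute\<close>)
  also have "\<dots> = conv f' K x" unfolding conv_def by (rule integral_completion[OF m])
  also have "\<dots> = conv K f' x" by (rule conv_commute) auto
  finally show ?thesis by (simp add: K_def[abs_def])
qed

theorem theorem1p2:
  fixes q B1 B2 \<beta>0 :: real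
  assumes "0 < \<beta>0" "\<beta>0 < 1 / 2" "1 < q" "0 < B1" "0 < B2"
  shows "\<exists>C::real. \<forall>\<Omega> :: real^'n \<Rightarrow> real. dini_kernel B1 B2 \<Omega> \<longrightarrow>
    (\<forall>f \<in> Lp_space 1 \<inter> Lp_space q. \<forall>\<epsilon> > 0. \<forall>\<beta> > 0.
       \<beta> < min (1 - \<beta>0) ((q - 1) * real CARD('n) / q) \<longrightarrow>
       T_op \<Omega> \<beta> \<epsilon> f \<in> Lp_space q \<and>
       Lp_norm q (T_op \<Omega> \<beta> \<epsilon> f) \<le>
         C * (Lp_norm q f +
              \<beta> powr ((q - 1) * real CARD('n) / q)
                / (real CARD('n) * (q - 1) - \<beta> * q) powr (1 / q)
                * Lp_norm 1 f))"
proof -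
  let ?n = "real CARD('n)"
  have q: "1 < q" and B: "0 < B1" "0 < B2" by fact+
  define C0 :: real where "C0 = exp 1"
  have C0: "0 < C0" by (simp add: C0_def)
  have area: "0 < sphere_area CARD('n)" by (simp add: sphere_area_def)
  have H: "0 < hoermander_const CARD('n) B1 B2 C0"
    unfolding hoermander_const_def using area B C0 by (intro mult_pos_pos add_pos_pos) auto
  have A: "0 < fourier_const CARD('n) B1 B2 C0"
    unfolding fourier_const_def using area B C0 H by (intro add_pos_pos divide_pos_pos mult_pos_pos) auto
  obtain Cn where Cn: "0 < Cn" and near: "\<And>K :: real^'n \<Rightarrow> real.
     cz_kernel (fourier_const CARD('n) B1 B2 C0) (hoermander_const CARD('n) B1 B2 C0) K \<Longrightarrow> Lq_bounded q Cn K"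
    using calderon_zygmund[OF A H q, where 'a="real^'n"] by blast
  define Cf where "Cf = B1 powr q * sphere_area CARD('n) * exp q"
  have Cf: "0 < Cf" unfolding Cf_def using B area by simp
  define C where "C = 2 * (Cn powr (1 / q) + Cf powr (1 / q))"
  show ?thesis
  proof (intro exI[of _ C] allI impI ballI)
    fix \<Omega> :: "real^'n \<Rightarrow> real" and f :: "real^'n \<Rightarrow> real" and \<epsilon> \<beta> :: real
    assume \<Omega>: "dini_kernel B1 B2 \<Omega>" and f: "f \<in> Lp_space 1 \<inter> Lp_space q" and \<epsilon>: "0 < \<epsilon>"
      and \<beta>: "0 < \<beta>" "\<beta> < min (1 - \<beta>0) ((q - 1) * ?n / q)"
    define \<gamma> where "\<gamma> = ?n - \<beta>"
    have n1: "1 \<le> ?n" by (simp add: Suc_leI)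
    have "\<beta> < 1" using \<beta>(2) assms(1) by simp
    then have \<gamma>: "0 < \<gamma>" "\<gamma> \<le> ?n" using \<beta>(1) n1 unfolding \<gamma>_def by linarith+
    \<comment> \<open>The splitting radius: large enough for the norm of the far kernel to gain the power of \<open>\<beta>\<close>, and
      small enough for \<open>R powr \<beta>\<close> to stay bounded.\<close>
    define R where "R = 1 / \<beta>"
    have R: "0 < R" using \<beta> by (simp add: R_def)
    have Rb: "R powr \<beta> \<le> C0"
    proof -
      have "\<beta> * ln R \<le> \<beta> * R" using \<beta> R by (intro mult_left_mono order_trans[OF ln_le_minus_one]) auto
      also have "\<dots> = 1" using \<beta> by (simp add: R_def)
      finally show ?thesis using R by (simp add: powr_def C0_def)
    qed
    have size: "1 / r powr \<gamma> \<le> C0 / r ^ CARD('n)" if r: "0 < r" "r < R" for r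
    proof -
      have "1 / r powr \<gamma> = r powr \<beta> / r ^ CARD('n)"
        using r by (simp add: \<gamma>_def powr_diff powr_realpow)
      also have "r powr \<beta> \<le> R powr \<beta>" using r \<beta> by (intro powr_mono2) auto
      then have "r powr \<beta> / r ^ CARD('n) \<le> C0 / r ^ CARD('n)"
        using Rb r by (intro divide_right_mono) auto
      finally show ?thesis .
    qed
    define d where "d = ?n * (q - 1) - \<beta> * q"
    have d: "0 < d"
    proof -
      have "\<beta> * q < (q - 1) * ?n / q * q" using \<beta>(2) q by (intro mult_strict_right_mono) auto
      then show ?thesis using q by (simp add: d_def mult.commute)
    qed
    have \<gamma>q: "\<gamma> * q - ?n = d" by (simp add: \<gamma>_def d_def algebra_simps)
    have fm: "f \<in> borel_measurable lebesgue" using f by (auto simp: Lp_space_def)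
    obtain f' where f'm: "f' \<in> borel_measurable lborel" and ae: "AE x in lborel. f x = f' x"
      using completion_ex_borel_measurable_real[OF fm] by blast
    have [measurable]: "f' \<in> borel_measurable borel" using f'm by simp
    note rep1 = Lp_space_representative[OF IntD1[OF f] _ ae]
    note repq = Lp_space_representative[OF IntD2[OF f] _ ae]
    define F where "F = (\<integral>x. \<bar>f' x\<bar> powr q \<partial>lborel)"
    define L where "L = (\<integral>x. \<bar>f' x\<bar> \<partial>lborel)"
    have F0: "0 \<le> F" unfolding F_def by (intro Bochner_Integration.integral_nonneg) auto
    have L0: "0 \<le> L" unfolding L_def by (intro Bochner_Integration.integral_nonneg) auto
    have F: "Lp_norm q f = F powr (1 / q)" by (simp add: Lp_norm_def F_def repq(2))
    have "(\<integral>x. \<bar>f x\<bar> \<partial>lebesgue) = L" using rep1(2) by (simp add: L_def)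
    then have L: "Lp_norm 1 f = L" using L0 by (simp add: Lp_norm_def)
    have f'1: "integrable lborel f'" using rep1(1) by (subst integrable_abs_iff[symmetric]) auto
    have \<Omega>_le: "\<bar>\<Omega> y\<bar> \<le> B1" if "y \<noteq> 0" for y using \<Omega> that by (simp add: dini_kernel_def)
    define Kn where "Kn = trunc_kernel \<Omega> \<gamma> \<epsilon> R"
    define Kf where "Kf y = (if max \<epsilon> R \<le> norm y then \<Omega> y / norm y powr \<gamma> else 0)" for y
    define K where "K y = (if \<epsilon> \<le> norm y then \<Omega> y / norm y powr \<gamma> else 0)" for y
    have [measurable]: "Kn \<in> borel_measurable borel"
      unfolding Kn_def by (rule trunc_kernel_measurable[OF \<Omega> B \<gamma> C0 size \<epsilon>])
    have [measurable]: "K \<in> borel_measurable borel"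
      using borel_measurable_if_dini[OF \<Omega> \<epsilon>, of "\<lambda>_. True"] by (simp add: K_def[abs_def])
    have pos: "0 < max \<epsilon> R" using \<epsilon> by simp
    have [measurable]: "Kf \<in> borel_measurable borel"
      using borel_measurable_if_dini[OF \<Omega> pos, of "\<lambda>_. True"] by (simp add: Kf_def[abs_def])
    have T: "T_op \<Omega> \<beta> \<epsilon> f = conv K f'"
      unfolding K_def[abs_def] \<gamma>_def by (rule ext, rule T_op_eq_conv[OF \<Omega> \<epsilon> _ ae]) simp
    have Tsplit: "conv K f' x = conv Kn f' x + conv Kf f' x" for x
    proof -
      have "integrable lborel (\<lambda>y. Kn (x - y) * f' y)"
        unfolding Kn_def
        by (rule conv_integrand_integrable1[OF trunc_kernel_integrable[OF \<Omega> B \<gamma> C0 size \<epsilon>]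
            trunc_kernel_bounded[OF \<Omega> B \<gamma> C0 size \<epsilon>] f'1])
      moreover have "integrable lborel (\<lambda>y. Kf (x - y) * f' y)"
      proof (rule Bochner_Integration.integrable_bound[where f = "\<lambda>y. B1 / \<epsilon> powr \<gamma> * f' y"])
        have Kf_le: "\<bar>Kf y\<bar> \<le> B1 / \<epsilon> powr \<gamma>" for y
        proof (cases "max \<epsilon> R \<le> norm y")
          case True
          then have "y \<noteq> 0" using \<epsilon> by auto
          with True have "\<bar>\<Omega> y\<bar> / norm y powr \<gamma> \<le> B1 / \<epsilon> powr \<gamma>"
            using \<epsilon> \<gamma> B \<Omega>_le[of y] by (intro frac_le powr_mono2) auto
          then show ?thesis using True by (simp add: Kf_def abs_divide)
        qed (use B in \<open>auto simp: Kf_def\<close>)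
        show "AE y in lborel. norm (Kf (x - y) * f' y) \<le> norm (B1 / \<epsilon> powr \<gamma> * f' y)"
        proof (intro AE_I2)
          fix y show "norm (Kf (x - y) * f' y) \<le> norm (B1 / \<epsilon> powr \<gamma> * f' y)"
            using mult_right_mono[OF Kf_le[of "x - y"], of "\<bar>f' y\<bar>"] B by (simp add: abs_mult)
        qed
      qed (use f'1 in auto)
      moreover have "K y = Kn y + Kf y" for y
        by (auto simp: K_def Kn_def Kf_def trunc_kernel_def)
      ultimately show ?thesis unfolding conv_def by (simp add: distrib_right)
    qed
    have N: "int_powr q (conv Kn f') \<le> ennreal (Cn * F)"
    proof -
      have "Lq_bounded q Cn Kn"
        unfolding Kn_def by (intro near trunc_kernel_cz[OF \<Omega> B \<gamma> C0 size \<epsilon> R]) auto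
      then have "int_powr q (conv Kn f') \<le> ennreal Cn * int_powr q f'"
        by (auto simp: Lq_bounded_def)
      also have "int_powr q f' = ennreal F"
        unfolding F_def by (intro nn_integral_eq_integral repq(1)) auto
      finally show ?thesis using Cn F0 by (simp add: ennreal_mult)
    qed
    \<comment> \<open>The exponent of \<open>R\<close> in the integral of the power \<open>q\<close> of the far kernel is \<open>- d = - n * (q - 1) + \<beta> * q\<close>; its second
      part is absorbed by \<open>R powr \<beta> \<le> C0\<close>.\<close>
    define E where "E = \<beta> powr (?n * (q - 1)) / d"
    have E0: "0 \<le> E" using d by (simp add: E_def)
    have Fr: "int_powr q (conv Kf f') \<le> ennreal (L powr q * (Cf * E))"
    proof -
      have "int_powr q Kf \<le>
        (\<integral>\<^sup>+x. ennreal (B1 powr q) * (if R \<le> norm x then ennreal (norm x powr - (\<gamma> * q)) else 0) \<partial>(lborel :: (real^'n) measure))"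
      proof (intro nn_integral_mono)
        fix x :: "real^'n"
        show "ennreal (\<bar>Kf x\<bar> powr q) \<le> ennreal (B1 powr q) * (if R \<le> norm x then ennreal (norm x powr - (\<gamma> * q)) else 0)"
        proof (cases "max \<epsilon> R \<le> norm x")
          case True
          then have x: "x \<noteq> 0" "0 < norm x" using R by auto
          have "\<bar>Kf x\<bar> \<le> B1 / norm x powr \<gamma>"
            using True x by (auto simp: Kf_def abs_divide intro!: divide_right_mono \<Omega>_le)
          then have "\<bar>Kf x\<bar> powr q \<le> (B1 / norm x powr \<gamma>) powr q" using q by (intro powr_mono2) auto
          also have "\<dots> = B1 powr q * norm x powr - (\<gamma> * q)"
            using B by (simp add: powr_divide powr_powr powr_minus_divide)
          finally have "ennreal (\<bar>Kf x\<bar> powr q) \<le> ennreal (B1 powr q * norm x powr - (\<gamma> * q))" by (rule ennreal_leI)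
          then show ?thesis using True by (simp add: ennreal_mult)
        qed (use q in \<open>auto simp: Kf_def\<close>)
      qed
      also have "\<dots> = ennreal (B1 powr q) * (\<integral>\<^sup>+x. (if R \<le> norm x then ennreal (norm x powr - (\<gamma> * q)) else 0) \<partial>(lborel :: (real^'n) measure))"
        by (rule nn_integral_cmult) measurable
      also have "(\<integral>\<^sup>+x. (if R \<le> norm x then ennreal (norm x powr - (\<gamma> * q)) else 0) \<partial>(lborel :: (real^'n) measure)) =
        ennreal (sphere_area CARD('n) * (R powr (?n - \<gamma> * q) / (\<gamma> * q - ?n)))"
        using nn_integral_norm_far[OF R, of "\<gamma> * q", where 'a="real^'n", unfolded DIM_vec] d \<gamma>q by simp
      also have "ennreal (B1 powr q) * \<dots> \<le> ennreal (B1 powr q) * ennreal (sphere_area CARD('n) * (exp q * \<beta> powr (?n * (q - 1)) / d))"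
      proof (rule mult_left_mono, rule ennreal_leI)
        have "?n - \<gamma> * q = - (?n * (q - 1)) + \<beta> * q" using \<gamma>q by (simp add: d_def)
        then have "R powr (?n - \<gamma> * q) = R powr (- (?n * (q - 1))) * (R powr \<beta>) powr q"
          by (simp only: powr_add powr_powr)
        also have "R powr (- (?n * (q - 1))) = \<beta> powr (?n * (q - 1))"
          using \<beta> by (simp add: R_def powr_minus_divide powr_divide)
        finally have Rd: "R powr (?n - \<gamma> * q) = (R powr \<beta>) powr q * \<beta> powr (?n * (q - 1))" by (simp add: mult.commute)
        have "(R powr \<beta>) powr q \<le> C0 powr q" using Rb q by (intro powr_mono2) auto
        also have "C0 powr q = exp q" by (simp add: C0_def powr_def)
        finally have "R powr (?n - \<gamma> * q) \<le> exp q * \<beta> powr (?n * (q - 1))"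
          unfolding Rd by (rule mult_right_mono) simp
        then show "sphere_area CARD('n) * (R powr (?n - \<gamma> * q) / (\<gamma> * q - ?n)) \<le> sphere_area CARD('n) * (exp q * \<beta> powr (?n * (q - 1)) / d)"
          unfolding \<gamma>q using d by (intro mult_left_mono divide_right_mono) auto
      qed auto
      also have "\<dots> = ennreal (Cf * E)"
        using d by (subst ennreal_mult[symmetric]) (auto simp: Cf_def E_def)
      finally have KfE: "int_powr q Kf \<le> ennreal (Cf * E)" .
      have "conv Kf f' = conv f' Kf" by (rule ext) (rule conv_commute; simp)
      then have "int_powr q (conv Kf f') \<le> ennreal (L powr q) * int_powr q Kf"
        using conv_young[OF q f'1, of Kf] by (simp add: L_def)
      also have "\<dots> \<le> ennreal (L powr q) * ennreal (Cf * E)" by (intro mult_left_mono KfE) auto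
      also have "\<dots> = ennreal (L powr q * (Cf * E))" using Cf E0 by (intro ennreal_mult[symmetric]) auto
      finally show ?thesis .
    qed
    define S where "S = 2 powr q * (Cn * F + L powr q * (Cf * E))"
    have S0: "0 \<le> Cn * F" "0 \<le> L powr q * (Cf * E)" using Cn F0 Cf E0 by auto
    have TS: "int_powr q (conv K f') \<le> ennreal S"
    proof -
      have "int_powr q (conv K f') \<le> ennreal (2 powr q) *
        (int_powr q (conv Kn f') + int_powr q (conv Kf f'))"
        unfolding Tsplit using q by (intro powr_add_le_nn) auto
      also have "\<dots> \<le> ennreal (2 powr q) * (ennreal (Cn * F) + ennreal (L powr q * (Cf * E)))"
        by (intro mult_left_mono add_mono N Fr) auto
      also have "\<dots> = ennreal S" unfolding S_def using S0 by (simp add: ennreal_mult ennreal_plus[symmetric] del: ennreal_plus)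
      finally show ?thesis .
    qed
    have m: "(\<lambda>x. \<bar>conv K f' x\<bar> powr q) \<in> borel_measurable lborel" by measurable
    have Ti: "integrable lborel (\<lambda>x. \<bar>conv K f' x\<bar> powr q)"
      by (intro integrableI_nonneg m) (auto intro: le_less_trans[OF TS])
    have TS': "(\<integral>x. \<bar>conv K f' x\<bar> powr q \<partial>lborel) \<le> S"
      using TS S0 unfolding nn_integral_eq_integral[OF Ti AE_I2[OF powr_ge_zero]]
      by (subst (asm) ennreal_le_iff) (auto simp: S_def)
    have "conv K f' \<in> borel_measurable lebesgue" by (rule measurable_completion) simp
    then have mem: "T_op \<Omega> \<beta> \<epsilon> f \<in> Lp_space q"
      unfolding T Lp_space_def using Ti integrable_completion[OF m] by simp
    have "Lp_norm q (T_op \<Omega> \<beta> \<epsilon> f) = (\<integral>x. \<bar>conv K f' x\<bar> powr q \<partial>lborel) powr (1 / q)"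
      unfolding T Lp_norm_def by (simp add: integral_completion[OF m])
    also have "\<dots> \<le> S powr (1 / q)"
      using TS' q by (intro powr_mono2) (auto intro!: Bochner_Integration.integral_nonneg)
    also have "\<dots> = 2 * (Cn * F + L powr q * (Cf * E)) powr (1 / q)"
      unfolding S_def using S0 q by (simp add: powr_mult powr_powr)
    also have "\<dots> \<le> 2 * ((Cn * F) powr (1 / q) + (L powr q * (Cf * E)) powr (1 / q))"
      using S0 q by (intro mult_left_mono powr_root_add_le) auto
    also have "(Cn * F) powr (1 / q) = Cn powr (1 / q) * Lp_norm q f"
      unfolding F using Cn F0 by (simp add: powr_mult)
    also have "(L powr q * (Cf * E)) powr (1 / q) = Cf powr (1 / q) * (E powr (1 / q) * L)"
      using L0 Cf E0 q by (simp add: powr_mult powr_powr)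
    also have "E powr (1 / q) = \<beta> powr ((q - 1) * ?n / q) / (?n * (q - 1) - \<beta> * q) powr (1 / q)"
      unfolding E_def d_def[symmetric] using d \<beta> by (simp add: powr_divide powr_powr mult.commute)
    finally have "Lp_norm q (T_op \<Omega> \<beta> \<epsilon> f) \<le> 2 * (Cn powr (1 / q) * Lp_norm q f +
       Cf powr (1 / q) * (\<beta> powr ((q - 1) * ?n / q) / (?n * (q - 1) - \<beta> * q) powr (1 / q) * Lp_norm 1 f))"
      unfolding L .
    also have "\<dots> \<le> 2 * ((Cn powr (1 / q) + Cf powr (1 / q)) * Lp_norm q f +
       (Cn powr (1 / q) + Cf powr (1 / q)) * (\<beta> powr ((q - 1) * ?n / q) / (?n * (q - 1) - \<beta> * q) powr (1 / q) * Lp_norm 1 f))"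
      using L0 by (intro mult_left_mono add_mono mult_right_mono) (auto simp: F L)
    also have "\<dots> = C * (Lp_norm q f + \<beta> powr ((q - 1) * ?n / q) / (?n * (q - 1) - \<beta> * q) powr (1 / q) * Lp_norm 1 f)"
    proof -
      have "2 * (c * u + c * v) = 2 * c * (u + v)" for c u v :: real by (simp add: algebra_simps)
      then show ?thesis unfolding C_def .
    qed
    finally show "T_op \<Omega> \<beta> \<epsilon> f \<in> Lp_space q \<and>
       Lp_norm q (T_op \<Omega> \<beta> \<epsilon> f) \<le> C * (Lp_norm q f + \<beta> powr ((q - 1) * ?n / q) / (?n * (q - 1) - \<beta> * q) powr (1 / q) * Lp_norm 1 f)"
      using mem by blast
  qed
qed

end
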